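(* Let $T$ be a (non-degenerate) triangle in the plane with area $A$ and perimeter $L$, and let $\lambda_T$ be the first eigenvalue of the Dirichlet Laplacian on $T$. Then $$\frac{\pi^2 L^2}{16A^2}\leq\lambda_T\leq \frac{\pi^2 L^2}{9A^2}.$$ Moreover, the constants $9$ and $16$ are optimal, that is: for every real $c>9$ there exists a triangle $T$ with area $A$ and perimeter $L$ such that $\lambda_T>\frac{\pi^2L^2}{cA^2}$, and for every real $c$ with $0<c<16$ there exists a triangle $T$ with area $A$ and perimeter $L$ such that $\lambda_T<\frac{\pi^2L^2}{cA^2}$.
   Context: The first eigenvalue of the Dirichlet Laplacian on a triangle $T$ is the smallest $\lambda$ for which the problem $-\Delta u=\lambda u$ in the interior of $T$, $u=0$ on the boundary of $T$, has a nonzero solution; equivalently, $\lambda_T=\inf\left\{\int_T|\nabla\psi|^2\big/\int_T\psi^2 : 0\neq\psi\in H^1_0(T)\right\}$, where $H^1_0(T)$ is the Sobolev space of functions on the interior of $T$ vanishing on the boundary. *)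

theory Defs
  imports "HOL-Analysis.Analysis"
begin

definition partial_deriv :: "'n::finite \<Rightarrow> (real ^ 'n \<Rightarrow> real) \<Rightarrow> real ^ 'n \<Rightarrow> real" where
  "partial_deriv i f x = frechet_derivative f (at x) (axis i 1)"

definition gradient :: "(real ^ 'n::finite \<Rightarrow> real) \<Rightarrow> real ^ 'n \<Rightarrow> real ^ 'n" where
  "gradient f x = (\<chi> i. partial_deriv i f x)"

primrec C_k :: "nat \<Rightarrow> (real ^ 'n::finite \<Rightarrow> real) \<Rightarrow> bool" where
  "C_k 0 f \<longleftrightarrow> continuous_on UNIV f"
| "C_k (Suc k) f \<longleftrightarrow> (\<forall>x. f differentiable (at x)) \<and> (\<forall>i. C_k k (partial_deriv i f))"

definition test_function :: "(real ^ 'n::finite) set \<Rightarrow> (real ^ 'n \<Rightarrow> real) \<Rightarrow> bool" where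
  "test_function \<Omega> \<phi> \<longleftrightarrow> (\<forall>k. C_k k \<phi>) \<and>
     compact (closure {x. \<phi> x \<noteq> 0}) \<and> closure {x. \<phi> x \<noteq> 0} \<subseteq> \<Omega>"

definition L2_on :: "(real ^ 'n::finite) set \<Rightarrow> (real ^ 'n \<Rightarrow> 'b::euclidean_space) \<Rightarrow> bool" where
  "L2_on \<Omega> f \<longleftrightarrow> f \<in> borel_measurable (lebesgue_on \<Omega>) \<and>
     integrable (lebesgue_on \<Omega>) (\<lambda>x. (norm (f x))\<^sup>2)"

definition weak_gradient ::
    "(real ^ 'n::finite) set \<Rightarrow> (real ^ 'n \<Rightarrow> real) \<Rightarrow> (real ^ 'n \<Rightarrow> real ^ 'n) \<Rightarrow> bool" where
  "weak_gradient \<Omega> u g \<longleftrightarrow> (\<forall>\<phi> i. test_function \<Omega> \<phi> \<longrightarrow>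
     (LINT x|lebesgue_on \<Omega>. u x * partial_deriv i \<phi> x) =
     - (LINT x|lebesgue_on \<Omega>. g x $ i * \<phi> x))"

text \<open>
  Since the weak gradient is determined only almost everywhere, an element of a Sobolev space is
  represented by a pair of a function and a version of its weak gradient.
\<close>

definition H1 :: "(real ^ 'n::finite) set \<Rightarrow> ((real ^ 'n \<Rightarrow> real) \<times> (real ^ 'n \<Rightarrow> real ^ 'n)) set" where
  "H1 \<Omega> = {(u, g). L2_on \<Omega> u \<and> L2_on \<Omega> g \<and> weak_gradient \<Omega> u g}"

text \<open>Functions vanishing on the boundary: the closure of the test functions in the norm of \<open>H1\<close>.\<close>

definition H1_0 :: "(real ^ 'n::finite) set \<Rightarrow> ((real ^ 'n \<Rightarrow> real) \<times> (real ^ 'n \<Rightarrow> real ^ 'n)) set" where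
  "H1_0 \<Omega> = {(u, g) \<in> H1 \<Omega>. \<exists>\<phi> :: nat \<Rightarrow> real ^ 'n \<Rightarrow> real. (\<forall>k. test_function \<Omega> (\<phi> k)) \<and>
     (\<lambda>k. (LINT x|lebesgue_on \<Omega>. (\<phi> k x - u x)\<^sup>2) +
          (LINT x|lebesgue_on \<Omega>. (norm (gradient (\<phi> k) x - g x))\<^sup>2)) \<longlonglongrightarrow> 0}"

text \<open>
  The infimum of the Rayleigh quotient; a nonzero element of \<open>H1_0\<close> is one that does not vanish
  almost everywhere. For a nonempty bounded open set the set of quotients is nonempty and bounded
  below by 0, so the real-valued \<open>Inf\<close> is the genuine infimum.
\<close>

definition first_dirichlet_eigenvalue :: "(real ^ 'n::finite) set \<Rightarrow> real" where
  "first_dirichlet_eigenvalue \<Omega> =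
     Inf {(LINT x|lebesgue_on \<Omega>. (norm (g x))\<^sup>2) / (LINT x|lebesgue_on \<Omega>. (u x)\<^sup>2) | u g.
            (u, g) \<in> H1_0 \<Omega> \<and> \<not> (AE x in lebesgue_on \<Omega>. u x = 0)}"

definition triangle_area :: "real ^ 2 \<Rightarrow> real ^ 2 \<Rightarrow> real ^ 2 \<Rightarrow> real" where
  "triangle_area a b c = measure lebesgue (convex hull {a, b, c})"

definition triangle_perimeter :: "real ^ 2 \<Rightarrow> real ^ 2 \<Rightarrow> real ^ 2 \<Rightarrow> real" where
  "triangle_perimeter a b c = dist a b + dist b c + dist c a"

definition triangle_eigenvalue :: "real ^ 2 \<Rightarrow> real ^ 2 \<Rightarrow> real ^ 2 \<Rightarrow> real" where
  "triangle_eigenvalue a b c = first_dirichlet_eigenvalue (interior (convex hull {a, b, c}))"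

end

theory Submission
  imports Defs
begin

text \<open>Let \<open>a\<close>, \<open>b\<close>, \<open>c\<close> be the side lengths, \<open>x = a^2\<close>, \<open>y = b^2\<close>, \<open>z = c^2\<close>, and \<open>\<rho> = 2 A / L\<close> the inradius.

Lower bound. The claim is \<open>\<lambda> \<ge> (\<pi> / (2 \<rho>))^2\<close>. The angle bisectors cut the triangle into three pieces,
each consisting of the points nearest to one side. A line perpendicular to that side runs inside the
piece from the side to a point at distance at most \<open>\<rho>\<close>, and on it a test function vanishes at the side.
The one-dimensional inequality with a free end (\<open>wirtinger_free_end\<close>), integrated over all these lines,
gives the bound; \<open>side_region\<close> does this for one piece.

Upper bound. The claim is \<open>4 A^2 \<lambda> \<le> (4 \<pi>^2 / 9) (a + b + c)^2\<close>. For a function \<open>F\<close> of the barycentric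
coordinates, \<open>4 A^2 |\<nabla> F|^2\<close> is a quadratic form in the partial derivatives of \<open>F\<close> whose coefficients
are linear in \<open>x, y, z\<close>. So a fixed \<open>F\<close> vanishing on the boundary bounds \<open>4 A^2 \<lambda>\<close> by a linear function
of \<open>x, y, z\<close>, with integrals over one standard simplex (\<open>trial.eigenvalue_le\<close>). The sum of the sines of
\<open>2 \<pi>\<close> times the coordinates, which is the first eigenfunction of the equilateral triangle, gives
\<open>(4 \<pi>^2 / 3) (x + y + z)\<close>. This agrees with the claim for the equilateral triangle, but exceeds it to
second order near it. Adding a multiple of \<open>uvw (s1 u^2 + s2 v^2 + s3 w^2)\<close>, with coefficients
proportional to the deviations of \<open>x, y, z\<close> from their mean, lowers the quotient by a larger second order
term (\<open>near_equilateral_bound\<close>). This is good enough unless one side is shorter than a fifth of the sum of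
the other two; then a polynomial concentrated near the short side works (\<open>thin_triangle_bound\<close>). What
remains is a homogeneous polynomial inequality of degree six in \<open>a, b, c\<close> on a polyhedral cone
(\<open>side_poly_nonneg\<close>): the cone is the union of two simplicial ones, and in the coordinates of each of
them all coefficients are nonnegative.

Optimality. The constant 9 is attained by the equilateral triangle: with the positive eigenfunction
\<open>\<Psi>\<close>, the integral of \<open>|\<nabla> \<phi>|^2 - \<lambda> \<phi>^2\<close> is that of \<open>|\<nabla> \<phi> - \<phi> \<nabla> (ln \<Psi>)|^2\<close>
(\<open>equilateral_eigenvalue_ge\<close>). For the constant 16, a long right triangle with a leg of length 1
contains a long rectangle whose height is nearly 1 (\<open>right_triangle_eigenvalue_le\<close>).

Both kinds of estimate reduce to smooth functions. A lower bound passes from test functions to their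
closure (\<open>first_eigenvalue_ge\<close>). For an upper bound, a smooth function that vanishes on the boundary is
approximated by test functions obtained by composing it with functions that vanish near 0
(\<open>first_eigenvalue_le\<close>).\<close>

section \<open>Smooth functions\<close>

lemma partial_deriv_eq:
  assumes "(f has_derivative f') (at x)"
  shows "partial_deriv i f x = f' (axis i 1)"
  using frechet_derivative_at[OF assms] by (simp add: partial_deriv_def)

lemma C_k_Suc_imp_C_k: "C_k (Suc k) f \<Longrightarrow> C_k k f"
proof (induction k arbitrary: f)
  case 0
  then show ?case
    by (auto intro!: continuous_at_imp_continuous_on differentiable_imp_continuous_within)
next
  case (Suc k)
  then show ?case by simp
qed

abbreviation smooth :: "(real ^ 'n::finite \<Rightarrow> real) \<Rightarrow> bool"
  where "smooth f \<equiv> (\<forall>k. C_k k f)"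

lemma smooth_differentiable: "smooth f \<Longrightarrow> f differentiable (at x)"
  by (metis C_k.simps(2))

lemma smooth_partial_deriv: "smooth f \<Longrightarrow> smooth (partial_deriv i f)"
  by (metis C_k.simps(2))

lemma smooth_continuous: "smooth f \<Longrightarrow> continuous_on A f"
  by (metis C_k.simps(1) continuous_on_subset top_greatest)

lemma C_k_add: "C_k k f \<Longrightarrow> C_k k g \<Longrightarrow> C_k k (\<lambda>x. f x + g x)"
proof (induction k arbitrary: f g)
  case 0
  then show ?case by (auto intro: continuous_intros)
next
  case (Suc k)
  have "partial_deriv i (\<lambda>x. f x + g x) = (\<lambda>x. partial_deriv i f x + partial_deriv i g x)" for i
  proof
    fix x
    have "(f has_derivative frechet_derivative f (at x)) (at x)"
      "(g has_derivative frechet_derivative g (at x)) (at x)"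
      using Suc.prems by (auto simp: frechet_derivative_works[symmetric])
    from partial_deriv_eq[OF has_derivative_add[OF this]]
    show "partial_deriv i (\<lambda>x. f x + g x) x = partial_deriv i f x + partial_deriv i g x"
      by (simp add: partial_deriv_def)
  qed
  with Suc show ?case by auto
qed

lemma C_k_mult: "C_k k f \<Longrightarrow> C_k k g \<Longrightarrow> C_k k (\<lambda>x. f x * g x)"
proof (induction k arbitrary: f g)
  case 0
  then show ?case by (auto intro: continuous_intros)
next
  case (Suc k)
  have eq: "partial_deriv i (\<lambda>x. f x * g x) = (\<lambda>x. f x * partial_deriv i g x + partial_deriv i f x * g x)" for i
  proof
    fix x
    have "(f has_derivative frechet_derivative f (at x)) (at x)"
      "(g has_derivative frechet_derivative g (at x)) (at x)"
      using Suc.prems by (auto simp: frechet_derivative_works[symmetric])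
    from partial_deriv_eq[OF has_derivative_mult[OF this]]
    show "partial_deriv i (\<lambda>x. f x * g x) x = f x * partial_deriv i g x + partial_deriv i f x * g x"
      by (simp add: partial_deriv_def)
  qed
  have "C_k k f" "C_k k g" using Suc.prems C_k_Suc_imp_C_k by blast+
  with Suc eq show ?case by (auto intro!: C_k_add)
qed

lemma C_k_compose:
  fixes F :: "nat \<Rightarrow> real \<Rightarrow> real"
  assumes "\<And>n t. (F n has_real_derivative F (Suc n) t) (at t)" and "C_k k f"
  shows "C_k k (\<lambda>x. F n (f x))"
  using assms(2)
proof (induction k arbitrary: n f)
  case 0
  have "continuous_on UNIV (F n)"
    using assms(1) by (meson DERIV_isCont continuous_at_imp_continuous_on)
  with 0 show ?case by (auto intro: continuous_on_compose2)
next
  case (Suc k)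
  have der: "((\<lambda>x. F n (f x)) has_derivative (\<lambda>h. F (Suc n) (f x) * frechet_derivative f (at x) h)) (at x)" for x
  proof -
    have "(f has_derivative frechet_derivative f (at x)) (at x)"
      using Suc.prems by (auto simp: frechet_derivative_works[symmetric])
    from has_derivative_compose[OF this, of "F n" "(*) (F (Suc n) (f x))"]
    show ?thesis using assms(1)[of n "f x"] by (simp add: has_field_derivative_def)
  qed
  have eq: "partial_deriv i (\<lambda>x. F n (f x)) = (\<lambda>x. F (Suc n) (f x) * partial_deriv i f x)" for i
    using partial_deriv_eq[OF der] by (auto simp: partial_deriv_def)
  have "C_k k f" using Suc.prems C_k_Suc_imp_C_k by blast
  moreover have "\<forall>x. (\<lambda>x. F n (f x)) differentiable (at x)"
    using der unfolding differentiable_def by blast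
  ultimately show ?case using Suc eq by (simp add: C_k_mult)
qed

lemma C_k_const: "C_k k (\<lambda>x. c)"
proof (induction k arbitrary: c)
  case (Suc k)
  have "partial_deriv i (\<lambda>x. c) = (\<lambda>x. 0)" for i :: 'a
    using partial_deriv_eq[OF has_derivative_const] by auto
  with Suc show ?case by auto
qed (auto)

lemma C_k_inner: "C_k k (\<lambda>x::real^'n::finite. e \<bullet> x)"
proof (cases k)
  case (Suc m)
  have d: "((\<lambda>x. e \<bullet> x) has_derivative (\<lambda>h. e \<bullet> h)) (at x)" for x :: "real^'n"
    by (auto intro!: derivative_eq_intros)
  have "partial_deriv i (\<lambda>x. e \<bullet> x) = (\<lambda>x. e $ i)" for i :: 'n
    using partial_deriv_eq[OF d] by (auto simp: inner_axis)
  with Suc d show ?thesis by (auto simp: C_k_const differentiable_def)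
qed (auto intro: continuous_intros)

lemma smooth_inner: "smooth (\<lambda>x. e \<bullet> x)" and smooth_const: "smooth (\<lambda>x. c)"
  by (simp_all add: C_k_inner C_k_const)

lemma smooth_add: "smooth f \<Longrightarrow> smooth g \<Longrightarrow> smooth (\<lambda>x. f x + g x)"
  and smooth_mult: "smooth f \<Longrightarrow> smooth g \<Longrightarrow> smooth (\<lambda>x. f x * g x)"
  by (simp_all add: C_k_add C_k_mult)

lemma smooth_minus: assumes "smooth f" shows "smooth (\<lambda>x. - f x)"
  using smooth_mult[OF smooth_const[of "-1"] assms] by simp

lemma smooth_diff: "smooth f \<Longrightarrow> smooth g \<Longrightarrow> smooth (\<lambda>x. f x - g x)"
  using smooth_add[OF _ smooth_minus, of f g] by simp

lemma smooth_power: "smooth f \<Longrightarrow> smooth (\<lambda>x. f x ^ n)"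
  by (induction n) (simp_all add: C_k_const C_k_mult)

lemma smooth_compose:
  fixes F :: "nat \<Rightarrow> real \<Rightarrow> real"
  assumes "\<And>n t. (F n has_real_derivative F (Suc n) t) (at t)" and "smooth f"
  shows "smooth (\<lambda>x. F 0 (f x))"
  using C_k_compose[of F _ f 0] assms by blast

lemma smooth_sin: assumes "smooth f" shows "smooth (\<lambda>x. sin (f x))"
proof -
  have "((\<lambda>t. sin (t + real n * pi / 2)) has_real_derivative sin (t + real (Suc n) * pi / 2)) (at t)" for n t
  proof -
    have "sin (t + real (Suc n) * pi / 2) = cos (t + real n * pi / 2)"
    proof -
      have "t + real (Suc n) * pi / 2 = (t + real n * pi / 2) + pi / 2" by (simp add: field_simps)
      then show ?thesis by (simp only: sin_add) simp
    qed
    then show ?thesis by (auto intro!: derivative_eq_intros)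
  qed
  from smooth_compose[of "\<lambda>n t. sin (t + real n * pi / 2)", OF this assms] show ?thesis by simp
qed

text \<open>The \<open>n\<close>-th derivative of \<open>exp (- 1 / t)\<close> on \<open>t > 0\<close> has the form \<open>p (1 / t) exp (- 1 / t)\<close> with a
polynomial \<open>p\<close>, and differentiation replaces \<open>p\<close> by \<open>X^2 (p - p')\<close>.\<close>

definition flat_deriv :: "nat \<Rightarrow> real \<Rightarrow> real" where
  "flat_deriv n t = (if t > 0 then poly (((\<lambda>p. monom 1 2 * (p - pderiv p)) ^^ n) 1) (1 / t) * exp (- 1 / t) else 0)"

definition flat :: "real \<Rightarrow> real" where "flat t = (if t > 0 then exp (- 1 / t) else 0)"

lemma flat_deriv_0: "flat_deriv 0 = flat"
  by (auto simp: flat_deriv_def flat_def)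

lemma poly_exp_lim: "((\<lambda>x. poly p x * exp (- x)) \<longlongrightarrow> 0) (at_top :: real filter)"
proof -
  have "((\<lambda>x. \<Sum>i\<le>degree p. coeff p i * (x ^ i / exp x)) \<longlongrightarrow> (\<Sum>i\<le>degree p. coeff p i * 0)) (at_top :: real filter)"
    by (intro tendsto_sum tendsto_mult tendsto_const tendsto_power_div_exp_0)
  then show ?thesis
    by (simp add: poly_altdef sum_divide_distrib exp_minus divide_inverse sum_distrib_right mult.assoc)
qed

text \<open>At 0 the difference quotient from the right is again a polynomial in \<open>1 / t\<close> times \<open>exp (- 1 / t)\<close>, so it
tends to 0.\<close>

lemma flat_deriv_has_derivative: "(flat_deriv n has_real_derivative flat_deriv (Suc n) t) (at t)"
proof -
  define p where "p = (((\<lambda>p. monom 1 2 * (p - pderiv p)) ^^ n) (1 :: real poly))"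
  have pS: "(((\<lambda>p. monom 1 2 * (p - pderiv p)) ^^ Suc n) (1 :: real poly)) = monom 1 2 * (p - pderiv p)"
    by (simp add: p_def)
  consider "t > 0" | "t < 0" | "t = 0" by linarith
  then show ?thesis
  proof cases
    case 1
    have "((\<lambda>t. poly p (1 / t) * exp (- 1 / t)) has_real_derivative flat_deriv (Suc n) t) (at t)"
      unfolding flat_deriv_def pS using 1
      by (auto intro!: derivative_eq_intros DERIV_chain2[OF poly_DERIV] simp: poly_monom field_simps power2_eq_square)
    moreover have "eventually (\<lambda>s. poly p (1 / s) * exp (- 1 / s) = flat_deriv n s) (nhds t)"
      using eventually_nhds_in_open[of "{0<..}" t] 1
      by (auto elim!: eventually_mono simp: flat_deriv_def p_def)
    ultimately show ?thesis by (subst (asm) DERIV_cong_ev[OF refl _ refl]) auto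
  next
    case 2
    have "((\<lambda>t. 0) has_real_derivative flat_deriv (Suc n) t) (at t)"
      using 2 by (auto simp: flat_deriv_def)
    moreover have "eventually (\<lambda>s. 0 = flat_deriv n s) (nhds t)"
      using eventually_nhds_in_open[of "{..<0}" t] 2
      by (auto elim!: eventually_mono simp: flat_deriv_def p_def)
    ultimately show ?thesis by (subst (asm) DERIV_cong_ev[OF refl _ refl]) auto
  next
    case 3
    have "((\<lambda>s. flat_deriv n s / s) \<longlongrightarrow> 0) (at_right 0)"
    proof -
      have "((\<lambda>s. poly (pCons 0 p) (1/s) * exp (- (1/s))) \<longlongrightarrow> 0) (at_right (0::real))"
        by (rule filterlim_compose[OF poly_exp_lim])
          (use filterlim_inverse_at_top_right in \<open>simp only: inverse_eq_divide\<close>)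
      moreover have "eventually (\<lambda>s. poly (pCons 0 p) (1/s) * exp (- (1/s)) = flat_deriv n s / s) (at_right (0::real))"
        by (rule eventually_mono[OF eventually_at_right_less[of "0::real"]]) (simp add: flat_deriv_def p_def)
      ultimately show ?thesis by (rule Lim_transform_eventually)
    qed
    moreover have "((\<lambda>s. flat_deriv n s / s) \<longlongrightarrow> 0) (at_left 0)"
    proof -
      have "eventually (\<lambda>s. flat_deriv n s / s = 0) (at_left (0::real))"
        by (auto simp: eventually_at_left_field flat_deriv_def intro!: exI[of _ "-1"])
      then show ?thesis by (simp add: tendsto_eventually)
    qed
    ultimately have "((\<lambda>s. flat_deriv n s / s) \<longlongrightarrow> 0) (at 0)"
      by (simp add: filterlim_split_at)
    then show ?thesis using 3 by (simp add: DERIV_def flat_deriv_def)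
  qed
qed

lemma smooth_flat: "smooth f \<Longrightarrow> smooth (\<lambda>x. flat (f x))"
  using smooth_compose[of flat_deriv f, OF flat_deriv_has_derivative] by (simp add: flat_deriv_0)

section \<open>Integration on the plane\<close>

lemma Basis_real2: "(Basis :: (real^2) set) = {axis 1 1, axis 2 1}"
  by (auto simp: Basis_vec_def UNIV_2)

lemma axis_real2_neq: "(axis 1 1 :: real^2) \<noteq> axis 2 1"
  by (simp add: axis_eq_axis)

lemma prod_Basis_real2: "(\<Prod>b\<in>(Basis::(real^2) set). f b) = f (axis 1 1) * f (axis 2 1)"
  by (simp add: Basis_real2 axis_real2_neq)

lemma box_real2: "box l u = {x :: real^2. l$1 < x$1 \<and> x$1 < u$1 \<and> l$2 < x$2 \<and> x$2 < u$2}"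
  by (auto simp: box_def Basis_real2 inner_axis)

lemma inner_real2: "x \<bullet> y = x$1 * y$1 + x$2 * (y :: real^2)$2"
  by (simp add: inner_vec_def sum_2)

lemma norm_real2: "norm (x::real^2) ^ 2 = (x$1)^2 + (x$2)^2"
  unfolding power2_norm_eq_inner by (simp add: inner_real2 power2_eq_square)

definition vec2 :: "real \<Rightarrow> real \<Rightarrow> real^2" where "vec2 a b = a *\<^sub>R axis 1 1 + b *\<^sub>R axis 2 1"

lemma vec2_nth [simp]: "vec2 a b $ 1 = a" "vec2 a b $ 2 = b"
  by (simp_all add: vec2_def axis_def)

lemma continuous_on_pair_vector: "continuous_on A (\<lambda>z::real\<times>real. vec2 (fst z) (snd z))"
  unfolding vec2_def by (intro continuous_intros)

text \<open>Both measures agree on boxes. This makes Fubini's theorem available on \<open>real^2\<close>.\<close>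

lemma lborel_real2: "distr (lborel \<Otimes>\<^sub>M lborel) borel (\<lambda>z. vec2 (fst z) (snd z)) = lborel"
proof (rule lborel_eqI[symmetric])
  have m: "(\<lambda>z. vec2 (fst z) (snd z)) \<in> (lborel \<Otimes>\<^sub>M lborel) \<rightarrow>\<^sub>M borel"
    unfolding lborel_prod using borel_measurable_continuous_onI[OF continuous_on_pair_vector] by simp
  fix l u :: "real^2"
  assume le: "\<And>b. b \<in> Basis \<Longrightarrow> l \<bullet> b \<le> u \<bullet> b"
  have le': "l$1 \<le> u$1" "l$2 \<le> u$2"
    using le[of "axis 1 1"] le[of "axis 2 1"] by (auto simp: Basis_real2 inner_axis)
  have "(\<lambda>z. vec2 (fst z) (snd z)) -` box l u \<inter> space (lborel \<Otimes>\<^sub>M lborel) =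
    {l$1<..<u$1} \<times> {l$2<..<u$2}"
    by (auto simp: box_real2 space_pair_measure)
  then show "emeasure (distr (lborel \<Otimes>\<^sub>M lborel) borel (\<lambda>z. vec2 (fst z) (snd z))) (box l u) =
      ennreal (\<Prod>b\<in>Basis. (u - l) \<bullet> b)"
    using le' by (simp add: emeasure_distr[OF m] lborel.emeasure_pair_measure_Times prod_Basis_real2 inner_axis ennreal_mult)
qed auto

text \<open>Affine coordinates with origin \<open>P\<close> and axes \<open>e1\<close>, \<open>e2\<close>; \<open>D\<close> is their Jacobian determinant. The axes may be
oblique: two sides of a triangle give barycentric coordinates, while an orthogonal pair slices the plane
along a direction.\<close>

locale chart =
  fixes P e1 e2 :: "real^2" and D :: real
  assumes D_def: "D = e1$1 * e2$2 - e1$2 * e2$1" and D_nz: "D \<noteq> 0"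
begin

definition G :: "real^2 \<Rightarrow> real^2" where "G x = P + ((x$1) *\<^sub>R e1 + (x$2) *\<^sub>R e2)"
definition H :: "real^2 \<Rightarrow> real^2" where
  "H y = vec2 (((y-P)$1 * e2$2 - (y-P)$2 * e2$1) / D) ((e1$1 * (y-P)$2 - e1$2 * (y-P)$1) / D)"

lemma GH: "G (H y) = y" and HG: "H (G y) = y"
proof -
  define y1 y2 where "y1 = y$1 - P$1" and "y2 = y$2 - P$2"
  have "(y1 * e2$2 - y2 * e2$1) / D * e1$1 + (e1$1 * y2 - e1$2 * y1) / D * e2$1 = y1 * D / D"
    "(y1 * e2$2 - y2 * e2$1) / D * e1$2 + (e1$1 * y2 - e1$2 * y1) / D * e2$2 = y2 * D / D"
    unfolding D_def by (simp_all add: add_divide_distrib[symmetric] diff_divide_distrib[symmetric] algebra_simps)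
  then show "G (H y) = y"
    using D_nz by (simp add: G_def H_def vec_eq_iff forall_2 y1_def y2_def)
  have "((y$1 * e1$1 + y$2 * e2$1) * e2$2 - (y$1 * e1$2 + y$2 * e2$2) * e2$1) = y$1 * D"
    "(e1$1 * (y$1 * e1$2 + y$2 * e2$2) - e1$2 * (y$1 * e1$1 + y$2 * e2$1)) = y$2 * D"
    unfolding D_def by (simp_all add: algebra_simps)
  then show "H (G y) = y"
    using D_nz by (simp add: G_def H_def vec_eq_iff forall_2)
qed

lemma continuous_G: "continuous_on A G" and continuous_H: "continuous_on A H"
proof -
  show "continuous_on A G" unfolding G_def by (intro continuous_intros)
  show "continuous_on A H" unfolding H_def vec2_def
    using D_nz by (intro continuous_intros) auto
qed

lemma density_distr_G: "density (distr lborel borel G) (\<lambda>_. ennreal \<bar>D\<bar>) = lborel"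
proof (rule lborel_eqI[symmetric])
  have mG: "G \<in> lborel \<rightarrow>\<^sub>M borel"
    using borel_measurable_continuous_onI[OF continuous_G] by simp
  fix l u :: "real^2"
  assume le: "\<And>b. b \<in> Basis \<Longrightarrow> l \<bullet> b \<le> u \<bullet> b"
  define L where "L x = (x$1) *\<^sub>R e1 + (x$2) *\<^sub>R e2" for x :: "real^2"
  have linL: "linear L" unfolding L_def
    by (intro linearI) (auto simp: algebra_simps)
  have detL: "det (matrix L) = D"
    by (simp add: det_2 matrix_def L_def D_def axis_def)
  define A where "A = G -` box l u"
  have opA: "open A" unfolding A_def by (intro open_vimage continuous_G) auto
  have "A \<subseteq> H ` cbox l u"
  proof
    fix x assume "x \<in> A"
    then have "G x \<in> cbox l u" using box_subset_cbox[of l u] unfolding A_def by blast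
    then show "x \<in> H ` cbox l u" using HG[of x] by (metis image_eqI)
  qed
  moreover have "compact (H ` cbox l u)" by (intro compact_continuous_image continuous_H) auto
  ultimately have bA: "bounded A" using compact_imp_bounded bounded_subset by blast
  have A: "A \<in> lmeasurable" using bA opA by (simp add: lmeasurable_open)
  have "G ` A = box l u" unfolding A_def using GH by (metis surj_def surj_image_vimage_eq)
  moreover have "G ` A = (+) P ` L ` A" by (auto simp: G_def L_def image_image)
  ultimately have "measure lebesgue (box l u) = \<bar>D\<bar> * measure lebesgue A"
    using measure_translation[of P "L ` A"] measure_linear_image[OF linL A] detL by metis
  then have *: "measure lborel (box l u) = \<bar>D\<bar> * measure lborel A"
    using opA by simp
  have fin: "emeasure lborel A = ennreal (measure lborel A)"
    using emeasure_bounded_finite[OF bA] by (intro emeasure_eq_ennreal_measure) auto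
  have "emeasure (density (distr lborel borel G) (\<lambda>_. ennreal \<bar>D\<bar>)) (box l u) = ennreal \<bar>D\<bar> * emeasure lborel A"
    using mG by (subst emeasure_density_const) (auto simp: emeasure_distr A_def)
  also have "\<dots> = ennreal (measure lborel (box l u))"
    by (simp add: fin * ennreal_mult)
  also have "measure lborel (box l u) = (\<Prod>b\<in>Basis. (u - l) \<bullet> b)"
    using le by (simp add: measure_lborel_box_eq)
  finally show "emeasure (density (distr lborel borel G) (\<lambda>_. ennreal \<bar>D\<bar>)) (box l u) = ennreal (\<Prod>b\<in>Basis. (u - l) \<bullet> b)" .
qed auto

lemma
  fixes f :: "real^2 \<Rightarrow> real"
  assumes f: "f \<in> borel_measurable borel"
  shows integrable_chart: "integrable lborel f \<longleftrightarrow>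
      integrable (lborel \<Otimes>\<^sub>M lborel) (\<lambda>z. f (P + fst z *\<^sub>R e1 + snd z *\<^sub>R e2))" (is ?A)
    and integral_chart: "(LINT x|lborel. f x) =
      \<bar>D\<bar> * (LINT z|(lborel \<Otimes>\<^sub>M lborel). f (P + fst z *\<^sub>R e1 + snd z *\<^sub>R e2))" (is ?B)
proof -
  have m: "(\<lambda>z. vec2 (fst z) (snd z)) \<in> (lborel \<Otimes>\<^sub>M lborel) \<rightarrow>\<^sub>M borel"
    unfolding lborel_prod using borel_measurable_continuous_onI[OF continuous_on_pair_vector] by simp
  have mG: "G \<in> borel \<rightarrow>\<^sub>M borel"
    using borel_measurable_continuous_onI[OF continuous_G] by simp
  have fG: "f \<circ> G \<in> borel_measurable borel" using mG f by (rule measurable_comp)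
  have 1: "integrable lborel f \<longleftrightarrow> integrable lborel (\<lambda>x. f (G x))"
    "(LINT x|lborel. f x) = \<bar>D\<bar> * (LINT x|lborel. f (G x))"
    using mG f D_nz
    by (subst density_distr_G[symmetric], simp add: integrable_density integrable_distr_eq integral_density integral_distr)+
  have 2: "integrable lborel (\<lambda>x. f (G x)) \<longleftrightarrow> integrable (lborel \<Otimes>\<^sub>M lborel) (\<lambda>z. f (G (vec2 (fst z) (snd z))))"
    "(LINT x|lborel. f (G x)) = (LINT z|(lborel \<Otimes>\<^sub>M lborel). f (G (vec2 (fst z) (snd z))))"
    using m fG by (subst lborel_real2[symmetric], simp add: integrable_distr_eq integral_distr comp_def)+
  show ?A ?B using 1 2 by (auto simp: G_def add.assoc)
qed

lemma integral_chart_iterated: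
  fixes f :: "real^2 \<Rightarrow> real"
  assumes f: "integrable lborel f"
  shows "(LINT x|lborel. f x) = \<bar>D\<bar> * (LINT v|lborel. LINT u|lborel. f (P + u *\<^sub>R e1 + v *\<^sub>R e2))"
    and "(LINT x|lborel. f x) = \<bar>D\<bar> * (LINT u|lborel. LINT v|lborel. f (P + u *\<^sub>R e1 + v *\<^sub>R e2))"
proof -
  have fb: "f \<in> borel_measurable borel" using f by (auto dest: borel_measurable_integrable)
  have i: "integrable (lborel \<Otimes>\<^sub>M lborel) (\<lambda>(u,v). f (P + u *\<^sub>R e1 + v *\<^sub>R e2))"
    using f integrable_chart[OF fb] by (simp add: case_prod_beta')
  show "(LINT x|lborel. f x) = \<bar>D\<bar> * (LINT v|lborel. LINT u|lborel. f (P + u *\<^sub>R e1 + v *\<^sub>R e2))"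
    using lborel_pair.integral_snd[OF i] integral_chart[OF fb] by (simp add: case_prod_beta')
  show "(LINT x|lborel. f x) = \<bar>D\<bar> * (LINT u|lborel. LINT v|lborel. f (P + u *\<^sub>R e1 + v *\<^sub>R e2))"
    using lborel_pair.integral_fst[OF i] integral_chart[OF fb] by (simp add: case_prod_beta')
qed

end

lemma integral_deriv_compact_support_real:
  fixes F f :: "real \<Rightarrow> real"
  assumes der: "\<And>u. (F has_real_derivative f u) (at u)" and cont: "continuous_on UNIV f"
    and supp: "\<And>u. \<bar>u\<bar> > R \<Longrightarrow> F u = 0"
  shows "(LINT u|lborel. f u) = 0"
proof -
  define B where "B = \<bar>R\<bar> + 1"
  have f0: "f u = 0" if "\<bar>u\<bar> > R" for u
  proof -
    have "open {u::real. \<bar>u\<bar> > R}"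
      by (intro open_Collect_less continuous_intros)
    then have "eventually (\<lambda>u. F u = 0) (nhds u)"
      using that supp by (auto simp: eventually_nhds intro!: exI[of _ "{u. \<bar>u\<bar> > R}"])
    then have "((\<lambda>_. 0) has_real_derivative f u) (at u)"
      using der[of u] by (subst (asm) DERIV_cong_ev[OF refl _ refl]) auto
    then show ?thesis using DERIV_unique DERIV_const by blast
  qed
  have "(LINT u|lborel. f u) = (LINT u|lborel. indicator {-B..B} u *\<^sub>R f u)"
  proof (rule Bochner_Integration.integral_cong)
    fix u show "f u = indicator {-B..B} u *\<^sub>R f u"
      using f0[of u] by (cases "\<bar>u\<bar> > R") (auto simp: B_def indicator_def)
  qed simp
  also have "\<dots> = F B - F (-B)"
    by (rule integral_FTC_Icc)
      (auto simp: B_def has_real_derivative_iff_has_vector_derivative[symmetric]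
        intro!: has_field_derivative_at_within der continuous_on_subset[OF cont])
  also have "\<dots> = 0" using supp[of B] supp[of "-B"] by (simp add: B_def)
  finally show ?thesis .
qed

lemma integrable_compact_support:
  fixes f :: "'a::euclidean_space \<Rightarrow> 'b::euclidean_space"
  assumes "continuous_on UNIV f" "compact K" "\<And>x. x \<notin> K \<Longrightarrow> f x = 0"
  shows "integrable lborel f"
proof -
  have "integrable lborel (\<lambda>x. indicator K x *\<^sub>R f x)"
    by (rule borel_integrable_compact[OF assms(2)]) (rule continuous_on_subset[OF assms(1)], simp)
  also have "(\<lambda>x. indicator K x *\<^sub>R f x) = f" using assms(3) by (auto simp: indicator_def)
  finally show ?thesis .
qed

text \<open>The plane is sliced along \<open>e\<close>; on each slice the fundamental theorem of calculus gives 0.\<close>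

lemma integral_directional_derivative_compact_support:
  fixes w g :: "real^2 \<Rightarrow> real"
  assumes der: "\<And>x. (w has_derivative w' x) (at x)" and g: "\<And>x. g x = w' x e"
    and cont: "continuous_on UNIV g"
    and K: "compact K" and supp: "\<And>x. x \<notin> K \<Longrightarrow> w x = 0"
  shows "integrable lborel g" "(LINT x|lborel. g x) = 0"
proof -
  have g0: "g x = 0" if "x \<notin> K" for x
  proof -
    have op: "open (-K)" using K(1) by (simp add: compact_imp_closed open_Compl)
    have "((\<lambda>_. 0) has_derivative (\<lambda>_. 0)) (at x)" by simp
    then have "(w has_derivative (\<lambda>_. 0)) (at x)"
      by (rule has_derivative_transform_within_open[OF _ op]) (use that supp in auto)
    then have "w' x = (\<lambda>_. 0)" using der has_derivative_unique by blast
    then show ?thesis by (simp add: g)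
  qed
  show int: "integrable lborel g" using cont K g0 by (rule integrable_compact_support)
  show "(LINT x|lborel. g x) = 0"
  proof (cases "e = 0")
    case True
    have "g x = 0" for x unfolding g True using der has_derivative_linear linear_0 by blast
    then show ?thesis by simp
  next
    case False
    define e2 :: "real^2" where "e2 = vec2 (- e$2) (e$1)"
    have "norm e ^ 2 \<noteq> 0" using False by simp
    then have nz: "(e$1)^2 + (e$2)^2 \<noteq> 0" unfolding norm_real2 .
    interpret chart 0 e e2 "(e$1)^2 + (e$2)^2"
      by unfold_locales (use nz in \<open>auto simp: e2_def power2_eq_square\<close>)
    obtain B where B: "\<And>x. x \<in> K \<Longrightarrow> norm x \<le> B" using K compact_imp_bounded bounded_iff by metis
    have "(LINT u|lborel. g (0 + u *\<^sub>R e + v *\<^sub>R e2)) = 0" for v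
    proof (rule integral_deriv_compact_support_real[where F="\<lambda>u. w (0 + u *\<^sub>R e + v *\<^sub>R e2)" and R="(B + norm (v *\<^sub>R e2)) / norm e"])
      fix u
      have "((\<lambda>u. w (0 + u *\<^sub>R e + v *\<^sub>R e2)) has_derivative (\<lambda>h. w' (0 + u *\<^sub>R e + v *\<^sub>R e2) (h *\<^sub>R e))) (at u)"
        by (rule has_derivative_compose[OF _ der]) (auto intro!: derivative_eq_intros)
      moreover have "w' x (h *\<^sub>R e) = h * w' x e" for x h
        using linear_cmul[OF has_derivative_linear[OF der[of x]]] by simp
      ultimately show "((\<lambda>u. w (0 + u *\<^sub>R e + v *\<^sub>R e2)) has_real_derivative g (0 + u *\<^sub>R e + v *\<^sub>R e2)) (at u)"
        by (simp add: has_field_derivative_def g mult_commute_abs)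
      show "w (0 + u *\<^sub>R e + v *\<^sub>R e2) = 0" if "(B + norm (v *\<^sub>R e2)) / norm e < \<bar>u\<bar>"
      proof (rule supp, rule notI)
        assume "0 + u *\<^sub>R e + v *\<^sub>R e2 \<in> K"
        from B[OF this] have "norm (u *\<^sub>R e) \<le> B + norm (v *\<^sub>R e2)"
          using norm_triangle_ineq2[of "u *\<^sub>R e" "- (v *\<^sub>R e2)"] by simp
        with that False show False by (simp add: field_simps)
      qed
    next
      show "continuous_on UNIV (\<lambda>u. g (0 + u *\<^sub>R e + v *\<^sub>R e2))"
        by (rule continuous_on_compose2[OF cont]) (auto intro!: continuous_intros)
    qed
    then show ?thesis using integral_chart_iterated(1)[OF int] by simp
  qed
qed

section \<open>Test functions and their gradients\<close>

lemma gradient_has_derivative: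
  assumes "f differentiable (at x)"
  shows "(f has_derivative (\<lambda>h. gradient f x \<bullet> h)) (at x)"
proof -
  have d: "(f has_derivative frechet_derivative f (at x)) (at x)"
    using assms by (simp add: frechet_derivative_works[symmetric])
  have l: "linear (frechet_derivative f (at x))" using d by (rule has_derivative_linear)
  have "frechet_derivative f (at x) h = gradient f x \<bullet> h" for h
  proof -
    have e: "(\<Sum>i\<in>UNIV. (h$i) *\<^sub>R axis i 1) = h"
      using basis_expansion[of h] by (simp add: scalar_mult_eq_scaleR)
    have "frechet_derivative f (at x) h = frechet_derivative f (at x) (\<Sum>i\<in>UNIV. (h$i) *\<^sub>R axis i 1)"
      by (simp only: e)
    also have "\<dots> = (\<Sum>i\<in>UNIV. h$i * partial_deriv i f x)"
      by (simp add: linear_sum[OF l] linear_cmul[OF l] partial_deriv_def)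
    finally show ?thesis by (simp add: inner_vec_def gradient_def mult.commute)
  qed
  then show ?thesis using d by (metis (no_types, lifting) ext)
qed

lemma gradient_eqI:
  assumes "(f has_derivative (\<lambda>h. g \<bullet> h)) (at x)"
  shows "gradient f x = g"
  by (simp add: vec_eq_iff gradient_def partial_deriv_eq[OF assms] inner_axis)

lemma smooth_gradient: "smooth f \<Longrightarrow> (f has_derivative (\<lambda>h. gradient f x \<bullet> h)) (at x)"
  by (simp add: gradient_has_derivative smooth_differentiable)

lemma continuous_gradient: "smooth f \<Longrightarrow> continuous_on A (gradient f)"
  unfolding gradient_def
  by (intro continuous_on_vec_lambda smooth_continuous smooth_partial_deriv)

lemma test_function_compact_support:
  assumes "test_function \<Omega> \<phi>"
  obtains K where "compact K" "K \<subseteq> \<Omega>" "\<And>x. x \<notin> K \<Longrightarrow> \<phi> x = 0" "\<And>x. x \<notin> K \<Longrightarrow> gradient \<phi> x = 0"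
proof -
  define K where "K = closure {x. \<phi> x \<noteq> 0}"
  have K: "compact K" "K \<subseteq> \<Omega>" using assms by (auto simp: test_function_def K_def)
  have "{x. \<phi> x \<noteq> 0} \<subseteq> K" unfolding K_def by (rule closure_subset)
  then have 0: "\<phi> x = 0" if "x \<notin> K" for x using that by auto
  have op: "open (-K)" using K(1) by (simp add: compact_imp_closed open_Compl)
  have "gradient \<phi> x = 0" if "x \<notin> K" for x
  proof (rule gradient_eqI)
    have "((\<lambda>_. 0::real) has_derivative (\<lambda>h. 0 \<bullet> h)) (at x)" by simp
    then show "(\<phi> has_derivative (\<lambda>h. 0 \<bullet> h)) (at x)"
      by (rule has_derivative_transform_within_open[OF _ op]) (use that 0 in auto)
  qed
  with K 0 show ?thesis using that by blast
qed

lemma test_function_smooth: "test_function \<Omega> \<phi> \<Longrightarrow> smooth \<phi>"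
  by (simp add: test_function_def)

lemma test_function_integrable:
  assumes "test_function \<Omega> \<phi>"
  shows "integrable lborel (\<lambda>x. (\<phi> x)^2)" "integrable lborel (\<lambda>x. (norm (gradient \<phi> x))^2)"
proof -
  note s = test_function_smooth[OF assms]
  obtain K where K: "compact K" "K \<subseteq> \<Omega>" "\<And>x. x \<notin> K \<Longrightarrow> \<phi> x = 0" "\<And>x. x \<notin> K \<Longrightarrow> gradient \<phi> x = 0"
    using test_function_compact_support[OF assms] by blast
  show "integrable lborel (\<lambda>x. (\<phi> x)^2)" "integrable lborel (\<lambda>x. (norm (gradient \<phi> x))^2)"
    using K by (auto intro!: integrable_compact_support[where K=K] continuous_intros smooth_continuous[OF s] continuous_gradient[OF s])
qed

lemma
  fixes F :: "real^'n::finite \<Rightarrow> 'b::euclidean_space"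
  assumes "F \<in> borel_measurable borel" "\<Omega> \<in> sets borel"
  shows lebesgue_on_integral: "(LINT x|lebesgue_on \<Omega>. F x) = (LINT x|lborel. indicator \<Omega> x *\<^sub>R F x)"
    and lebesgue_on_integrable: "integrable (lebesgue_on \<Omega>) F \<longleftrightarrow> integrable lborel (\<lambda>x. indicator \<Omega> x *\<^sub>R F x)"
    and lebesgue_on_measurable: "F \<in> borel_measurable (lebesgue_on \<Omega>)"
proof -
  have m: "(\<lambda>x. indicator \<Omega> x *\<^sub>R F x) \<in> borel_measurable lborel" using assms by simp
  have \<Omega>: "\<Omega> \<inter> space lebesgue \<in> sets lebesgue" using assms by auto
  show "(LINT x|lebesgue_on \<Omega>. F x) = (LINT x|lborel. indicator \<Omega> x *\<^sub>R F x)"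
    unfolding integral_restrict_space[OF \<Omega>] using m by (rule integral_completion)
  show "integrable (lebesgue_on \<Omega>) F \<longleftrightarrow> integrable lborel (\<lambda>x. indicator \<Omega> x *\<^sub>R F x)"
    unfolding integrable_restrict_space[OF \<Omega>] using m by (rule integrable_completion)
  show "F \<in> borel_measurable (lebesgue_on \<Omega>)"
    using assms by (intro measurable_restrict_space1 measurable_completion) simp
qed

lemma lebesgue_on_vanishing:
  fixes F :: "real^'n::finite \<Rightarrow> 'b::euclidean_space"
  assumes "F \<in> borel_measurable borel" "\<Omega> \<in> sets borel" "\<And>x. x \<notin> \<Omega> \<Longrightarrow> F x = 0"
  shows "(LINT x|lebesgue_on \<Omega>. F x) = (LINT x|lborel. F x)"
    and "integrable (lebesgue_on \<Omega>) F \<longleftrightarrow> integrable lborel F"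
proof -
  have "(\<lambda>x. indicator \<Omega> x *\<^sub>R F x) = F" using assms(3) by (auto simp: indicator_def)
  then show "(LINT x|lebesgue_on \<Omega>. F x) = (LINT x|lborel. F x)"
    "integrable (lebesgue_on \<Omega>) F \<longleftrightarrow> integrable lborel F"
    using lebesgue_on_integral[OF assms(1,2)] lebesgue_on_integrable[OF assms(1,2)] by auto
qed

lemma test_function_lebesgue_on:
  assumes "test_function \<Omega> \<phi>" "\<Omega> \<in> sets borel"
  shows "(LINT x|lebesgue_on \<Omega>. (\<phi> x)^2) = (LINT x|lborel. (\<phi> x)^2)"
    "(LINT x|lebesgue_on \<Omega>. (norm (gradient \<phi> x))^2) = (LINT x|lborel. (norm (gradient \<phi> x))^2)"
    "integrable (lebesgue_on \<Omega>) (\<lambda>x. (\<phi> x)^2)"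
    "integrable (lebesgue_on \<Omega>) (\<lambda>x. (norm (gradient \<phi> x))^2)"
proof -
  note s = test_function_smooth[OF assms(1)]
  obtain K where K: "compact K" "K \<subseteq> \<Omega>" "\<And>x. x \<notin> K \<Longrightarrow> \<phi> x = 0" "\<And>x. x \<notin> K \<Longrightarrow> gradient \<phi> x = 0"
    using test_function_compact_support[OF assms(1)] by blast
  have m: "(\<lambda>x. (\<phi> x)^2) \<in> borel_measurable borel" "(\<lambda>x. (norm (gradient \<phi> x))^2) \<in> borel_measurable borel"
    by (auto intro!: borel_measurable_continuous_onI continuous_intros smooth_continuous[OF s] continuous_gradient[OF s])
  have 0: "\<And>x. x \<notin> \<Omega> \<Longrightarrow> (\<phi> x)^2 = 0" "\<And>x. x \<notin> \<Omega> \<Longrightarrow> (norm (gradient \<phi> x))^2 = 0" using K by auto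
  note 1 = lebesgue_on_vanishing[OF m(1) assms(2) 0(1)] and 2 = lebesgue_on_vanishing[OF m(2) assms(2) 0(2)]
  show "(LINT x|lebesgue_on \<Omega>. (\<phi> x)^2) = (LINT x|lborel. (\<phi> x)^2)"
    "(LINT x|lebesgue_on \<Omega>. (norm (gradient \<phi> x))^2) = (LINT x|lborel. (norm (gradient \<phi> x))^2)"
    "integrable (lebesgue_on \<Omega>) (\<lambda>x. (\<phi> x)^2)"
    "integrable (lebesgue_on \<Omega>) (\<lambda>x. (norm (gradient \<phi> x))^2)"
    using 1 2 test_function_integrable[OF assms(1)] by blast+
qed

lemma test_function_L2:
  assumes t: "test_function \<Omega> \<phi>" and \<Omega>: "\<Omega> \<in> sets borel"
  shows "L2_on \<Omega> \<phi>" "L2_on \<Omega> (gradient \<phi>)"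
proof -
  note s = test_function_smooth[OF t]
  show "L2_on \<Omega> \<phi>" "L2_on \<Omega> (gradient \<phi>)"
    unfolding L2_on_def using test_function_lebesgue_on[OF t \<Omega>]
    by (auto intro!: lebesgue_on_measurable \<Omega> borel_measurable_continuous_onI smooth_continuous[OF s] continuous_gradient[OF s])
qed

text \<open>A constant sequence approximates \<open>\<phi>\<close>. That the classical gradient is a weak gradient is the preceding fact
on directional derivatives, applied to a product of two test functions.\<close>

lemma test_function_H1_0:
  fixes \<Omega> :: "(real^2) set"
  assumes t: "test_function \<Omega> \<phi>" and \<Omega>: "\<Omega> \<in> sets borel"
  shows "(\<phi>, gradient \<phi>) \<in> H1_0 \<Omega>"
proof -
  note s = test_function_smooth[OF t] and L2 = test_function_L2[OF t \<Omega>]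
  have "weak_gradient \<Omega> \<phi> (gradient \<phi>)"
    unfolding weak_gradient_def
  proof (intro allI impI)
    fix \<psi> :: "real^2 \<Rightarrow> real" and i
    assume t': "test_function \<Omega> \<psi>"
    note s' = test_function_smooth[OF t']
    obtain K where K: "compact K" "K \<subseteq> \<Omega>" "\<And>x. x \<notin> K \<Longrightarrow> \<phi> x = 0" "\<And>x. x \<notin> K \<Longrightarrow> gradient \<phi> x = 0"
      using test_function_compact_support[OF t] by blast
    let ?f = "\<lambda>x. \<phi> x * partial_deriv i \<psi> x" and ?g = "\<lambda>x. gradient \<phi> x $ i * \<psi> x"
    have pd: "partial_deriv i \<psi> x = gradient \<psi> x $ i" for x by (simp add: gradient_def)
    have c: "continuous_on UNIV (\<lambda>x. gradient f x $ i)" if "smooth f" for f :: "real^2 \<Rightarrow> real"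
      using continuous_gradient[OF that] by (intro continuous_intros)
    have cf: "continuous_on UNIV ?f" "continuous_on UNIV ?g"
      unfolding pd by (intro continuous_intros c s s' smooth_continuous)+
    have 0: "?f x = 0" "?g x = 0" if "x \<notin> K" for x using K that by auto
    have i: "integrable lborel ?f" "integrable lborel ?g"
      using cf K(1) 0 by (auto intro!: integrable_compact_support)
    have "(LINT x|lborel. ?f x + ?g x) = 0"
    proof (rule integral_directional_derivative_compact_support(2))
      fix x
      show "((\<lambda>x. \<phi> x * \<psi> x) has_derivative (\<lambda>h. \<phi> x * (gradient \<psi> x \<bullet> h) + (gradient \<phi> x \<bullet> h) * \<psi> x)) (at x)"
        by (rule has_derivative_mult) (rule smooth_gradient, fact)+
      show "?f x + ?g x = \<phi> x * (gradient \<psi> x \<bullet> axis i 1) + (gradient \<phi> x \<bullet> axis i 1) * \<psi> x"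
        by (simp add: inner_axis pd)
      show "\<phi> x * \<psi> x = 0" if "x \<notin> K" using K that by auto
    qed (use cf K in \<open>auto intro!: continuous_intros\<close>)
    then have "(LINT x|lborel. ?f x) = - (LINT x|lborel. ?g x)" using i by simp
    moreover have "(LINT x|lebesgue_on \<Omega>. ?f x) = (LINT x|lborel. ?f x)"
      "(LINT x|lebesgue_on \<Omega>. ?g x) = (LINT x|lborel. ?g x)"
      by (rule lebesgue_on_vanishing(1)[OF borel_measurable_continuous_onI \<Omega>], use cf 0 K(2) in blast, use 0 K(2) in blast)+
    ultimately show "(LINT x|lebesgue_on \<Omega>. ?f x) = - (LINT x|lebesgue_on \<Omega>. ?g x)" by simp
  qed
  with L2 have "(\<phi>, gradient \<phi>) \<in> H1 \<Omega>" by (simp add: H1_def)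
  then show ?thesis unfolding H1_0_def using t by (auto intro!: exI[of _ "\<lambda>_. \<phi>"])
qed

section \<open>Approximation by test functions\<close>

text \<open>The function \<open>g\<close> vanishes near the frontier of \<open>A\<close>, so cutting it off there is locally either no change
or a replacement by 0.\<close>

lemma has_derivative_indicator_mult:
  fixes g :: "real^'n::finite \<Rightarrow> real"
  assumes "open A" "open U" "frontier A \<subseteq> U" "\<And>x. x \<in> U \<Longrightarrow> g x = 0"
    and d: "(g has_derivative g') (at x)"
  shows "((\<lambda>x. indicator A x * g x) has_derivative (\<lambda>h. indicator A x * g' h)) (at x)"
proof -
  consider "x \<in> A" | "x \<in> U" "x \<notin> A" | "x \<in> - closure A"
    using assms(1,3) by (auto simp: frontier_def interior_open)
  then show ?thesis
  proof cases
    case 1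
    then have "(g has_derivative (\<lambda>h. indicator A x * g' h)) (at x)" using d by simp
    then show ?thesis by (rule has_derivative_transform_within_open[OF _ assms(1) 1]) simp
  next
    case 2
    have "((\<lambda>_. 0) has_derivative (\<lambda>h. indicator A x * g' h)) (at x)" using 2 by simp
    then show ?thesis by (rule has_derivative_transform_within_open[OF _ assms(2) 2(1)]) (simp add: assms(4))
  next
    case 3
    have "x \<notin> A" using 3 closure_subset by auto
    then have "((\<lambda>_. 0) has_derivative (\<lambda>h. indicator A x * g' h)) (at x)" by simp
    then show ?thesis
      by (rule has_derivative_transform_within_open[OF _ _ 3]) (use closure_subset in \<open>auto simp: indicator_def\<close>)
  qed
qed

lemma smooth_indicator_mult:
  fixes g :: "real^'n::finite \<Rightarrow> real"
  assumes A: "open A" "open U" "frontier A \<subseteq> U"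
    and "smooth g" "\<And>x. x \<in> U \<Longrightarrow> g x = 0"
  shows "smooth (\<lambda>x. indicator A x * g x)"
proof
  fix k show "C_k k (\<lambda>x. indicator A x * g x)"
    using assms(4,5)
  proof (induction k arbitrary: g)
    case 0
    have "((\<lambda>x. indicator A x * g x) has_derivative (\<lambda>h. indicator A x * (gradient g x \<bullet> h))) (at x)" for x
      using has_derivative_indicator_mult[OF A] 0 smooth_gradient[of g x] by blast
    then show ?case
      by (auto intro!: continuous_at_imp_continuous_on has_derivative_continuous)
  next
    case (Suc k)
    have d: "((\<lambda>x. indicator A x * g x) has_derivative (\<lambda>h. indicator A x * (gradient g x \<bullet> h))) (at x)" for x
      using has_derivative_indicator_mult[OF A] Suc.prems smooth_gradient[of g x] by blast
    have "partial_deriv i (\<lambda>x. indicator A x * g x) = (\<lambda>x. indicator A x * partial_deriv i g x)" for i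
      using partial_deriv_eq[OF d] by (auto simp: gradient_def inner_axis)
    moreover have "C_k k (\<lambda>x. indicator A x * partial_deriv i g x)" for i
    proof (rule Suc.IH)
      show "smooth (partial_deriv i g)" using Suc.prems smooth_partial_deriv by blast
      fix x assume "x \<in> U"
      have "((\<lambda>_. 0) has_derivative (\<lambda>h. 0)) (at x)" by simp
      then have "(g has_derivative (\<lambda>h. 0)) (at x)"
        by (rule has_derivative_transform_within_open[OF _ A(2) \<open>x \<in> U\<close>]) (simp add: Suc.prems)
      then show "partial_deriv i g x = 0" by (simp add: partial_deriv_eq)
    qed
    ultimately show ?case using d by (auto simp: differentiable_def)
  qed
qed

abbreviation rayleigh_quotients :: "(real^2) set \<Rightarrow> real set" where
  "rayleigh_quotients \<Omega> \<equiv> {(LINT x|lebesgue_on \<Omega>. (norm (g x))^2) / (LINT x|lebesgue_on \<Omega>. (u x)^2) | u g.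
            (u, g) \<in> H1_0 \<Omega> \<and> \<not> (AE x in lebesgue_on \<Omega>. u x = 0)}"

lemma first_eigenvalue_le_test:
  fixes \<Omega> :: "(real^2) set"
  assumes "open \<Omega>" "test_function \<Omega> \<phi>"
  shows "first_dirichlet_eigenvalue \<Omega> * (LINT x|lborel. (\<phi> x)^2) \<le> (LINT x|lborel. (norm (gradient \<phi> x))^2)"
proof -
  have \<Omega>: "\<Omega> \<in> sets borel" using assms by auto
  note i = test_function_lebesgue_on[OF assms(2) \<Omega>]
  show ?thesis
  proof (cases "(LINT x|lborel. (\<phi> x)^2) = 0")
    case True
    then show ?thesis by simp
  next
    case False
    then have pos: "(LINT x|lborel. (\<phi> x)^2) > 0"
      by (simp add: less_le integral_nonneg)
    let ?S = "rayleigh_quotients \<Omega>"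
    have "\<not> (AE x in lebesgue_on \<Omega>. \<phi> x = 0)"
    proof
      assume "AE x in lebesgue_on \<Omega>. \<phi> x = 0"
      then have "(LINT x|lebesgue_on \<Omega>. (\<phi> x)^2) = 0"
        by (intro integral_eq_zero_AE) auto
      with False i show False by simp
    qed
    then have "(LINT x|lborel. (norm (gradient \<phi> x))^2) / (LINT x|lborel. (\<phi> x)^2) \<in> ?S"
      using test_function_H1_0[OF assms(2) \<Omega>]
      by (intro CollectI exI[of _ \<phi>] exI[of _ "gradient \<phi>"]) (simp add: i)
    moreover have "bdd_below ?S"
      by (intro bdd_belowI[of _ 0]) (auto intro!: divide_nonneg_nonneg integral_nonneg)
    ultimately have "first_dirichlet_eigenvalue \<Omega> \<le> (LINT x|lborel. (norm (gradient \<phi> x))^2) / (LINT x|lborel. (\<phi> x)^2)"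
      unfolding first_dirichlet_eigenvalue_def by (rule cInf_lower)
    then show ?thesis using pos by (simp add: pos_le_divide_eq)
  qed
qed

lemma square_add_le:
  fixes a b d :: real
  assumes "d > 0"
  shows "(a + b)^2 \<le> (1 + d) * a^2 + (1 + 1/d) * b^2"
proof -
  have "(1 + d) * a^2 + (1 + 1/d) * b^2 - (a + b)^2 = (d * a - b)^2 / d"
    using assms by (simp add: field_simps power2_eq_square)
  moreover have "\<dots> \<ge> 0" using assms by simp
  ultimately show ?thesis by linarith
qed

text \<open>With this weighted inequality a comparison of squared norms survives approximation up to factors
\<open>1 + d\<close>, and \<open>d\<close> can tend to 0 at the end.\<close>

lemma norm_square_add_le:
  fixes a b :: "'a::real_normed_vector" and d :: real
  assumes "d > 0"
  shows "(norm (a + b))^2 \<le> (1 + d) * (norm a)^2 + (1 + 1/d) * (norm b)^2"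
proof -
  have "(norm (a + b))^2 \<le> (norm a + norm b)^2" by (intro power_mono norm_triangle_ineq) auto
  also have "\<dots> \<le> (1 + d) * (norm a)^2 + (1 + 1/d) * (norm b)^2" using square_add_le[OF assms] .
  finally show ?thesis .
qed

lemma L2_diff_integrable:
  fixes f g :: "_ \<Rightarrow> 'b::euclidean_space"
  assumes "L2_on \<Omega> f" "L2_on \<Omega> g"
  shows "integrable (lebesgue_on \<Omega>) (\<lambda>x. (norm (f x - g x))^2)"
proof (rule Bochner_Integration.integrable_bound)
  show "integrable (lebesgue_on \<Omega>) (\<lambda>x. 2 * (norm (f x))^2 + 2 * (norm (g x))^2)"
    using assms by (auto simp: L2_on_def)
  have [measurable]: "f \<in> borel_measurable (lebesgue_on \<Omega>)" "g \<in> borel_measurable (lebesgue_on \<Omega>)"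
    using assms by (auto simp: L2_on_def)
  show "(\<lambda>x. (norm (f x - g x))^2) \<in> borel_measurable (lebesgue_on \<Omega>)" by measurable
  show "AE x in lebesgue_on \<Omega>. norm ((norm (f x - g x))^2) \<le> norm (2 * (norm (f x))^2 + 2 * (norm (g x))^2)"
  proof (rule AE_I2)
    fix x
    show "norm ((norm (f x - g x))^2) \<le> norm (2 * (norm (f x))^2 + 2 * (norm (g x))^2)"
      using norm_square_add_le[of 1 "f x" "- g x"] by simp
  qed
qed

lemma L2_perturb:
  fixes f g :: "_ \<Rightarrow> 'b::euclidean_space"
  assumes "L2_on \<Omega> f" "L2_on \<Omega> g" "d > 0"
  shows "(LINT x|lebesgue_on \<Omega>. (norm (f x))^2) \<le>
    (1 + d) * (LINT x|lebesgue_on \<Omega>. (norm (g x))^2) + (1 + 1/d) * (LINT x|lebesgue_on \<Omega>. (norm (f x - g x))^2)"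
proof -
  have i: "integrable (lebesgue_on \<Omega>) (\<lambda>x. (norm (f x))^2)" "integrable (lebesgue_on \<Omega>) (\<lambda>x. (norm (g x))^2)"
    "integrable (lebesgue_on \<Omega>) (\<lambda>x. (norm (f x - g x))^2)"
    using assms L2_diff_integrable[of \<Omega> f g] by (auto simp: L2_on_def)
  have "(LINT x|lebesgue_on \<Omega>. (norm (f x))^2) \<le>
    (LINT x|lebesgue_on \<Omega>. (1 + d) * (norm (g x))^2 + (1 + 1/d) * (norm (f x - g x))^2)"
  proof (rule integral_mono)
    fix x show "(norm (f x))^2 \<le> (1 + d) * (norm (g x))^2 + (1 + 1/d) * (norm (f x - g x))^2"
      using norm_square_add_le[OF assms(3), of "g x" "f x - g x"] by simp
  qed (use i in auto)
  also have "\<dots> = (1 + d) * (LINT x|lebesgue_on \<Omega>. (norm (g x))^2) + (1 + 1/d) * (LINT x|lebesgue_on \<Omega>. (norm (f x - g x))^2)"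
    using i by simp
  finally show ?thesis .
qed

text \<open>Both sides are compared with those of an approximating sequence of test functions; the index tends to
infinity first, then \<open>d\<close> to 0.\<close>

lemma H1_0_ge:
  fixes \<Omega> :: "(real^2) set"
  assumes op: "open \<Omega>" and K: "K \<ge> 0"
    and ineq: "\<And>\<phi>. test_function \<Omega> \<phi> \<Longrightarrow> K * (LINT x|lborel. (\<phi> x)^2) \<le> (LINT x|lborel. (norm (gradient \<phi> x))^2)"
    and ug: "(u, g) \<in> H1_0 \<Omega>"
  shows "K * (LINT x|lebesgue_on \<Omega>. (u x)^2) \<le> (LINT x|lebesgue_on \<Omega>. (norm (g x))^2)"
proof -
  have \<Omega>: "\<Omega> \<in> sets borel" using op by auto
  define A where "A = (LINT x|lebesgue_on \<Omega>. (u x)^2)"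
  define G where "G = (LINT x|lebesgue_on \<Omega>. (norm (g x))^2)"
  have L2: "L2_on \<Omega> u" "L2_on \<Omega> g" using ug by (auto simp: H1_0_def H1_def)
  obtain \<phi> where t: "\<And>k. test_function \<Omega> (\<phi> k)" and
    lim: "(\<lambda>k. (LINT x|lebesgue_on \<Omega>. (\<phi> k x - u x)^2) +
          (LINT x|lebesgue_on \<Omega>. (norm (gradient (\<phi> k) x - g x))^2)) \<longlonglongrightarrow> 0"
    using ug by (auto simp: H1_0_def)
  define a where "a k = (LINT x|lebesgue_on \<Omega>. (\<phi> k x - u x)^2)" for k
  define b where "b k = (LINT x|lebesgue_on \<Omega>. (norm (gradient (\<phi> k) x - g x))^2)" for k
  have nn: "a k \<ge> 0" "b k \<ge> 0" for k by (auto simp: a_def b_def intro!: integral_nonneg)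
  have lim': "(\<lambda>k. a k + b k) \<longlonglongrightarrow> 0" using lim by (simp add: a_def b_def)
  have a0: "a \<longlonglongrightarrow> 0" by (rule real_tendsto_sandwich[OF _ _ tendsto_const lim']) (use nn in auto)
  have b0: "b \<longlonglongrightarrow> 0" by (rule real_tendsto_sandwich[OF _ _ tendsto_const lim']) (use nn in auto)
  have main: "K * A \<le> (1 + d) * ((1 + d) * G)" if d: "d > 0" for d
  proof -
    have "K * A \<le> (1 + d) * ((1 + d) * G + (1 + 1/d) * b k) + K * ((1 + 1/d) * a k)" for k
    proof -
      note tl = test_function_L2[OF t \<Omega>, of k]
      have 1: "A \<le> (1 + d) * (LINT x|lborel. (\<phi> k x)^2) + (1 + 1/d) * a k"
        using L2_perturb[OF L2(1) tl(1) d] test_function_lebesgue_on(1)[OF t \<Omega>, of k]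
        by (simp add: A_def a_def power2_commute)
      have 2: "(LINT x|lborel. (norm (gradient (\<phi> k) x))^2) \<le> (1 + d) * G + (1 + 1/d) * b k"
        using L2_perturb[OF tl(2) L2(2) d] test_function_lebesgue_on(2)[OF t \<Omega>, of k]
        by (simp add: G_def b_def)
      have "K * A \<le> K * ((1 + d) * (LINT x|lborel. (\<phi> k x)^2) + (1 + 1/d) * a k)"
        using 1 K by (rule mult_left_mono)
      also have "\<dots> = (1 + d) * (K * (LINT x|lborel. (\<phi> k x)^2)) + K * ((1 + 1/d) * a k)"
        by (simp add: algebra_simps)
      also have "\<dots> \<le> (1 + d) * ((1 + d) * G + (1 + 1/d) * b k) + K * ((1 + 1/d) * a k)"
        using d order_trans[OF ineq[OF t] 2] by (intro add_right_mono mult_left_mono) auto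
      finally show ?thesis .
    qed
    moreover have "(\<lambda>k. (1 + d) * ((1 + d) * G + (1 + 1/d) * b k) + K * ((1 + 1/d) * a k)) \<longlonglongrightarrow>
      (1 + d) * ((1 + d) * G + (1 + 1/d) * 0) + K * ((1 + 1/d) * 0)"
      by (intro tendsto_intros a0 b0)
    ultimately show ?thesis by (intro tendsto_lowerbound[where F=sequentially]) auto
  qed
  have "((\<lambda>d. (1 + d) * ((1 + d) * G)) \<longlongrightarrow> (1 + 0) * ((1 + 0) * G)) (at_right 0)"
    by (intro tendsto_intros)
  then have "((\<lambda>d. (1 + d) * ((1 + d) * G)) \<longlongrightarrow> G) (at_right 0)" by simp
  moreover have "eventually (\<lambda>d. K * A \<le> (1 + d) * ((1 + d) * G)) (at_right 0)"
    by (rule eventually_mono[OF eventually_at_right_less]) (rule main)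
  ultimately have "K * A \<le> G" by (rule tendsto_lowerbound) simp
  then show ?thesis by (simp add: A_def G_def)
qed

lemma not_AE_zero_lebesgue_on:
  fixes \<phi> :: "real^'n::finite \<Rightarrow> real"
  assumes "open \<Omega>" "continuous_on UNIV \<phi>" "x \<in> \<Omega>" "\<phi> x \<noteq> 0"
  shows "\<not> (AE x in lebesgue_on \<Omega>. \<phi> x = 0)"
proof
  assume "AE x in lebesgue_on \<Omega>. \<phi> x = 0"
  moreover have \<Omega>: "\<Omega> \<inter> space lebesgue \<in> sets lebesgue" using assms(1) by auto
  ultimately have "AE x in lebesgue. x \<in> \<Omega> \<longrightarrow> \<phi> x = 0"
    by (simp add: AE_restrict_space_iff)
  then obtain N where N: "{x \<in> space lebesgue. \<not> (x \<in> \<Omega> \<longrightarrow> \<phi> x = 0)} \<subseteq> N" "N \<in> null_sets lebesgue"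
    unfolding eventually_ae_filter by blast
  have "negligible N" using N(2) by (simp add: negligible_iff_null_sets)
  then have "negligible {x. \<not> (x \<in> \<Omega> \<longrightarrow> \<phi> x = 0)}"
    by (rule negligible_subset) (use N(1) in simp)
  moreover have "open {x. \<not> (x \<in> \<Omega> \<longrightarrow> \<phi> x = 0)}"
  proof -
    have "{x. \<not> (x \<in> \<Omega> \<longrightarrow> \<phi> x = 0)} = \<Omega> \<inter> {x. \<phi> x \<noteq> 0}" by auto
    moreover have "open {x. \<phi> x \<noteq> 0}" using assms(2) by (intro open_Collect_neq continuous_intros)
    ultimately show ?thesis using assms(1) by auto
  qed
  ultimately show False using open_not_negligible[of "{x. \<not> (x \<in> \<Omega> \<longrightarrow> \<phi> x = 0)}"] assms(3,4) by blast
qed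

text \<open>This makes the set of Rayleigh quotients nonempty, so that a lower bound for its elements is one for its
infimum.\<close>

lemma bump_test_function:
  fixes \<Omega> :: "(real^2) set"
  assumes op: "open \<Omega>" and a: "a \<in> \<Omega>"
  obtains \<phi> where "test_function \<Omega> \<phi>" "\<phi> a \<noteq> 0"
proof -
  obtain r where r: "r > 0" "cball a r \<subseteq> \<Omega>" using op a open_contains_cball by blast
  define \<phi> where "\<phi> x = flat (r^2 - ((axis 1 1 \<bullet> x - a$1)^2 + (axis 2 1 \<bullet> x - a$2)^2))" for x :: "real^2"
  have eq: "\<phi> x = flat (r^2 - (norm (x - a))^2)" for x
    by (simp add: \<phi>_def norm_real2 inner_axis')
  have "smooth \<phi>"
    unfolding \<phi>_def by (intro smooth_flat smooth_diff smooth_add smooth_power smooth_inner smooth_const)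
  moreover have sub: "closure {x. \<phi> x \<noteq> 0} \<subseteq> cball a r"
  proof (rule closure_minimal)
    show "{x. \<phi> x \<noteq> 0} \<subseteq> cball a r"
    proof
      fix x assume "x \<in> {x. \<phi> x \<noteq> 0}"
      then have "(norm (x - a))^2 < r^2" by (auto simp: eq flat_def split: if_splits)
      then have "norm (x - a) < r" using r(1) power_less_imp_less_base by fastforce
      then show "x \<in> cball a r" by (simp add: dist_norm norm_minus_commute)
    qed
  qed simp
  then have "compact (closure {x. \<phi> x \<noteq> 0})"
    using bounded_subset compact_closure bounded_cball bounded_closure_image by (metis closed_closure compact_cball compact_eq_bounded_closed)
  moreover have "closure {x. \<phi> x \<noteq> 0} \<subseteq> \<Omega>" using sub r(2) by (rule order_trans)
  ultimately have "test_function \<Omega> \<phi>" unfolding test_function_def by auto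
  moreover have "\<phi> a \<noteq> 0" using r(1) by (simp add: eq flat_def)
  ultimately show ?thesis using that by blast
qed

lemma first_eigenvalue_ge:
  fixes \<Omega> :: "(real^2) set"
  assumes op: "open \<Omega>" and ne: "\<Omega> \<noteq> {}" and K: "K \<ge> 0"
    and ineq: "\<And>\<phi>. test_function \<Omega> \<phi> \<Longrightarrow> K * (LINT x|lborel. (\<phi> x)^2) \<le> (LINT x|lborel. (norm (gradient \<phi> x))^2)"
  shows "K \<le> first_dirichlet_eigenvalue \<Omega>"
  unfolding first_dirichlet_eigenvalue_def
proof (rule cInf_greatest)
  obtain a where a: "a \<in> \<Omega>" using ne by blast
  obtain \<phi> where \<phi>: "test_function \<Omega> \<phi>" "\<phi> a \<noteq> 0" using bump_test_function[OF op a] by blast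
  have "(\<phi>, gradient \<phi>) \<in> H1_0 \<Omega>" using test_function_H1_0[OF \<phi>(1)] op by auto
  moreover have "\<not> (AE x in lebesgue_on \<Omega>. \<phi> x = 0)"
    using smooth_continuous[OF test_function_smooth[OF \<phi>(1)]] a \<phi>(2) by (intro not_AE_zero_lebesgue_on[OF op]) auto
  ultimately show "rayleigh_quotients \<Omega> \<noteq> {}"
    by blast
next
  fix q
  assume "q \<in> rayleigh_quotients \<Omega>"
  then obtain u g where q: "q = (LINT x|lebesgue_on \<Omega>. (norm (g x))^2) / (LINT x|lebesgue_on \<Omega>. (u x)^2)"
    and ug: "(u, g) \<in> H1_0 \<Omega>" and nz: "\<not> (AE x in lebesgue_on \<Omega>. u x = 0)" by blast
  have int: "integrable (lebesgue_on \<Omega>) (\<lambda>x. (u x)^2)" using ug by (auto simp: H1_0_def H1_def L2_on_def)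
  have "(LINT x|lebesgue_on \<Omega>. (u x)^2) \<noteq> 0"
    using integral_nonneg_eq_0_iff_AE[OF int] nz by simp
  then have "(LINT x|lebesgue_on \<Omega>. (u x)^2) > 0"
    by (simp add: less_le integral_nonneg)
  then show "K \<le> q" using H1_0_ge[OF op K ineq ug] by (simp add: q pos_le_divide_eq)
qed

text \<open>\<open>cut c t\<close> vanishes for \<open>c |t| \<le> 1\<close> and tends to \<open>t\<close> as \<open>c\<close> tends to infinity. Its derivative depends on \<open>c t\<close>
only and is therefore bounded independently of \<open>c\<close>.\<close>

definition cut :: "real \<Rightarrow> real \<Rightarrow> real" where "cut c t = t * flat (c^2 * t^2 - 1)"
definition cut' :: "real \<Rightarrow> real \<Rightarrow> real" where
  "cut' c t = flat (c^2 * t^2 - 1) + 2 * (c^2 * t^2) * flat_deriv 1 (c^2 * t^2 - 1)"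

lemma flat_deriv_1: "flat_deriv (Suc 0) t = (if t > 0 then (1/t)^2 * exp (- 1/t) else 0)"
  by (simp add: flat_deriv_def poly_monom)

lemma flat_bounds: "0 \<le> flat t" "flat t \<le> 1"
  by (auto simp: flat_def)

lemma cut_bound: "\<bar>cut c t\<bar> \<le> \<bar>t\<bar>"
  using flat_bounds[of "c^2 * t^2 - 1"] by (simp add: cut_def abs_mult mult_left_le)

text \<open>In terms of \<open>y = 1 / s\<close> the product is \<open>(y + y^2) exp (- y)\<close>.\<close>

lemma flat_deriv_1_bound: "0 \<le> (s + 1) * flat_deriv 1 s" "(s + 1) * flat_deriv 1 s \<le> 3"
proof -
  show "0 \<le> (s + 1) * flat_deriv 1 s" by (simp add: flat_deriv_1)
  show "(s + 1) * flat_deriv 1 s \<le> 3"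
  proof (cases "s > 0")
    case True
    define y where "y = 1 / s"
    have y: "y > 0" using True by (simp add: y_def)
    have "1 + y + y^2 / 2 \<le> exp y" using exp_lower_Taylor_quadratic[of y] y by simp
    then have "y + y^2 \<le> 3 * exp y" using zero_le_power2[of y] y by linarith
    then have "(y + y^2) * exp (- y) \<le> 3 * exp y * exp (- y)" by (intro mult_right_mono) auto
    moreover have "3 * exp y * exp (- y) = 3" by (simp add: exp_minus)
    moreover have "(s + 1) * flat_deriv 1 s = (y + y^2) * exp (- y)"
      using True by (simp add: flat_deriv_1 y_def field_simps power2_eq_square)
    ultimately show ?thesis by simp
  qed (simp add: flat_deriv_1)
qed

lemma cut'_bound: "\<bar>cut' c t\<bar> \<le> 7"
  using flat_bounds[of "c^2 * t^2 - 1"] flat_deriv_1_bound[of "c^2 * t^2 - 1"]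
  by (simp add: cut'_def)

lemma cut_has_derivative: "(cut c has_real_derivative cut' c t) (at t)"
proof -
  have "(flat has_real_derivative flat_deriv 1 s) (at s)" for s
    using flat_deriv_has_derivative[of 0 s] by (simp add: flat_deriv_0)
  note [derivative_intros] = DERIV_chain2[OF this]
  show ?thesis unfolding cut_def[abs_def] cut'_def
    by (auto intro!: derivative_eq_intros simp: power2_eq_square algebra_simps)
qed

lemma
  assumes "t \<noteq> 0"
  shows cut_tendsto: "(\<lambda>n. cut (real (Suc n)) t) \<longlonglongrightarrow> t"
    and cut'_tendsto: "(\<lambda>n. cut' (real (Suc n)) t) \<longlonglongrightarrow> 1"
proof -
  define s where "s n = (real (Suc n))^2 * t^2 - 1" for n
  have s: "filterlim s at_top sequentially"
  proof -
    have "filterlim (\<lambda>n. real (Suc n)) at_top sequentially"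
      using filterlim_compose[OF filterlim_real_sequentially filterlim_Suc] by simp
    then have "filterlim (\<lambda>n. (real (Suc n))^2) at_top sequentially"
      by (rule filterlim_pow_at_top[of 2, simplified])
    then have "filterlim (\<lambda>n. t^2 * (real (Suc n))^2) at_top sequentially"
      using assms by (intro filterlim_tendsto_pos_mult_at_top[OF tendsto_const]) auto
    then have "filterlim (\<lambda>n. (-1) + t^2 * (real (Suc n))^2) at_top sequentially"
      by (intro filterlim_tendsto_add_at_top[OF tendsto_const])
    then show ?thesis unfolding s_def by (simp add: algebra_simps)
  qed
  have inv: "(\<lambda>n. 1 / s n) \<longlonglongrightarrow> 0"
    using tendsto_inverse_0_at_top[OF s] by (simp add: inverse_eq_divide)
  have ev: "eventually (\<lambda>n. s n > 0) sequentially" using s by (simp add: filterlim_at_top_dense)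
  have "(\<lambda>n. exp (- (1 / s n))) \<longlonglongrightarrow> exp (- 0)" by (intro tendsto_intros inv)
  then have e1: "(\<lambda>n. exp (- (1 / s n))) \<longlonglongrightarrow> 1" by simp
  have f: "(\<lambda>n. flat (s n)) \<longlonglongrightarrow> 1"
    by (rule Lim_transform_eventually[OF e1]) (use ev in \<open>auto simp: flat_def elim!: eventually_mono\<close>)
  have "(\<lambda>n. (1 / s n + (1 / s n)^2) * exp (- (1 / s n))) \<longlonglongrightarrow> (0 + 0^2) * 1"
    by (intro tendsto_intros inv e1)
  then have e2: "(\<lambda>n. (1 / s n + (1 / s n)^2) * exp (- (1 / s n))) \<longlonglongrightarrow> 0" by simp
  have g: "(\<lambda>n. (s n + 1) * flat_deriv 1 (s n)) \<longlonglongrightarrow> 0"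
    by (rule Lim_transform_eventually[OF e2])
      (use ev in \<open>auto simp: flat_deriv_1 field_simps power2_eq_square elim!: eventually_mono\<close>)
  have "(\<lambda>n. t * flat (s n)) \<longlonglongrightarrow> t * 1" by (intro tendsto_intros f)
  then show "(\<lambda>n. cut (real (Suc n)) t) \<longlonglongrightarrow> t" by (simp add: cut_def s_def)
  have "(\<lambda>n. flat (s n) + 2 * ((s n + 1) * flat_deriv 1 (s n))) \<longlonglongrightarrow> 1 + 2 * 0" by (intro tendsto_intros f g)
  then show "(\<lambda>n. cut' (real (Suc n)) t) \<longlonglongrightarrow> 1" by (simp add: cut'_def s_def mult.assoc)
qed

lemma smooth_cut: "smooth f \<Longrightarrow> smooth (\<lambda>x. cut c (f x))"
  unfolding cut_def by (intro smooth_mult smooth_flat smooth_diff smooth_power smooth_const)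

lemma integrable_indicator_bounded:
  fixes f :: "'a::euclidean_space \<Rightarrow> real"
  assumes "continuous_on UNIV f" "bounded A" "A \<in> sets borel"
  shows "integrable lborel (\<lambda>x. indicator A x * f x)"
proof -
  have "integrable lborel (\<lambda>x. indicator (closure A) x *\<^sub>R f x)"
    using assms by (intro borel_integrable_compact continuous_on_subset[OF assms(1)]) auto
  from integrable_mult_indicator[OF _ this, of A] assms(3)
  have "integrable lborel (\<lambda>x. indicator A x *\<^sub>R indicator (closure A) x *\<^sub>R f x)" by simp
  also have "(\<lambda>x. indicator A x *\<^sub>R indicator (closure A) x *\<^sub>R f x) = (\<lambda>x. indicator A x * f x)"
  proof
    fix x show "indicator A x *\<^sub>R indicator (closure A) x *\<^sub>R f x = indicator A x * f x"
      using closure_subset[of A] by (cases "x \<in> A") auto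
  qed
  finally show ?thesis .
qed

text \<open>The cut-off of \<open>f\<close>, set to 0 outside \<open>A\<close>, is a test function, because its support lies in the compact
subset of \<open>A\<close> where \<open>|f|\<close> is at least \<open>1 / c\<close>. Its gradient tends to that of \<open>f\<close> where \<open>f\<close> is not 0, and
to 0 elsewhere, which can only lower the limit of the energies.\<close>

lemma first_eigenvalue_le:
  fixes f :: "real^2 \<Rightarrow> real"
  assumes f: "smooth f" and op: "open A" "open \<Omega>" "A \<subseteq> \<Omega>" and bd: "bounded A"
    and zero: "\<And>x. x \<in> frontier A \<Longrightarrow> f x = 0"
  shows "first_dirichlet_eigenvalue \<Omega> * (LINT x|lborel. indicator A x * (f x)^2) \<le>
    (LINT x|lborel. indicator A x * (norm (gradient f x))^2)"
proof -
  define \<phi> where "\<phi> n x = indicator A x * cut (real (Suc n)) (f x)" for n x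
  have U: "open {x. \<bar>f x\<bar> < 1 / real (Suc n)}" for n
    by (intro open_Collect_less continuous_intros smooth_continuous[OF f])
  have cut0: "cut (real (Suc n)) t = 0" if "\<bar>t\<bar> \<le> 1 / real (Suc n)" for n t
  proof -
    have "(real (Suc n) * \<bar>t\<bar>)^2 \<le> 1^2" using that by (intro power_mono) (auto simp: field_simps)
    then show ?thesis by (simp add: cut_def flat_def power_mult_distrib)
  qed
  have s: "smooth (\<phi> n)" for n
    unfolding \<phi>_def
    by (rule smooth_indicator_mult[OF op(1) U[of n] _ smooth_cut[OF f]]) (auto simp: zero cut0 simp del: of_nat_Suc)
  have t: "test_function \<Omega> (\<phi> n)" for n
  proof -
    define K where "K = closure A \<inter> {x. 1 / real (Suc n) \<le> \<bar>f x\<bar>}"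
    have "closed K" unfolding K_def
      by (intro closed_Int closed_closure closed_Collect_le continuous_intros smooth_continuous[OF f])
    moreover have "bounded K" unfolding K_def using bd by (meson bounded_Int bounded_closure)
    ultimately have K: "compact K" using compact_eq_bounded_closed by blast
    have "{x. \<phi> n x \<noteq> 0} \<subseteq> K"
    proof
      fix x assume "x \<in> {x. \<phi> n x \<noteq> 0}"
      then have "x \<in> A" "cut (real (Suc n)) (f x) \<noteq> 0" by (auto simp: \<phi>_def indicator_def split: if_splits)
      with cut0[of "f x" n] closure_subset[of A] show "x \<in> K"
        unfolding K_def by (simp del: of_nat_Suc) (meson linear subsetD)
    qed
    then have sub: "closure {x. \<phi> n x \<noteq> 0} \<subseteq> K" using \<open>closed K\<close> by (rule closure_minimal)
    have "K \<subseteq> A"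
    proof
      fix x assume x: "x \<in> K"
      then have "f x \<noteq> 0" unfolding K_def by auto
      then show "x \<in> A" using x zero[of x] op(1) unfolding K_def frontier_def by (auto simp: interior_open)
    qed
    moreover have "compact (closure {x. \<phi> n x \<noteq> 0})"
      using K sub by (meson closed_closure compact_imp_bounded bounded_subset compact_eq_bounded_closed)
    ultimately show ?thesis using s sub op(3) unfolding test_function_def by blast
  qed
  have grad: "gradient (\<phi> n) x = (indicator A x * cut' (real (Suc n)) (f x)) *\<^sub>R gradient f x" for n x
  proof (rule gradient_eqI)
    have "((\<lambda>x. cut (real (Suc n)) (f x)) has_derivative (\<lambda>h. cut' (real (Suc n)) (f x) * (gradient f x \<bullet> h))) (at x)"
      using has_derivative_compose[OF smooth_gradient[OF f], of "cut (real (Suc n))" "(*) (cut' (real (Suc n)) (f x))" x] cut_has_derivative[of "real (Suc n)" "f x"]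
      by (simp add: has_field_derivative_def)
    from has_derivative_indicator_mult[OF op(1) U[of n] _ _ this]
    show "(\<phi> n has_derivative (\<lambda>h. ((indicator A x * cut' (real (Suc n)) (f x)) *\<^sub>R gradient f x) \<bullet> h)) (at x)"
      unfolding \<phi>_def by (auto simp: zero cut0 mult.assoc subset_iff simp del: of_nat_Suc)
  qed
  have iA: "A \<in> sets borel" using op by auto
  have int: "integrable lborel (\<lambda>x. indicator A x * (f x)^2)" "integrable lborel (\<lambda>x. indicator A x * (norm (gradient f x))^2)"
    by (auto intro!: integrable_indicator_bounded bd iA continuous_intros smooth_continuous[OF f] continuous_gradient[OF f])
  have m: "f \<in> borel_measurable lborel" "(\<lambda>x. gradient f x) \<in> borel_measurable lborel"
    using borel_measurable_continuous_onI[OF smooth_continuous[OF f]] borel_measurable_continuous_onI[OF continuous_gradient[OF f]] by auto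
  have l1: "(\<lambda>n. LINT x|lborel. (\<phi> n x)^2) \<longlonglongrightarrow> (LINT x|lborel. indicator A x * (f x)^2)"
  proof (rule integral_dominated_convergence[where w="\<lambda>x. indicator A x * (f x)^2"])
    show "(\<lambda>x. (\<phi> n x)^2) \<in> borel_measurable lborel" for n
      using borel_measurable_continuous_onI[OF smooth_continuous[OF s]] by simp
    show "AE x in lborel. (\<lambda>n. (\<phi> n x)^2) \<longlonglongrightarrow> indicator A x * (f x)^2"
    proof (rule AE_I2)
      fix x
      have "(\<lambda>n. cut (real (Suc n)) (f x)) \<longlonglongrightarrow> f x"
        using cut_tendsto[of "f x"] by (cases "f x = 0") (auto simp: cut_def)
      then have "(\<lambda>n. (\<phi> n x)^2) \<longlonglongrightarrow> (indicator A x * f x)^2" unfolding \<phi>_def by (intro tendsto_intros)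
      then show "(\<lambda>n. (\<phi> n x)^2) \<longlonglongrightarrow> indicator A x * (f x)^2" by (cases "x \<in> A") auto
    qed
    show "AE x in lborel. norm ((\<phi> n x)^2) \<le> indicator A x * (f x)^2" for n
      using cut_bound[of "real (Suc n)"] by (intro AE_I2) (auto simp: \<phi>_def indicator_def abs_le_square_iff[symmetric])
  qed (use int m iA in auto)
  \<comment> \<open>The pointwise limit of the energy densities.\<close>
  define E where "E x = indicator A x * (if f x = 0 then 0 else (norm (gradient f x))^2)" for x
  have mE: "E \<in> borel_measurable lborel" unfolding E_def using m iA by simp
  have l2: "(\<lambda>n. LINT x|lborel. (norm (gradient (\<phi> n) x))^2) \<longlonglongrightarrow> (LINT x|lborel. E x)"
  proof (rule integral_dominated_convergence[where w="\<lambda>x. 49 * (indicator A x * (norm (gradient f x))^2)"])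
    show "(\<lambda>x. (norm (gradient (\<phi> n) x))^2) \<in> borel_measurable lborel" for n
      using borel_measurable_continuous_onI[OF continuous_gradient[OF s]] by simp
    show "AE x in lborel. (\<lambda>n. (norm (gradient (\<phi> n) x))^2) \<longlonglongrightarrow> E x"
    proof (rule AE_I2)
      fix x
      show "(\<lambda>n. (norm (gradient (\<phi> n) x))^2) \<longlonglongrightarrow> E x"
      proof (cases "f x = 0")
        case True
        then show ?thesis by (simp add: grad E_def cut'_def flat_def flat_deriv_1)
      next
        case False
        have "(\<lambda>n. (norm ((indicator A x * cut' (real (Suc n)) (f x)) *\<^sub>R gradient f x))^2) \<longlonglongrightarrow>
          (norm ((indicator A x * 1) *\<^sub>R gradient f x))^2"
          by (intro tendsto_intros cut'_tendsto False)
        then show ?thesis using False unfolding grad E_def by (cases "x \<in> A") auto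
      qed
    qed
    show "AE x in lborel. norm ((norm (gradient (\<phi> n) x))^2) \<le> 49 * (indicator A x * (norm (gradient f x))^2)" for n
    proof (rule AE_I2)
      fix x
      have "(cut' (real (Suc n)) (f x))^2 \<le> 7^2"
        using cut'_bound[of "real (Suc n)" "f x"] by (simp only: abs_le_square_iff[symmetric])
      then have "(cut' (real (Suc n)) (f x))^2 * (norm (gradient f x))^2 \<le> 49 * (norm (gradient f x))^2"
        by (intro mult_right_mono) auto
      then show "norm ((norm (gradient (\<phi> n) x))^2) \<le> 49 * (indicator A x * (norm (gradient f x))^2)"
        by (auto simp: grad indicator_def power_mult_distrib)
    qed
  qed (use int mE in auto)
  have "first_dirichlet_eigenvalue \<Omega> * (LINT x|lborel. indicator A x * (f x)^2) \<le> (LINT x|lborel. E x)"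
    by (rule LIMSEQ_le[OF tendsto_mult[OF tendsto_const l1] l2])
      (intro exI allI impI first_eigenvalue_le_test[OF op(2) t])
  also have "\<dots> \<le> (LINT x|lborel. indicator A x * (norm (gradient f x))^2)"
    by (rule integral_mono'[OF int(2)]) (auto simp: E_def indicator_def)
  finally show ?thesis .
qed

section \<open>Barycentric coordinates\<close>

definition cross2 :: "real^2 \<Rightarrow> real^2 \<Rightarrow> real" where
  "cross2 a b = a$1 * b$2 - a$2 * b$1"

text \<open>The affine function that is 1 at \<open>p\<close> and 0 on the line through \<open>q\<close> and \<open>r\<close>, as a quotient of signed areas.\<close>

definition bary :: "real^2 \<Rightarrow> real^2 \<Rightarrow> real^2 \<Rightarrow> real^2 \<Rightarrow> real" where
  "bary p q r x = cross2 (x - r) (q - r) / cross2 (p - r) (q - r)"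

lemma cross2_cyclic: "cross2 (q - p) (r - p) = cross2 (p - r) (q - r)" "cross2 (r - q) (p - q) = cross2 (p - r) (q - r)"
  by (simp_all add: cross2_def algebra_simps)

lemma cross2_combination: "cross2 (x *\<^sub>R a + y *\<^sub>R b) b = x * cross2 a b"
  "cross2 a (x *\<^sub>R a) = 0" "cross2 0 a = 0" "cross2 a 0 = 0"
  by (simp_all add: cross2_def algebra_simps)

lemma collinear_iff_cross2: "collinear {p, q, r} \<longleftrightarrow> cross2 (p - r) (q - r) = 0"
proof -
  have "collinear {p, q, r} \<longleftrightarrow> collinear {p, r, q}" by (simp add: insert_commute)
  also have "\<dots> \<longleftrightarrow> collinear {0, p - r, q - r}" using collinear_3[of p r q] by (simp add: NO_MATCH_def)
  also have "\<dots> \<longleftrightarrow> cross2 (p - r) (q - r) = 0"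
  proof
    assume "collinear {0, p - r, q - r}"
    then show "cross2 (p - r) (q - r) = 0"
      unfolding collinear_lemma by (metis cross2_combination(2-4))
  next
    assume 0: "cross2 (p - r) (q - r) = 0"
    define a b where "a = p - r" and "b = q - r"
    show "collinear {0, p - r, q - r}"
      unfolding collinear_lemma a_def[symmetric] b_def[symmetric]
    proof (cases "a = 0")
      case False
      have e: "a$1 * b$2 = a$2 * b$1" using 0 by (simp add: cross2_def a_def b_def)
      consider "a$1 \<noteq> 0" | "a$2 \<noteq> 0" using False by (auto simp: vec_eq_iff forall_2)
      then have "\<exists>c. b = c *\<^sub>R a"
      proof cases
        case 1
        then have "b = (b$1 / a$1) *\<^sub>R a" using e by (simp add: vec_eq_iff forall_2 field_simps)
        then show ?thesis by blast
      next
        case 2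
        then have "b = (b$2 / a$2) *\<^sub>R a" using e by (simp add: vec_eq_iff forall_2 field_simps)
        then show ?thesis by blast
      qed
      then show "a = 0 \<or> b = 0 \<or> (\<exists>c. b = c *\<^sub>R a)" by blast
    qed simp
  qed
  finally show ?thesis .
qed

lemma triangle_area_eq: "triangle_area p q r = \<bar>cross2 (p - r) (q - r)\<bar> / 2"
  unfolding triangle_area_def
  using content_triangle[of p q r] by (simp add: cross2_def algebra_simps compact_imp_closed finite_imp_compact_convex_hull)
  

lemma bary_sum:
  assumes "cross2 (p - r) (q - r) \<noteq> 0"
  shows "bary p q r x + bary q r p x + bary r p q x = 1"
proof -
  have "cross2 (x - r) (q - r) + cross2 (x - p) (r - p) + cross2 (x - q) (p - q) = cross2 (p - r) (q - r)"
    by (simp add: cross2_def algebra_simps)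
  then show ?thesis using assms
    unfolding bary_def cross2_cyclic
    by (simp add: add_divide_distrib[symmetric])
qed

lemma interior_triangle:
  assumes D: "cross2 (p - r) (q - r) \<noteq> 0"
  shows "interior (convex hull {p, q, r}) = {x. bary p q r x > 0 \<and> bary q r p x > 0 \<and> bary r p q x > 0}"
proof -
  have "\<not> collinear {p, q, r}" using D collinear_iff_cross2 by blast
  then have i: "interior (convex hull {p, q, r}) =
    {v. \<exists>x y z. 0 < x \<and> 0 < y \<and> 0 < z \<and> x + y + z = 1 \<and> x *\<^sub>R p + y *\<^sub>R q + z *\<^sub>R r = v}"
    by (rule interior_convex_hull_3_minimal) simp
  have b: "bary p q r v = x \<and> bary q r p v = y \<and> bary r p q v = z"
    if "x + y + z = 1" "x *\<^sub>R p + y *\<^sub>R q + z *\<^sub>R r = v" for x y z v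
  proof -
    have z: "z = 1 - x - y" using that(1) by simp
    have e: "v - r = x *\<^sub>R (p - r) + y *\<^sub>R (q - r)" "v - p = y *\<^sub>R (q - p) + z *\<^sub>R (r - p)"
      "v - q = z *\<^sub>R (r - q) + x *\<^sub>R (p - q)"
      unfolding that(2)[symmetric] z by (simp_all add: algebra_simps)
    have "cross2 (v - r) (q - r) = x * cross2 (p - r) (q - r)"
      "cross2 (v - p) (r - p) = y * cross2 (q - p) (r - p)"
      "cross2 (v - q) (p - q) = z * cross2 (r - q) (p - q)"
      by (simp_all only: e cross2_combination)
    then show ?thesis using D unfolding bary_def cross2_cyclic by simp
  qed
  have c: "bary p q r v *\<^sub>R p + bary q r p v *\<^sub>R q + bary r p q v *\<^sub>R r = v" for v
  proof -
    interpret chart r "p - r" "q - r" "cross2 (p - r) (q - r)"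
      by unfold_locales (use D in \<open>auto simp: cross2_def\<close>)
    have "bary p q r v = H v $ 1" "bary q r p v = H v $ 2"
      unfolding bary_def cross2_cyclic H_def
      by (simp_all add: cross2_def algebra_simps)
    moreover have "bary r p q v = 1 - bary p q r v - bary q r p v" using bary_sum[OF D, of v] by simp
    moreover have "H v $ 1 *\<^sub>R p + H v $ 2 *\<^sub>R q + (1 - H v $ 1 - H v $ 2) *\<^sub>R r = G (H v)"
      by (simp add: G_def algebra_simps)
    ultimately show ?thesis using GH[of v] by simp
  qed
  show ?thesis unfolding i
  proof (intro set_eqI iffI; unfold mem_Collect_eq)
    fix v assume "\<exists>x y z. 0 < x \<and> 0 < y \<and> 0 < z \<and> x + y + z = 1 \<and> x *\<^sub>R p + y *\<^sub>R q + z *\<^sub>R r = v"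
    then show "bary p q r v > 0 \<and> bary q r p v > 0 \<and> bary r p q v > 0" using b by metis
  next
    fix v assume "bary p q r v > 0 \<and> bary q r p v > 0 \<and> bary r p q v > 0"
    then show "\<exists>x y z. 0 < x \<and> 0 < y \<and> 0 < z \<and> x + y + z = 1 \<and> x *\<^sub>R p + y *\<^sub>R q + z *\<^sub>R r = v"
      using c[of v] bary_sum[OF D, of v] by blast
  qed
qed

section \<open>The lower bound\<close>

lemma cot_has_derivative:
  fixes x :: real
  assumes "sin x \<noteq> 0"
  shows "(cot has_real_derivative - (1 + (cot x)^2)) (at x)"
proof -
  have "1 + (cot x)^2 = ((sin x)^2 + (cos x)^2) / (sin x)^2"
    unfolding add_divide_distrib using assms by (simp add: cot_def power_divide)
  also have "\<dots> = inverse ((sin x)^2)" unfolding sin_cos_squared_add by (simp add: inverse_eq_divide)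
  finally show ?thesis using DERIV_cot[OF assms] by simp
qed

text \<open>Here \<open>J\<close> is closed downwards, and \<open>g\<close> vanishes outside a compact set of positive numbers. So only an
interval ending at some \<open>h \<le> \<rho>\<close> contributes. With \<open>k = \<pi> / (2 \<rho>)\<close>, the function \<open>g'^2 - k^2 g^2\<close> is the
sum of a square and of the derivative of \<open>k cot (k v) g^2\<close>, whose value at \<open>h\<close> is nonnegative since
\<open>k h \<le> \<pi> / 2\<close>.\<close>

lemma wirtinger_free_end:
  fixes g g' :: "real \<Rightarrow> real"
  assumes der: "\<And>v. (g has_real_derivative g' v) (at v)" and cont: "continuous_on UNIV g'"
    and C: "compact C" "\<And>v. v \<in> C \<Longrightarrow> v > 0" "\<And>v. v \<notin> C \<Longrightarrow> g v = 0 \<and> g' v = 0"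
    and J: "J \<in> sets borel" "\<And>v w. v \<in> J \<Longrightarrow> w \<le> v \<Longrightarrow> w \<in> J" "\<And>v. v \<in> J \<Longrightarrow> v \<in> C \<Longrightarrow> v \<le> \<rho>"
  shows "0 \<le> (LINT v|lborel. indicator J v * ((g' v)^2 - (pi / (2 * \<rho>))^2 * (g v)^2))"
proof (cases "J \<inter> C = {}")
  case True
  have "indicator J v * ((g' v)^2 - (pi / (2 * \<rho>))^2 * (g v)^2) = 0" for v
    using True C(3)[of v] by (cases "v \<in> C") (auto simp: indicator_def)
  then have eq: "(\<lambda>v. indicator J v * ((g' v)^2 - (pi / (2 * \<rho>))^2 * (g v)^2)) = (\<lambda>_. 0)" by blast
  show ?thesis unfolding eq by simp
next
  case False
  then obtain c where c: "c \<in> J" "c \<in> C" by blast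
  have \<rho>: "\<rho> > 0" using C(2)[OF c(2)] J(3)[OF c] by linarith
  define k where "k = pi / (2 * \<rho>)"
  have k: "k > 0" using \<rho> by (simp add: k_def)
  define F where "F v = (g' v)^2 - k^2 * (g v)^2" for v
  have contg: "continuous_on A g" for A
    using der by (meson DERIV_isCont continuous_at_imp_continuous_on)
  have contg': "continuous_on A g'" for A using cont continuous_on_subset by blast
  have [measurable]: "g \<in> borel_measurable borel" "g' \<in> borel_measurable borel"
    using contg contg' by (auto intro: borel_measurable_continuous_onI)
  note J(1)[measurable]
  define J' where "J' = J \<inter> {..\<rho>}"
  have cJ: "c \<in> J'" using c J(3) by (auto simp: J'_def)
  have bd: "bdd_above J'" by (auto simp: J'_def intro!: bdd_aboveI)
  define h where "h = Sup J'"
  have ch: "c \<le> h" unfolding h_def by (rule cSup_upper[OF cJ bd])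
  have h\<rho>: "h \<le> \<rho>" unfolding h_def using cJ by (intro cSup_least) (auto simp: J'_def)
  obtain m where m: "m \<in> C" "\<And>v. v \<in> C \<Longrightarrow> m \<le> v"
    using compact_attains_inf[OF C(1)] c(2) by blast
  \<comment> \<open>The cotangent has a pole at 0, so the interval starts where \<open>g\<close> is still 0.\<close>
  define \<delta> where "\<delta> = m / 2"
  have \<delta>: "\<delta> > 0" "\<And>v. v \<in> C \<Longrightarrow> \<delta> < v" using C(2)[OF m(1)] m(2) unfolding \<delta>_def by force+
  have \<delta>h: "\<delta> < h" using \<delta>(2)[OF c(2)] ch by simp
  have "(LINT v|lborel. indicator J v * F v) = (LINT v|lborel. indicator {\<delta>..h} v *\<^sub>R F v)"
  proof (rule integral_cong_AE)
    show "AE v in lborel. indicator J v * F v = indicator {\<delta>..h} v *\<^sub>R F v"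
    proof (rule eventually_mono[OF AE_lborel_singleton[of h]])
      fix v assume "v \<noteq> h"
      show "indicator J v * F v = indicator {\<delta>..h} v *\<^sub>R F v"
      proof (cases "v \<in> C")
        case True
        show ?thesis
        proof (cases "v < h")
          case True
          then obtain j where "j \<in> J'" "v < j" unfolding h_def using less_cSup_iff[OF _ bd] cJ by blast
          then have "v \<in> J" using J(2)[of j v] by (auto simp: J'_def)
          then show ?thesis using True \<delta>(2)[OF \<open>v \<in> C\<close>] by simp
        next
          case False
          have "v \<notin> J"
          proof
            assume "v \<in> J"
            then have "v \<in> J'" using J(3) True by (simp add: J'_def)
            then have "v \<le> h" unfolding h_def using bd by (rule cSup_upper)
            then show False using False \<open>v \<noteq> h\<close> by simp
          qed
          then show ?thesis using False \<open>v \<noteq> h\<close> by simp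
        qed
      qed (simp add: F_def C(3))
    qed
  qed (unfold F_def, measurable)
  also have "0 \<le> \<dots>"
  proof -
    let ?G = "\<lambda>v. 2 * k * cot (k * v) * g v * g' v - k^2 * (1 + (cot (k * v))^2) * (g v)^2"
    have sinpos: "sin (k * v) > 0" if "v \<in> {\<delta>..h}" for v
    proof (rule sin_gt_zero)
      show "0 < k * v" using that \<delta> k by simp
      have "k * v \<le> k * \<rho>" using that h\<rho> k by simp
      also have "\<dots> < pi" using \<rho> by (simp add: k_def)
      finally show "k * v < pi" .
    qed
    have nz: "sin (k * v) \<noteq> 0" if "v \<in> {\<delta>..h}" for v using sinpos[OF that] by simp
    have cG: "continuous_on {\<delta>..h} ?G" using nz by (intro continuous_intros contg contg' continuous_on_compose2[OF continuous_on_cot[OF continuous_on_id]]) auto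
    have cF: "continuous_on {\<delta>..h} F" unfolding F_def by (intro continuous_intros contg contg')
    have le: "?G v \<le> F v" if "v \<in> {\<delta>..h}" for v
    proof -
      have "F v - ?G v = (g' v - k * cot (k * v) * g v)^2"
        unfolding F_def by (simp add: power2_eq_square algebra_simps)
      also have "\<dots> \<ge> 0" by simp
      finally show ?thesis by simp
    qed
    have iG: "integrable lborel (\<lambda>v. indicator {\<delta>..h} v *\<^sub>R ?G v)" "integrable lborel (\<lambda>v. indicator {\<delta>..h} v *\<^sub>R F v)"
      by (rule borel_integrable_compact[OF compact_Icc], fact)+
    have "0 \<le> (LINT v|lborel. indicator {\<delta>..h} v *\<^sub>R ?G v)"
    proof -
      have "(LINT v|lborel. indicator {\<delta>..h} v *\<^sub>R ?G v) =
        k * cot (k * h) * (g h)^2 - k * cot (k * \<delta>) * (g \<delta>)^2"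
      proof (rule integral_FTC_Icc[where F="\<lambda>v. k * cot (k * v) * (g v)^2", OF less_imp_le[OF \<delta>h] _ cG])
        fix v assume "\<delta> \<le> v" "v \<le> h"
        then have s: "sin (k * v) \<noteq> 0" using nz by simp
        have "((\<lambda>v. k * cot (k * v) * (g v)^2) has_real_derivative ?G v) (at v)"
          by (auto intro!: derivative_eq_intros der DERIV_chain2[where f=cot and g="\<lambda>v. k * v" and x=v, OF cot_has_derivative[OF s]])
            (simp add: power2_eq_square algebra_simps)
        then show "((\<lambda>v. k * cot (k * v) * (g v)^2) has_vector_derivative ?G v) (at v within {\<delta>..h})"
          by (simp add: has_real_derivative_iff_has_vector_derivative[symmetric] has_field_derivative_at_within)
      qed
      moreover have "g \<delta> = 0" using C(3)[of \<delta>] \<delta>(2)[of \<delta>] by blast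
      moreover have "0 \<le> cos (k * h)"
      proof (rule cos_ge_zero)
        have "k * h \<le> k * \<rho>" using h\<rho> k by simp
        then show "k * h \<le> pi / 2" using \<rho> by (simp add: k_def)
        show "- (pi / 2) \<le> k * h" using k \<delta>h \<delta>(1) by (smt (verit) mult_pos_pos pi_gt_zero divide_pos_pos)
      qed
      ultimately show ?thesis using sinpos[of h] \<delta>h k by (simp add: cot_def)
    qed
    also have "\<dots> \<le> (LINT v|lborel. indicator {\<delta>..h} v *\<^sub>R F v)"
      by (rule integral_mono[OF iG]) (use le in \<open>auto simp: indicator_def\<close>)
    finally show ?thesis .
  qed
  finally show ?thesis by (simp add: F_def k_def)
qed

text \<open>The unit normal of the side \<open>qr\<close> that points towards \<open>p\<close>.\<close>

definition inward :: "real^2 \<Rightarrow> real^2 \<Rightarrow> real^2 \<Rightarrow> real^2" where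
  "inward p q r = (sgn (cross2 (p - r) (q - r)) / norm (q - r)) *\<^sub>R vec2 ((q - r)$2) (- ((q - r)$1))"

definition side_dist :: "real^2 \<Rightarrow> real^2 \<Rightarrow> real^2 \<Rightarrow> real^2 \<Rightarrow> real" where
  "side_dist p q r x = inward p q r \<bullet> (x - r)"

lemma cross2_nz_imp: "cross2 a b \<noteq> 0 \<Longrightarrow> a \<noteq> 0 \<and> b \<noteq> 0"
  using cross2_combination by auto

lemma perp_inner: "vec2 (e$2) (- (e$1)) \<bullet> y = cross2 y e"
  by (simp add: inner_real2 cross2_def algebra_simps)

lemma side_dist_bary:
  assumes "cross2 (p - r) (q - r) \<noteq> 0"
  shows "side_dist p q r x = \<bar>cross2 (p - r) (q - r)\<bar> / norm (q - r) * bary p q r x"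
proof -
  have "side_dist p q r x = sgn (cross2 (p - r) (q - r)) / norm (q - r) * cross2 (x - r) (q - r)"
    unfolding side_dist_def inward_def inner_scaleR_left perp_inner ..
  also have "\<dots> = \<bar>cross2 (p - r) (q - r)\<bar> / norm (q - r) * bary p q r x"
    using assms by (auto simp: bary_def sgn_if abs_if)
  finally show ?thesis .
qed

lemma norm_inward:
  assumes "cross2 (p - r) (q - r) \<noteq> 0"
  shows "norm (inward p q r) = 1"
proof -
  have "(norm (vec2 ((q - r)$2) (- ((q - r)$1))))^2 = (norm (q - r))^2"
    unfolding norm_real2 by (simp add: power2_commute)
  then have "norm (vec2 ((q - r)$2) (- ((q - r)$1))) = norm (q - r)" by simp
  then show ?thesis using assms cross2_nz_imp[OF assms] by (simp add: inward_def sgn_if)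
qed

lemma side_dist_moved: "side_dist p q r (x - t *\<^sub>R n) = side_dist p q r x - t * (inward p q r \<bullet> n)"
  by (simp add: side_dist_def algebra_simps inner_diff_right)

lemma continuous_side_dist: "continuous_on A (side_dist p q r)"
  unfolding side_dist_def by (intro continuous_intros)

text \<open>This is applied to the set \<open>R\<close> of points whose nearest side is \<open>qr\<close>. On each line perpendicular to that side,
with the distance from the side as coordinate, \<open>R\<close> is an initial piece, and the one-dimensional
inequality applies.\<close>

lemma side_region:
  fixes \<phi> :: "real^2 \<Rightarrow> real"
  assumes D: "cross2 (p - r) (q - r) \<noteq> 0" and s: "smooth \<phi>"
    and K: "compact K" "\<And>x. x \<notin> K \<Longrightarrow> \<phi> x = 0" "\<And>x. x \<notin> K \<Longrightarrow> gradient \<phi> x = 0"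
    and pos: "\<And>x. x \<in> K \<Longrightarrow> 0 < bary p q r x"
    and R: "R \<in> sets borel" "\<And>x t. x \<in> R \<Longrightarrow> 0 \<le> t \<Longrightarrow> x - t *\<^sub>R inward p q r \<in> R"
      "\<And>x. x \<in> R \<Longrightarrow> x \<in> K \<Longrightarrow> side_dist p q r x \<le> \<rho>"
  shows "integrable lborel (\<lambda>x. indicator R x * ((norm (gradient \<phi> x))^2 - (pi / (2 * \<rho>))^2 * (\<phi> x)^2))" (is "integrable lborel ?F")
    and "0 \<le> (LINT x|lborel. indicator R x * ((norm (gradient \<phi> x))^2 - (pi / (2 * \<rho>))^2 * (\<phi> x)^2))"
proof -
  define n where "n = inward p q r"
  define e where "e = q - r"
  have "integrable lborel (\<lambda>x. (norm (gradient \<phi> x))^2 - (pi / (2 * \<rho>))^2 * (\<phi> x)^2)"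
    by (rule integrable_compact_support[OF _ K(1)])
      (auto intro!: continuous_intros smooth_continuous[OF s] continuous_gradient[OF s] simp: K)
  from integrable_mult_indicator[OF _ this, of R] R(1) show int: "integrable lborel ?F" by simp
  have nn: "norm n = 1" unfolding n_def by (rule norm_inward[OF D])
  have "cross2 e n = - sgn (cross2 (p - r) (q - r)) / norm e * (norm e)^2"
  proof -
    have "cross2 e (c *\<^sub>R vec2 (e$2) (- (e$1))) = - c * (norm e)^2" for c
      unfolding norm_real2 by (simp add: cross2_def power2_eq_square algebra_simps)
    then show ?thesis by (simp add: n_def inward_def e_def)
  qed
  then have enz: "cross2 e n \<noteq> 0" using D cross2_nz_imp[OF D] by (simp add: e_def sgn_if)
  interpret chart r e n "cross2 e n" using enz by unfold_locales (simp add: cross2_def)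
  have ne: "n \<bullet> e = 0" by (simp add: n_def inward_def e_def[symmetric] inner_real2)
  have sd: "side_dist p q r (r + u *\<^sub>R e + v *\<^sub>R n) = v" for u v
    using ne nn by (simp add: side_dist_def n_def[symmetric] inner_add_right norm_eq_1)
  have "0 \<le> (LINT v|lborel. ?F (r + u *\<^sub>R e + v *\<^sub>R n))" for u
  proof -
    let ?y = "\<lambda>v. r + u *\<^sub>R e + v *\<^sub>R n"
    have cy: "continuous_on A ?y" for A by (intro continuous_intros)
    let ?g = "\<lambda>v. \<phi> (?y v)" and ?g' = "\<lambda>v. gradient \<phi> (?y v) \<bullet> n"
    let ?C = "?y -` K" and ?J = "?y -` R"
    have C: "compact ?C"
    proof -
      have "closed ?C" using K(1) by (intro closed_vimage compact_imp_closed cy)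
      moreover have "bounded ?C"
      proof -
        obtain B where B: "\<And>x. x \<in> K \<Longrightarrow> norm x \<le> B" using K(1) compact_imp_bounded bounded_iff by metis
        have "norm v \<le> B + norm (r + u *\<^sub>R e)" if "v \<in> ?C" for v
        proof -
          have "norm (v *\<^sub>R n) \<le> norm (?y v) + norm (r + u *\<^sub>R e)"
            using norm_triangle_ineq4[of "?y v" "r + u *\<^sub>R e"] by simp
          then show ?thesis using B[of "?y v"] that nn by simp
        qed
        then show ?thesis using bounded_iff by blast
      qed
      ultimately show ?thesis using compact_eq_bounded_closed by blast
    qed
    have "0 \<le> (LINT v|lborel. indicator ?J v * ((?g' v)^2 - (pi / (2 * \<rho>))^2 * (?g v)^2))"
    proof (rule wirtinger_free_end[OF _ _ C])
      fix v
      show "(?g has_real_derivative ?g' v) (at v)"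
      proof -
        have "(?y has_derivative (\<lambda>h. h *\<^sub>R n)) (at v)" by (auto intro!: derivative_eq_intros)
        from has_derivative_compose[OF this smooth_gradient[OF s]]
        show ?thesis by (simp add: has_field_derivative_def mult_commute_abs)
      qed
      show "continuous_on UNIV ?g'"
        by (intro continuous_intros continuous_on_compose2[OF continuous_gradient[OF s, of UNIV] cy]) auto
      show "v > 0" if "v \<in> ?C"
      proof -
        have "0 < \<bar>cross2 (p - r) (q - r)\<bar> / norm (q - r) * bary p q r (?y v)"
          using pos[of "?y v"] that D cross2_nz_imp[OF D] by (intro mult_pos_pos divide_pos_pos) auto
        then show ?thesis using sd[of u v] side_dist_bary[OF D] by simp
      qed
      show "?g v = 0 \<and> ?g' v = 0" if "v \<notin> ?C" using K that by simp
      show "?J \<in> sets borel"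
        using measurable_sets[OF borel_measurable_continuous_onI[OF cy] R(1)] by simp
      show "w \<in> ?J" if "v \<in> ?J" "w \<le> v" for w
        using R(2)[of "?y v" "v - w"] that by (simp add: n_def[symmetric] algebra_simps)
      show "v \<le> \<rho>" if "v \<in> ?J" "v \<in> ?C" using R(3)[of "?y v"] that sd[of u v] by simp
    qed
    also have "\<dots> \<le> (LINT v|lborel. ?F (?y v))"
    proof (rule integral_mono)
      have J: "?J \<in> sets lborel" using measurable_sets[OF borel_measurable_continuous_onI[OF cy] R(1)] by simp
      have "integrable lborel (\<lambda>v. (?g' v)^2 - (pi / (2 * \<rho>))^2 * (?g v)^2)"
        by (rule integrable_compact_support[OF _ C])
         (auto intro!: continuous_intros continuous_on_compose2[OF continuous_gradient[OF s, of UNIV] cy] continuous_on_compose2[OF smooth_continuous[OF s, of UNIV] cy] simp: K)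
      from integrable_mult_indicator[OF J this]
      show "integrable lborel (\<lambda>v. indicator ?J v * ((?g' v)^2 - (pi / (2 * \<rho>))^2 * (?g v)^2))" by simp
      have "integrable lborel (\<lambda>v. (norm (gradient \<phi> (?y v)))^2 - (pi / (2 * \<rho>))^2 * (?g v)^2)"
        by (rule integrable_compact_support[OF _ C])
         (auto intro!: continuous_intros continuous_on_compose2[OF continuous_gradient[OF s, of UNIV] cy] continuous_on_compose2[OF smooth_continuous[OF s, of UNIV] cy] simp: K)
      from integrable_mult_indicator[OF J this]
      show "integrable lborel (\<lambda>v. ?F (?y v))" by (simp add: indicator_def vimage_def)
      fix v
      have "(?g' v)^2 \<le> (norm (gradient \<phi> (?y v)))^2"
        using Cauchy_Schwarz_ineq2[of "gradient \<phi> (?y v)" n] nn by (simp add: abs_le_square_iff[symmetric])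
      then show "indicator ?J v * ((?g' v)^2 - (pi / (2 * \<rho>))^2 * (?g v)^2) \<le> ?F (?y v)"
        by (auto simp: indicator_def)
    qed
    finally show ?thesis .
  qed
  then have "0 \<le> (LINT u|lborel. LINT v|lborel. ?F (r + u *\<^sub>R e + v *\<^sub>R n))"
    by (rule Bochner_Integration.integral_nonneg)
  then show "0 \<le> (LINT x|lborel. ?F x)"
    using integral_chart_iterated(2)[OF int] by simp
qed

text \<open>The distances to the sides, weighted by the side lengths, add up to \<open>2 A\<close>, so the smallest one is at most
\<open>2 A / L\<close>. A nearest side stays nearest when one moves towards it, because no distance decreases faster
than at unit rate.\<close>

lemma triangle_eigenvalue_ge:
  assumes nc: "\<not> collinear {p, q, r}"
  shows "pi^2 * (triangle_perimeter p q r)^2 / (16 * (triangle_area p q r)^2) \<le> triangle_eigenvalue p q r"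
proof -
  define D where "D = cross2 (p - r) (q - r)"
  have D: "cross2 (p - r) (q - r) \<noteq> 0" "cross2 (q - p) (r - p) \<noteq> 0" "cross2 (r - q) (p - q) \<noteq> 0"
    using nc collinear_iff_cross2 cross2_cyclic by metis+
  have cyc: "cross2 (q - p) (r - p) = D" "cross2 (r - q) (p - q) = D" using cross2_cyclic D_def by metis+
  define L where "L = triangle_perimeter p q r"
  have L: "L = norm (q - r) + norm (r - p) + norm (p - q)"
    by (simp add: L_def triangle_perimeter_def dist_norm norm_minus_commute)
  have Lpos: "L > 0" using L cross2_nz_imp[OF D(1)] by (simp add: add_nonneg_pos add_pos_nonneg)
  define \<rho> where "\<rho> = \<bar>D\<bar> / L"
  define d1 d2 d3 where "d1 = side_dist p q r" and "d2 = side_dist q r p" and "d3 = side_dist r p q"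
  \<comment> \<open>Ties are broken so that the three regions partition the plane.\<close>
  define R1 where "R1 = {x. d1 x \<le> d2 x} \<inter> {x. d1 x \<le> d3 x}"
  define R2 where "R2 = {x. d2 x < d1 x} \<inter> {x. d2 x \<le> d3 x}"
  define R3 where "R3 = {x. d3 x < d1 x} \<inter> {x. d3 x < d2 x}"
  have cont: "continuous_on A d1" "continuous_on A d2" "continuous_on A d3" for A
    unfolding d1_def d2_def d3_def by (rule continuous_side_dist)+
  have R: "R1 \<in> sets borel" "R2 \<in> sets borel" "R3 \<in> sets borel"
    unfolding R1_def R2_def R3_def
    by (intro sets.Int borel_open[OF open_Collect_less] borel_closed[OF closed_Collect_le] cont)+
  have sum: "norm (q - r) * d1 x + norm (r - p) * d2 x + norm (p - q) * d3 x = \<bar>D\<bar>" for x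
    unfolding d1_def d2_def d3_def side_dist_bary[OF D(1)] side_dist_bary[OF D(2)] side_dist_bary[OF D(3)]
    using bary_sum[OF D(1), of x] cross2_nz_imp[OF D(1)] cross2_nz_imp[OF D(2)] cross2_nz_imp[OF D(3)]
    by (simp add: cyc D_def[symmetric] distrib_left[symmetric])
  have le: "d x \<le> \<rho>" if "d x \<le> d1 x" "d x \<le> d2 x" "d x \<le> d3 x" for d x
  proof -
    have "d x * L = norm (q - r) * d x + norm (r - p) * d x + norm (p - q) * d x" by (simp add: L algebra_simps)
    also have "\<dots> \<le> \<bar>D\<bar>" unfolding sum[of x, symmetric]
      using that by (intro add_mono mult_left_mono) auto
    finally show ?thesis using Lpos by (simp add: \<rho>_def pos_le_divide_eq)
  qed
  have n: "norm (inward p q r) = 1" "norm (inward q r p) = 1" "norm (inward r p q) = 1"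
    using norm_inward D by blast+
  have mv: "d1 (x - t *\<^sub>R n) \<ge> d1 x - t" "d2 (x - t *\<^sub>R n) \<ge> d2 x - t" "d3 (x - t *\<^sub>R n) \<ge> d3 x - t"
    if "norm n = 1" "t \<ge> 0" for x t n
  proof -
    have "t * (m \<bullet> n) \<le> t" if "norm m = 1" for m
      using norm_cauchy_schwarz[of m n] \<open>norm n = 1\<close> that \<open>t \<ge> 0\<close> by (simp add: mult_left_le)
    then show "d1 (x - t *\<^sub>R n) \<ge> d1 x - t" "d2 (x - t *\<^sub>R n) \<ge> d2 x - t" "d3 (x - t *\<^sub>R n) \<ge> d3 x - t"
      unfolding d1_def d2_def d3_def side_dist_moved using n by force+
  qed
  have mv': "d1 (x - t *\<^sub>R inward p q r) = d1 x - t" "d2 (x - t *\<^sub>R inward q r p) = d2 x - t" "d3 (x - t *\<^sub>R inward r p q) = d3 x - t"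
    for x t unfolding d1_def d2_def d3_def side_dist_moved using n by (simp_all add: norm_eq_1)
  define k where "k = pi / (2 * \<rho>)"
  define T where "T = interior (convex hull {p, q, r})"
  have T: "T = {x. bary p q r x > 0 \<and> bary q r p x > 0 \<and> bary r p q x > 0}"
    unfolding T_def by (rule interior_triangle[OF D(1)])
  have "k^2 \<le> first_dirichlet_eigenvalue T"
  proof (rule first_eigenvalue_ge)
    show "open T" unfolding T_def by simp
    have "bary p q r ((1/3) *\<^sub>R (p + q + r)) = 1/3" if "cross2 (p - r) (q - r) \<noteq> 0" for p q r :: "real^2"
    proof -
      have "cross2 ((1/3) *\<^sub>R (p + q + r) - r) (q - r) = cross2 (p - r) (q - r) / 3"
        by (simp add: cross2_def field_simps)
      then show ?thesis using that by (simp add: bary_def)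
    qed
    from this[OF D(1)] this[OF D(2)] this[OF D(3)] have "(1/3) *\<^sub>R (p + q + r) \<in> T"
      unfolding T by (simp add: add.commute add.left_commute)
    then show "T \<noteq> {}" by blast
    show "k^2 \<ge> 0" by simp
    fix \<phi> assume t: "test_function T \<phi>"
    note s = test_function_smooth[OF t]
    obtain K where K: "compact K" "K \<subseteq> T" "\<And>x. x \<notin> K \<Longrightarrow> \<phi> x = 0" "\<And>x. x \<notin> K \<Longrightarrow> gradient \<phi> x = 0"
      using test_function_compact_support[OF t] by blast
    let ?F = "\<lambda>x. (norm (gradient \<phi> x))^2 - k^2 * (\<phi> x)^2"
    have 1: "integrable lborel (\<lambda>x. indicator R1 x * ?F x)" "0 \<le> (LINT x|lborel. indicator R1 x * ?F x)"
      unfolding k_def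
      by (rule side_region[OF D(1) s K(1,3,4) _ R(1)];
          use K(2) mv[OF n(1)] mv'(1) le[of d1] in \<open>auto simp: T R1_def subset_iff d1_def[symmetric]\<close>; smt (verit))+
    have 2: "integrable lborel (\<lambda>x. indicator R2 x * ?F x)" "0 \<le> (LINT x|lborel. indicator R2 x * ?F x)"
      unfolding k_def
      by (rule side_region[OF D(2) s K(1,3,4) _ R(2)];
          use K(2) mv[OF n(2)] mv'(2) le[of d2] in \<open>auto simp: T R2_def subset_iff d2_def[symmetric]\<close>; smt (verit))+
    have 3: "integrable lborel (\<lambda>x. indicator R3 x * ?F x)" "0 \<le> (LINT x|lborel. indicator R3 x * ?F x)"
      unfolding k_def
      by (rule side_region[OF D(3) s K(1,3,4) _ R(3)];
          use K(2) mv[OF n(3)] mv'(3) le[of d3] in \<open>auto simp: T R3_def subset_iff d3_def[symmetric]\<close>; smt (verit))+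
    have "?F x = indicator R1 x * ?F x + indicator R2 x * ?F x + indicator R3 x * ?F x" for x
      by (auto simp: R1_def R2_def R3_def indicator_def)
    then have "(LINT x|lborel. ?F x) = (LINT x|lborel. indicator R1 x * ?F x + indicator R2 x * ?F x + indicator R3 x * ?F x)"
      by presburger
    also have "\<dots> \<ge> 0" using 1 2 3 by simp
    finally have "0 \<le> (LINT x|lborel. ?F x)" .
    then show "k^2 * (LINT x|lborel. (\<phi> x)^2) \<le> (LINT x|lborel. (norm (gradient \<phi> x))^2)"
      using test_function_integrable[OF t] by simp
  qed
  moreover have "k^2 = pi^2 * (triangle_perimeter p q r)^2 / (16 * (triangle_area p q r)^2)"
    using Lpos D(1) by (simp add: k_def \<rho>_def triangle_area_eq D_def[symmetric] L_def[symmetric] power_divide power_mult_distrib)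
  ultimately show ?thesis by (simp add: triangle_eigenvalue_def T_def)
qed

section \<open>Integration over the standard simplex\<close>

definition cont2 :: "(real \<Rightarrow> real \<Rightarrow> real) \<Rightarrow> bool" where
  "cont2 G \<longleftrightarrow> continuous_on UNIV (\<lambda>z. G (fst z) (snd z))"

definition simplex2 :: "(real \<times> real) set" where
  "simplex2 = {z. 0 < fst z} \<inter> {z. 0 < snd z} \<inter> {z. fst z + snd z < 1}"

text \<open>The integral over the standard simplex; \<open>u\<close>, \<open>v\<close> and \<open>1 - u - v\<close> are the barycentric coordinates.\<close>

definition SI :: "(real \<Rightarrow> real \<Rightarrow> real) \<Rightarrow> real" where
  "SI G = (LINT z|(lborel \<Otimes>\<^sub>M lborel). indicator simplex2 z * G (fst z) (snd z))"

lemma open_simplex2: "open simplex2"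
  unfolding simplex2_def by (intro open_Int open_Collect_less continuous_intros)

lemma bounded_simplex2: "bounded simplex2"
proof (rule bounded_subset)
  show "bounded (cbox (0,0) (1,1::real))" by simp
  show "simplex2 \<subseteq> cbox (0,0) (1,1::real)" by (auto simp: simplex2_def cbox_Pair_eq)
qed

lemma SI_integrable: "cont2 G \<Longrightarrow> integrable (lborel \<Otimes>\<^sub>M lborel) (\<lambda>z. indicator simplex2 z * G (fst z) (snd z))"
  unfolding lborel_prod cont2_def
  by (intro integrable_indicator_bounded bounded_simplex2 borel_open open_simplex2)

lemma SI_add: "cont2 F \<Longrightarrow> cont2 G \<Longrightarrow> SI (\<lambda>u v. F u v + G u v) = SI F + SI G"
  using SI_integrable[of F] SI_integrable[of G] by (simp add: SI_def distrib_left)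

lemma SI_cmult: "SI (\<lambda>u v. c * G u v) = c * SI G"
proof -
  have "SI (\<lambda>u v. c * G u v) = (LINT z|(lborel \<Otimes>\<^sub>M lborel). c * (indicator simplex2 z * G (fst z) (snd z)))"
    unfolding SI_def by (intro Bochner_Integration.integral_cong) auto
  then show ?thesis by (simp add: SI_def)
qed

lemma SI_zero: "SI (\<lambda>u v. 0) = 0"
  by (simp add: SI_def)

lemma SI_iterated: "cont2 G \<Longrightarrow> SI G = (LINT u|lborel. LINT v|lborel. indicator simplex2 (u, v) * G u v)"
  using lborel_pair.integral_fst[of "\<lambda>u v. indicator simplex2 (u, v) * G u v"] SI_integrable[of G]
  by (simp add: SI_def case_prod_beta')

lemma cont2_swap: "cont2 G \<Longrightarrow> cont2 (\<lambda>u v. G v u)"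
  unfolding cont2_def by (rule continuous_on_compose2[of UNIV "\<lambda>z. G (fst z) (snd z)" UNIV "\<lambda>z. (snd z, fst z)", simplified])
    (auto intro!: continuous_intros)

lemma SI_swap:
  assumes "cont2 G"
  shows "SI (\<lambda>u v. G v u) = SI G"
proof -
  have "SI G = (LINT v|lborel. LINT u|lborel. indicator simplex2 (u, v) * G u v)"
    using lborel_pair.integral_snd[of "\<lambda>u v. indicator simplex2 (u, v) * G u v"] SI_integrable[OF assms]
    by (simp add: SI_def case_prod_beta')
  also have "\<dots> = SI (\<lambda>u v. G v u)"
    unfolding SI_iterated[OF cont2_swap[OF assms]]
    by (intro Bochner_Integration.integral_cong refl) (auto simp: simplex2_def indicator_def add.commute)
  finally show ?thesis by simp
qed

lemma cont2_flip: "cont2 G \<Longrightarrow> cont2 (\<lambda>u v. G u (1 - u - v))"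
  unfolding cont2_def by (rule continuous_on_compose2[of UNIV "\<lambda>z. G (fst z) (snd z)" UNIV "\<lambda>z. (fst z, 1 - fst z - snd z)", simplified])
    (auto intro!: continuous_intros)

text \<open>Together with \<open>SI_swap\<close> this gives invariance under all permutations of the barycentric coordinates.\<close>

lemma SI_flip:
  assumes "cont2 G"
  shows "SI (\<lambda>u v. G u (1 - u - v)) = SI G"
  unfolding SI_iterated[OF cont2_flip[OF assms]] SI_iterated[OF assms]
proof (rule Bochner_Integration.integral_cong[OF refl])
  fix u :: real
  have "(LINT v|lborel. indicator simplex2 (u, v) * G u v) =
    (LINT v|lborel. indicator simplex2 (u, (1 - u) + (-1) * v) * G u ((1 - u) + (-1) * v))"
    using lborel_integral_real_affine[of "-1" "\<lambda>v. indicator simplex2 (u, v) * G u v" "1 - u"] by simp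
  also have "\<dots> = (LINT v|lborel. indicator simplex2 (u, v) * G u (1 - u - v))"
    by (intro Bochner_Integration.integral_cong refl) (auto simp: simplex2_def indicator_def)
  finally show "(LINT v|lborel. indicator simplex2 (u, v) * G u (1 - u - v)) = (LINT v|lborel. indicator simplex2 (u, v) * G u v)" by simp
qed

lemma integral_Ioo_FTC:
  fixes F f :: "real \<Rightarrow> real"
  assumes "a \<le> b" "\<And>x. a \<le> x \<Longrightarrow> x \<le> b \<Longrightarrow> (F has_real_derivative f x) (at x)" "continuous_on {a..b} f"
  shows "(LINT x|lborel. indicator {a<..<b} x * f x) = F b - F a"
proof -
  have i: "integrable lborel (\<lambda>x. indicator {a..b} x *\<^sub>R f x)" by (rule borel_integrable_compact[OF compact_Icc assms(3)])
  then have m: "(\<lambda>x. indicator {a..b} x *\<^sub>R f x) \<in> borel_measurable lborel" by auto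
  have e: "(\<lambda>x. indicator {a<..<b} x * f x) = (\<lambda>x. indicator {a<..<b} x * (indicator {a..b} x *\<^sub>R f x))"
    by (auto simp: indicator_def fun_eq_iff)
  have m': "(\<lambda>x. indicator {a<..<b} x * f x) \<in> borel_measurable lborel" unfolding e
    using borel_measurable_integrable[OF integrable_mult_indicator[OF _ i, of "{a<..<b}"]] by simp
  have "(LINT x|lborel. indicator {a<..<b} x * f x) = (LINT x|lborel. indicator {a..b} x *\<^sub>R f x)"
  proof (rule integral_cong_AE[OF m' m])
    show "AE x in lborel. indicator {a<..<b} x * f x = indicator {a..b} x *\<^sub>R f x"
      using AE_lborel_singleton[of a] AE_lborel_singleton[of b] by eventually_elim (auto simp: indicator_def)
  qed
  also have "\<dots> = F b - F a"
  proof (rule integral_FTC_Icc[OF assms(1) _ assms(3)])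
    fix x assume "a \<le> x" "x \<le> b"
    from has_field_derivative_at_within[OF assms(2)[OF this]]
    show "(F has_vector_derivative f x) (at x within {a..b})"
      unfolding has_real_derivative_iff_has_vector_derivative .
  qed
  finally show ?thesis .
qed

lemma SI_eval:
  assumes G: "cont2 G" and H: "\<And>u v. (H u has_real_derivative G u v) (at v)"
    and K: "\<And>u. (K has_real_derivative (H u (1 - u) - H u 0)) (at u)"
    and c: "continuous_on {0..1} (\<lambda>u. H u (1 - u) - H u 0)"
  shows "SI G = K 1 - K 0"
proof -
  have "SI G = (LINT u|lborel. indicator {0<..<1} u * (H u (1 - u) - H u 0))"
    unfolding SI_iterated[OF G]
  proof (intro Bochner_Integration.integral_cong refl)
    fix u :: real
    show "(LINT v|lborel. indicator simplex2 (u, v) * G u v) = indicator {0<..<1} u * (H u (1 - u) - H u 0)"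
    proof (cases "u \<in> {0<..<1}")
      case True
      have "(LINT v|lborel. indicator simplex2 (u, v) * G u v) = (LINT v|lborel. indicator {0<..<1 - u} v * G u v)"
        using True by (intro Bochner_Integration.integral_cong refl) (auto simp: simplex2_def indicator_def)
      also have "\<dots> = H u (1 - u) - H u 0"
      proof (rule integral_Ioo_FTC[OF _ H])
        show "continuous_on {0..1 - u} (G u)"
          by (rule continuous_on_compose2[OF G[unfolded cont2_def], of _ "\<lambda>v. (u, v)", simplified]) (intro continuous_intros)
      qed (use True in auto)
      finally show ?thesis using True by simp
    next
      case False
      then have "(\<lambda>v. indicator simplex2 (u, v) * G u v) = (\<lambda>v. 0)" by (auto simp: simplex2_def indicator_def)
      then show ?thesis using False by simp
    qed
  qed
  also have "\<dots> = K 1 - K 0" by (rule integral_Ioo_FTC[OF _ K c]) simp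
  finally show ?thesis .
qed

lemma SI_partial_v:
  assumes "cont2 G" "\<And>u v. (H u has_real_derivative G u v) (at v)" "\<And>u. H u 0 = 0" "\<And>u. H u (1 - u) = 0"
  shows "SI G = 0"
  using SI_eval[OF assms(1,2), of "\<lambda>_. 0"] assms(3,4) by simp

lemma SI_partial_u:
  assumes "cont2 G" "\<And>u v. ((\<lambda>u. H u v) has_real_derivative G u v) (at u)" "\<And>v. H 0 v = 0" "\<And>v. H (1 - v) v = 0"
  shows "SI G = 0"
  unfolding SI_swap[OF assms(1), symmetric]
  by (rule SI_partial_v[OF cont2_swap[OF assms(1)], of "\<lambda>u v. H v u"]) (use assms in auto)

definition mono3 :: "nat \<Rightarrow> nat \<Rightarrow> nat \<Rightarrow> real \<Rightarrow> real \<Rightarrow> real" where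
  "mono3 a b c u v = u ^ a * v ^ b * (1 - u - v) ^ c"

lemma cont2_mono3: "cont2 (mono3 a b c)"
  unfolding cont2_def mono3_def by (intro continuous_intros)

lemma cont2_cmult: "cont2 G \<Longrightarrow> cont2 (\<lambda>u v. c * G u v)" and cont2_add: "cont2 F \<Longrightarrow> cont2 G \<Longrightarrow> cont2 (\<lambda>u v. F u v + G u v)"
  and cont2_mult: "cont2 F \<Longrightarrow> cont2 G \<Longrightarrow> cont2 (\<lambda>u v. F u v * G u v)" and cont2_const: "cont2 (\<lambda>u v. c)"
  unfolding cont2_def by (auto intro!: continuous_intros)

text \<open>The derivative of \<open>v^(b + 1) w^(c + 1)\<close> along \<open>v\<close>, where \<open>w = 1 - u - v\<close>, integrates to 0.\<close>

lemma mono3_step: "real (Suc b) * SI (mono3 a b (Suc c)) = real (Suc c) * SI (mono3 a (Suc b) c)"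
proof -
  have "SI (\<lambda>u v. real (Suc b) * mono3 a b (Suc c) u v + (- real (Suc c)) * mono3 a (Suc b) c u v) = 0"
  proof (rule SI_partial_v[where H="mono3 a (Suc b) (Suc c)"])
    show "cont2 (\<lambda>u v. real (Suc b) * mono3 a b (Suc c) u v + (- real (Suc c)) * mono3 a (Suc b) c u v)"
      by (intro cont2_add cont2_cmult cont2_mono3)
    show "(mono3 a (Suc b) (Suc c) u has_real_derivative (real (Suc b) * mono3 a b (Suc c) u v + - real (Suc c) * mono3 a (Suc b) c u v)) (at v)" for u v
      unfolding mono3_def by (rule derivative_eq_intros refl | simp del: of_nat_Suc power_Suc)+
  qed (auto simp: mono3_def)
  then have "SI (\<lambda>u v. real (Suc b) * mono3 a b (Suc c) u v) + SI (\<lambda>u v. (- real (Suc c)) * mono3 a (Suc b) c u v) = 0"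
    by (subst (asm) SI_add[OF cont2_cmult[OF cont2_mono3] cont2_cmult[OF cont2_mono3]])
  then show ?thesis unfolding SI_cmult by (simp del: of_nat_Suc)
qed

lemma mono3_sym: "SI (mono3 a b c) = SI (mono3 b a c)"
proof -
  have "mono3 b a c = (\<lambda>u v. mono3 a b c v u)" by (auto simp: mono3_def fun_eq_iff algebra_simps)
  then show ?thesis using SI_swap[OF cont2_mono3, of a b c] by simp
qed

lemma SI_mono3_base: "SI (mono3 a 0 0) = 1 / ((real a + 1) * (real a + 2))"
proof -
  have "SI (mono3 a 0 0) = (\<lambda>u. u ^ (Suc a) / real (Suc a) - u ^ (Suc (Suc a)) / real (Suc (Suc a))) 1 - (\<lambda>u. u ^ (Suc a) / real (Suc a) - u ^ (Suc (Suc a)) / real (Suc (Suc a))) 0"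
  proof (rule SI_eval[OF cont2_mono3, where H="\<lambda>u v. u ^ a * v"])
    show "((\<lambda>u. u ^ (Suc a) / real (Suc a) - u ^ (Suc (Suc a)) / real (Suc (Suc a))) has_real_derivative u ^ a * (1 - u) - u ^ a * 0) (at u)" for u
    proof -
      have "((\<lambda>u. u ^ (Suc a) / real (Suc a) - u ^ (Suc (Suc a)) / real (Suc (Suc a))) has_real_derivative real (Suc a) * u ^ a / real (Suc a) - real (Suc (Suc a)) * u ^ Suc a / real (Suc (Suc a))) (at u)"
        by (rule derivative_eq_intros refl | simp del: of_nat_Suc power_Suc)+
      then show ?thesis by (simp add: algebra_simps del: of_nat_Suc)
    qed
  qed (auto simp: mono3_def intro!: derivative_eq_intros continuous_intros)
  also have "\<dots> = 1 / ((real a + 1) * (real a + 2))" by (simp add: field_simps)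
  finally show ?thesis .
qed

lemma SI_mono3: "SI (mono3 a b c) = fact a * fact b * fact c / fact (a + b + c + 2)"
proof (induction c arbitrary: a b)
  case (Suc c)
  have "real (Suc b) * SI (mono3 a b (Suc c)) = real (Suc c) * (fact a * fact (Suc b) * fact c / fact (a + Suc b + c + 2))"
    unfolding mono3_step Suc ..
  also have "\<dots> = real (Suc b) * (fact a * fact b * fact (Suc c) / fact (a + b + Suc c + 2))"
    by (simp add: fact_Suc del: of_nat_Suc)
  finally show ?case by (rule mult_left_cancel[THEN iffD1, OF of_nat_neq_0])
next
  case 0
  show ?case
  proof (induction b arbitrary: a)
    case 0
    have "fact (a + 2) = (real a + 2) * ((real a + 1) * fact a)" by (simp add: numeral_2_eq_2 fact_Suc algebra_simps)
    then show ?case unfolding SI_mono3_base by (simp add: mult.commute)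
  next
    case (Suc b)
    have "real (Suc a) * SI (mono3 a (Suc b) 0) = real (Suc a) * (real (Suc b) * SI (mono3 a b (Suc 0)))"
      using mono3_step[of b a 0] by simp
    also have "\<dots> = real (Suc b) * (real (Suc a) * SI (mono3 b a (Suc 0)))"
      by (simp add: mono3_sym[of a b])
    also have "\<dots> = real (Suc b) * SI (mono3 (Suc a) b 0)"
      using mono3_step[of a b 0] by (simp add: mono3_sym[of b "Suc a"])
    also have "\<dots> = real (Suc b) * (fact (Suc a) * fact b * fact 0 / fact (Suc a + b + 0 + 2))" unfolding Suc ..
    also have "\<dots> = real (Suc a) * (fact a * fact (Suc b) * fact 0 / fact (a + Suc b + 0 + 2))"
      by (simp add: fact_Suc del: of_nat_Suc)
    finally show ?case by (rule mult_left_cancel[THEN iffD1, OF of_nat_neq_0])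
  qed
qed

text \<open>Polynomials in the barycentric coordinates are given by lists of coefficients and exponents, so that
their integrals become finite sums which the simplifier evaluates.\<close>

definition trivariate :: "(real \<times> nat \<times> nat \<times> nat) list \<Rightarrow> real \<Rightarrow> real \<Rightarrow> real \<Rightarrow> real" where
  "trivariate xs a b c = (\<Sum>(k, i, j, l)\<leftarrow>xs. k * (a ^ i * b ^ j * c ^ l))"

lemma SI_trivariate:
  "cont2 (\<lambda>u v. trivariate xs u v (1 - u - v)) \<and>
   SI (\<lambda>u v. trivariate xs u v (1 - u - v)) = (\<Sum>(k, i, j, l)\<leftarrow>xs. k * (fact i * fact j * fact l / fact (i + j + l + 2)))"
proof (induction xs)
  case Nil
  then show ?case by (simp add: trivariate_def SI_zero cont2_const)
next
  case (Cons x xs)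
  obtain k i j l where x: "x = (k, i, j, l)" by (metis prod_cases4)
  have e: "(\<lambda>u v. trivariate (x # xs) u v (1 - u - v)) = (\<lambda>u v. k * mono3 i j l u v + trivariate xs u v (1 - u - v))"
    by (simp add: trivariate_def x mono3_def)
  show ?case unfolding e using Cons
    by (auto simp: SI_add cont2_cmult cont2_mono3 SI_cmult SI_mono3 cont2_add x)
qed

text \<open>Integration by parts, repeated until the polynomial factor \<open>f0\<close> of degree at most six is used up.\<close>

lemma sin_antiderivative:
  fixes w :: real
  assumes w: "w \<noteq> 0" and d:
    "\<And>u. (f0 has_real_derivative f1 u) (at u)" "\<And>u. (f1 has_real_derivative f2 u) (at u)"
    "\<And>u. (f2 has_real_derivative f3 u) (at u)" "\<And>u. (f3 has_real_derivative f4 u) (at u)"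
    "\<And>u. (f4 has_real_derivative f5 u) (at u)" "\<And>u. (f5 has_real_derivative f6 u) (at u)"
    "\<And>u. (f6 has_real_derivative 0) (at u)"
  defines "i \<equiv> 1 / w"
  shows "((\<lambda>u. - (f0 u * cos (w * u)) * i + f1 u * sin (w * u) * i^2 + f2 u * cos (w * u) * i^3 - f3 u * sin (w * u) * i^4
     - f4 u * cos (w * u) * i^5 + f5 u * sin (w * u) * i^6 + f6 u * cos (w * u) * i^7) has_real_derivative f0 u * sin (w * u)) (at u)"
proof -
  have 1: "w * i = 1" using w by (simp add: i_def)
  define S C where "S = sin (w * u)" and "C = cos (w * u)"
  have "f0 u * S = - (f1 u * C - f0 u * (S * w)) * i + (f2 u * S + f1 u * (C * w)) * i^2 + (f3 u * C - f2 u * (S * w)) * i^3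
     - (f4 u * S + f3 u * (C * w)) * i^4 - (f5 u * C - f4 u * (S * w)) * i^5 + (f6 u * S + f5 u * (C * w)) * i^6
     + (0 * C - f6 u * (S * w)) * i^7"
    using 1 by algebra
  moreover have "((\<lambda>u. - (f0 u * cos (w * u)) * i + f1 u * sin (w * u) * i^2 + f2 u * cos (w * u) * i^3 - f3 u * sin (w * u) * i^4
     - f4 u * cos (w * u) * i^5 + f5 u * sin (w * u) * i^6 + f6 u * cos (w * u) * i^7) has_real_derivative
      - (f1 u * C - f0 u * (S * w)) * i + (f2 u * S + f1 u * (C * w)) * i^2 + (f3 u * C - f2 u * (S * w)) * i^3
     - (f4 u * S + f3 u * (C * w)) * i^4 - (f5 u * C - f4 u * (S * w)) * i^5 + (f6 u * S + f5 u * (C * w)) * i^6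
     + (0 * C - f6 u * (S * w)) * i^7) (at u)"
    unfolding S_def C_def by (rule derivative_eq_intros d refl)+ (simp add: algebra_simps)
  ultimately show ?thesis by (simp only: S_def)
qed

lemma cont2_sin_mono: "cont2 (\<lambda>u v. sin (2 * pi * u) * mono3 a b c u v)"
  unfolding cont2_def mono3_def by (intro continuous_intros)

text \<open>Only the terms with a cosine survive at the end points 0 and 1.\<close>

lemma SI_sin_mult:
  assumes g: "cont2 (\<lambda>u v. sin (2 * pi * u) * g u v)" "\<And>u v. (G u has_real_derivative g u v) (at v)"
    and f0: "\<And>u. f0 u = G u (1 - u) - G u 0"
    and d: "\<And>u. (f0 has_real_derivative f1 u) (at u)" "\<And>u. (f1 has_real_derivative f2 u) (at u)"
    "\<And>u. (f2 has_real_derivative f3 u) (at u)" "\<And>u. (f3 has_real_derivative f4 u) (at u)"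
    "\<And>u. (f4 has_real_derivative f5 u) (at u)" "\<And>u. (f5 has_real_derivative f6 u) (at u)"
    "\<And>u. (f6 has_real_derivative 0) (at u)"
  shows "SI (\<lambda>u v. sin (2 * pi * u) * g u v) = - (f0 1 - f0 0) / (2 * pi) + (f2 1 - f2 0) / (2 * pi)^3
    - (f4 1 - f4 0) / (2 * pi)^5 + (f6 1 - f6 0) / (2 * pi)^7"
proof -
  have e: "sin (2 * pi * u) * G u (1 - u) - sin (2 * pi * u) * G u 0 = f0 u * sin (2 * pi * u)" for u
    by (simp add: f0 algebra_simps)
  have "continuous_on {0..1} f0" using d(1) by (meson DERIV_isCont continuous_at_imp_continuous_on)
  then have c: "continuous_on {0..1} (\<lambda>u. f0 u * sin (2 * pi * u))" by (intro continuous_intros)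
  show ?thesis
    unfolding SI_eval[OF g(1) DERIV_cmult[OF g(2)], unfolded e, OF sin_antiderivative[OF _ d] c, simplified]
    by (simp add: power_divide algebra_simps diff_divide_distrib)
qed

text \<open>After integration over \<open>v\<close> the polynomial factor is \<open>u^3 (1 - u)^3 / 6\<close>, which is symmetric about
\<open>1 / 2\<close>, while the sine is antisymmetric.\<close>

lemma SI_sin_mono311: "SI (\<lambda>u v. sin (2 * pi * u) * mono3 3 1 1 u v) = 0"
proof -
  define f0 f1 f2 f3 f4 f5 f6 :: "real \<Rightarrow> real" where
    "f0 u = (u^3 - 3*u^4 + 3*u^5 - u^6) / 6" and "f1 u = (3*u^2 - 12*u^3 + 15*u^4 - 6*u^5) / 6"
    and "f2 u = (6*u - 36*u^2 + 60*u^3 - 30*u^4) / 6" and "f3 u = (6 - 72*u + 180*u^2 - 120*u^3) / 6"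
    and "f4 u = (- 72 + 360*u - 360*u^2) / 6" and "f5 u = (360 - 720*u) / 6" and "f6 u = - 120" for u
  note defs = f0_def[abs_def] f1_def[abs_def] f2_def[abs_def] f3_def[abs_def] f4_def[abs_def] f5_def[abs_def] f6_def[abs_def]
  have "SI (\<lambda>u v. sin (2 * pi * u) * mono3 3 1 1 u v) = - (f0 1 - f0 0) / (2 * pi) + (f2 1 - f2 0) / (2 * pi)^3
    - (f4 1 - f4 0) / (2 * pi)^5 + (f6 1 - f6 0) / (2 * pi)^7"
  proof (rule SI_sin_mult[OF cont2_sin_mono, where G="\<lambda>u v. u^3 * ((1 - u) * v^2 / 2 - v^3 / 3)"])
    show "((\<lambda>v. u^3 * ((1 - u) * v^2 / 2 - v^3 / 3)) has_real_derivative mono3 3 1 1 u v) (at v)" for u v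
      unfolding mono3_def by (auto intro!: derivative_eq_intros simp: field_simps power2_eq_square)
    show "f0 u = u^3 * ((1 - u) * (1 - u)^2 / 2 - (1 - u)^3 / 3) - u^3 * ((1 - u) * 0^2 / 2 - 0^3 / 3)" for u
      by (simp add: f0_def field_simps eval_nat_numeral)
  qed (unfold defs, auto intro!: derivative_eq_intros simp: field_simps)
  then show ?thesis by (simp add: f0_def f2_def f4_def f6_def)
qed

definition sine_moment :: real where "sine_moment = 1 / (2 * (2 * pi)^3) - 12 / (2 * pi)^5"

lemma SI_sin_mono131: "SI (\<lambda>u v. sin (2 * pi * u) * mono3 1 3 1 u v) = sine_moment"
proof -
  define f0 f1 f2 f3 f4 f5 f6 :: "real \<Rightarrow> real" where
    "f0 u = (u - 5*u^2 + 10*u^3 - 10*u^4 + 5*u^5 - u^6) / 20" and "f1 u = (1 - 10*u + 30*u^2 - 40*u^3 + 25*u^4 - 6*u^5) / 20"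
    and "f2 u = (- 10 + 60*u - 120*u^2 + 100*u^3 - 30*u^4) / 20" and "f3 u = (60 - 240*u + 300*u^2 - 120*u^3) / 20"
    and "f4 u = (- 240 + 600*u - 360*u^2) / 20" and "f5 u = (600 - 720*u) / 20" and "f6 u = - 36" for u
  note defs = f0_def[abs_def] f1_def[abs_def] f2_def[abs_def] f3_def[abs_def] f4_def[abs_def] f5_def[abs_def] f6_def[abs_def]
  have "SI (\<lambda>u v. sin (2 * pi * u) * mono3 1 3 1 u v) = - (f0 1 - f0 0) / (2 * pi) + (f2 1 - f2 0) / (2 * pi)^3
    - (f4 1 - f4 0) / (2 * pi)^5 + (f6 1 - f6 0) / (2 * pi)^7"
  proof (rule SI_sin_mult[OF cont2_sin_mono, where G="\<lambda>u v. u * ((1 - u) * v^4 / 4 - v^5 / 5)"])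
    show "((\<lambda>v. u * ((1 - u) * v^4 / 4 - v^5 / 5)) has_real_derivative mono3 1 3 1 u v) (at v)" for u v
      unfolding mono3_def by (auto intro!: derivative_eq_intros simp: field_simps eval_nat_numeral)
    show "f0 u = u * ((1 - u) * (1 - u)^4 / 4 - (1 - u)^5 / 5) - u * ((1 - u) * 0^4 / 4 - 0^5 / 5)" for u
      by (simp add: f0_def field_simps eval_nat_numeral)
  qed (unfold defs, auto intro!: derivative_eq_intros simp: field_simps)
  then show ?thesis by (simp add: f0_def f2_def f4_def f6_def sine_moment_def)
qed

lemma SI_sin_mono113: "SI (\<lambda>u v. sin (2 * pi * u) * mono3 1 1 3 u v) = sine_moment"
  using SI_flip[OF cont2_sin_mono, of 1 3 1] SI_sin_mono131
  by (simp add: mono3_def algebra_simps)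

section \<open>Trial functions in barycentric coordinates\<close>

text \<open>\<open>F1\<close>, \<open>F2\<close>, \<open>F3\<close> are the partial derivatives of \<open>F\<close> as a function of three independent variables. On the
plane where the variables add up to 1, only their differences have a meaning, and only these occur in
the energies below.\<close>

locale trial =
  fixes F F1 F2 F3 :: "real \<Rightarrow> real \<Rightarrow> real \<Rightarrow> real"
  assumes smooth_comp: "\<And>A B C :: real^2 \<Rightarrow> real. smooth A \<Longrightarrow> smooth B \<Longrightarrow> smooth C \<Longrightarrow> smooth (\<lambda>x. F (A x) (B x) (C x))"
    and deriv: "\<And>(A :: real^2 \<Rightarrow> real) B C A' B' C' x. (A has_derivative A') (at x) \<Longrightarrow> (B has_derivative B') (at x) \<Longrightarrow>
      (C has_derivative C') (at x) \<Longrightarrow>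
      ((\<lambda>x. F (A x) (B x) (C x)) has_derivative (\<lambda>h. F1 (A x) (B x) (C x) * A' h + F2 (A x) (B x) (C x) * B' h + F3 (A x) (B x) (C x) * C' h)) (at x)"
    and cont: "cont2 (\<lambda>u v. F1 u v (1 - u - v))" "cont2 (\<lambda>u v. F2 u v (1 - u - v))" "cont2 (\<lambda>u v. F3 u v (1 - u - v))"
    and zero: "\<And>a b c. a + b + c = 1 \<Longrightarrow> a = 0 \<or> b = 0 \<or> c = 0 \<Longrightarrow> F a b c = 0"
begin

abbreviation "energy1 \<equiv> SI (\<lambda>u v. (F1 u v (1 - u - v) - F2 u v (1 - u - v)) * (F1 u v (1 - u - v) - F3 u v (1 - u - v)))"
abbreviation "energy2 \<equiv> SI (\<lambda>u v. (F2 u v (1 - u - v) - F3 u v (1 - u - v)) * (F2 u v (1 - u - v) - F1 u v (1 - u - v)))"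
abbreviation "energy3 \<equiv> SI (\<lambda>u v. (F3 u v (1 - u - v) - F1 u v (1 - u - v)) * (F3 u v (1 - u - v) - F2 u v (1 - u - v)))"

text \<open>The gradients of the barycentric coordinates are the side vectors \<open>q - r\<close>, \<open>r - p\<close>, \<open>p - q\<close>, rotated by a
right angle and divided by the determinant. Since the side vectors add up to 0, the square of the norm of
their combination with coefficients \<open>F1\<close>, \<open>F2\<close>, \<open>F3\<close> depends on the differences of these and on the side
lengths only.\<close>

lemma eigenvalue_le:
  assumes D: "cross2 (p - r) (q - r) \<noteq> 0"
  shows "triangle_eigenvalue p q r * (cross2 (p - r) (q - r))^2 * SI (\<lambda>u v. (F u v (1 - u - v))^2)
    \<le> (norm (q - r))^2 * energy1 + (norm (r - p))^2 * energy2 + (norm (p - q))^2 * energy3"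
proof -
  define d where "d = cross2 (p - r) (q - r)"
  have d0: "d \<noteq> 0" using D by (simp add: d_def)
  define T where "T = interior (convex hull {p, q, r})"
  have T: "T = {x. bary p q r x > 0 \<and> bary q r p x > 0 \<and> bary r p q x > 0}"
    unfolding T_def by (rule interior_triangle[OF D])
  define P where "P e = vec2 (e$2) (- (e$1))" for e :: "real^2"
  have bary_eq: "bary p q r = (\<lambda>x. ((1/d) *\<^sub>R P (q - r)) \<bullet> x + (- (((1/d) *\<^sub>R P (q - r)) \<bullet> r)))"
    "bary q r p = (\<lambda>x. ((1/d) *\<^sub>R P (r - p)) \<bullet> x + (- (((1/d) *\<^sub>R P (r - p)) \<bullet> p)))"
    "bary r p q = (\<lambda>x. ((1/d) *\<^sub>R P (p - q)) \<bullet> x + (- (((1/d) *\<^sub>R P (p - q)) \<bullet> q)))"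
    unfolding fun_eq_iff bary_def cross2_cyclic unfolding d_def[symmetric] unfolding P_def perp_inner[symmetric]
    by (simp_all only: inner_diff_right inner_scaleR_left) (simp_all add: diff_divide_distrib d0)
  have sb: "smooth (bary p q r)" "smooth (bary q r p)" "smooth (bary r p q)"
    unfolding bary_eq by (intro smooth_add smooth_inner smooth_const)+
  have db: "(bary p q r has_derivative (\<lambda>h. ((1/d) *\<^sub>R P (q - r)) \<bullet> h)) (at x)"
    "(bary q r p has_derivative (\<lambda>h. ((1/d) *\<^sub>R P (r - p)) \<bullet> h)) (at x)"
    "(bary r p q has_derivative (\<lambda>h. ((1/d) *\<^sub>R P (p - q)) \<bullet> h)) (at x)" for x
    unfolding bary_eq by (auto intro!: derivative_eq_intros simp: d0)
  define f where "f x = F (bary p q r x) (bary q r p x) (bary r p q x)" for x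
  have f: "smooth f" unfolding f_def by (intro smooth_comp sb)
  define G1 G2 G3 where "G1 x = F1 (bary p q r x) (bary q r p x) (bary r p q x)"
    and "G2 x = F2 (bary p q r x) (bary q r p x) (bary r p q x)"
    and "G3 x = F3 (bary p q r x) (bary q r p x) (bary r p q x)" for x
  have grad: "gradient f x = (1/d) *\<^sub>R (G1 x *\<^sub>R P (q - r) + G2 x *\<^sub>R P (r - p) + G3 x *\<^sub>R P (p - q))" for x
  proof (rule gradient_eqI)
    show "(f has_derivative (\<lambda>h. ((1/d) *\<^sub>R (G1 x *\<^sub>R P (q - r) + G2 x *\<^sub>R P (r - p) + G3 x *\<^sub>R P (p - q))) \<bullet> h)) (at x)"
      using deriv[OF db] unfolding f_def G1_def G2_def G3_def
      by (simp add: inner_add_left inner_scaleR_left algebra_simps)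
  qed
  define Q where "Q x = (norm (q - r))^2 * ((G1 x - G2 x) * (G1 x - G3 x)) + (norm (r - p))^2 * ((G2 x - G3 x) * (G2 x - G1 x))
    + (norm (p - q))^2 * ((G3 x - G1 x) * (G3 x - G2 x))" for x
  have Q: "(norm (gradient f x))^2 = Q x / d^2" for x
  proof -
    have "(norm (G1 x *\<^sub>R P (q - r) + G2 x *\<^sub>R P (r - p) + G3 x *\<^sub>R P (p - q)))^2 = Q x"
      unfolding norm_real2 Q_def P_def
      by (simp add: power2_eq_square algebra_simps)
    then show ?thesis unfolding grad by (simp add: power_mult_distrib power_divide)
  qed
  interpret chart r "p - r" "q - r" d
    by unfold_locales (use d0 in \<open>auto simp: d_def cross2_def\<close>)
  have bc: "bary p q r (r + u *\<^sub>R (p - r) + v *\<^sub>R (q - r)) = u" "bary q r p (r + u *\<^sub>R (p - r) + v *\<^sub>R (q - r)) = v"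
    "bary r p q (r + u *\<^sub>R (p - r) + v *\<^sub>R (q - r)) = 1 - u - v" for u v
  proof -
    show 1: "bary p q r (r + u *\<^sub>R (p - r) + v *\<^sub>R (q - r)) = u"
      using d0 cross2_combination(1)[of u "p - r" v "q - r"] by (simp add: bary_def d_def[symmetric] add.assoc)
    have "cross2 (r + u *\<^sub>R (p - r) + v *\<^sub>R (q - r) - p) (r - p) = v * cross2 (q - p) (r - p)"
      by (simp add: cross2_def algebra_simps)
    then show 2: "bary q r p (r + u *\<^sub>R (p - r) + v *\<^sub>R (q - r)) = v"
      using d0 by (simp add: bary_def cross2_cyclic d_def)
    show "bary r p q (r + u *\<^sub>R (p - r) + v *\<^sub>R (q - r)) = 1 - u - v"
      using bary_sum[OF D, of "r + u *\<^sub>R (p - r) + v *\<^sub>R (q - r)"] 1 2 by simp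
  qed
  have openT: "open T" unfolding T_def by simp
  have bT: "bounded T" unfolding T_def
    by (intro bounded_interior bounded_convex_hull finite_imp_bounded) simp
  have inT: "indicator T (r + u *\<^sub>R (p - r) + v *\<^sub>R (q - r)) = (indicator simplex2 (u, v) :: real)" for u v
    by (auto simp: indicator_def T bc simplex2_def)
  have main: "triangle_eigenvalue p q r * (LINT x|lborel. indicator T x * (f x)^2) \<le>
    (LINT x|lborel. indicator T x * (norm (gradient f x))^2)"
    unfolding triangle_eigenvalue_def T_def[symmetric]
  proof (rule first_eigenvalue_le[OF f openT openT order_refl bT])
    fix x assume x: "x \<in> frontier T"
    have "closed {x. bary p q r x \<ge> 0 \<and> bary q r p x \<ge> 0 \<and> bary r p q x \<ge> 0}"
      by (intro closed_Collect_conj closed_Collect_le continuous_intros smooth_continuous sb)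
    then have "closure T \<subseteq> {x. bary p q r x \<ge> 0 \<and> bary q r p x \<ge> 0 \<and> bary r p q x \<ge> 0}"
      by (intro closure_minimal) (auto simp: T)
    then have "bary p q r x = 0 \<or> bary q r p x = 0 \<or> bary r p q x = 0"
      using x openT by (auto simp: frontier_def interior_open T)
    then show "f x = 0" unfolding f_def by (intro zero) (use bary_sum[OF D] in auto)
  qed
  have m1: "(\<lambda>x. indicator T x * (f x)^2) \<in> borel_measurable borel"
    and m2: "(\<lambda>x. indicator T x * (norm (gradient f x))^2) \<in> borel_measurable borel"
  proof -
    have [measurable]: "f \<in> borel_measurable borel" "gradient f \<in> borel_measurable borel" "T \<in> sets borel"
      using openT borel_measurable_continuous_onI[OF smooth_continuous[OF f]] borel_measurable_continuous_onI[OF continuous_gradient[OF f]] by auto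
    show "(\<lambda>x. indicator T x * (f x)^2) \<in> borel_measurable borel"
      "(\<lambda>x. indicator T x * (norm (gradient f x))^2) \<in> borel_measurable borel" by measurable
  qed
  have 1: "(LINT x|lborel. indicator T x * (f x)^2) = \<bar>d\<bar> * SI (\<lambda>u v. (F u v (1 - u - v))^2)"
    unfolding integral_chart[OF m1] SI_def by (simp add: inT f_def bc)
  have 2: "(LINT x|lborel. indicator T x * (norm (gradient f x))^2) =
    \<bar>d\<bar> * SI (\<lambda>u v. (1 / d^2) * ((norm (q - r))^2 * ((F1 u v (1 - u - v) - F2 u v (1 - u - v)) * (F1 u v (1 - u - v) - F3 u v (1 - u - v)))
      + (norm (r - p))^2 * ((F2 u v (1 - u - v) - F3 u v (1 - u - v)) * (F2 u v (1 - u - v) - F1 u v (1 - u - v)))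
      + (norm (p - q))^2 * ((F3 u v (1 - u - v) - F1 u v (1 - u - v)) * (F3 u v (1 - u - v) - F2 u v (1 - u - v)))))"
    unfolding integral_chart[OF m2] SI_def by (simp add: inT Q Q_def G1_def G2_def G3_def bc)
  have jd: "cont2 (\<lambda>u v. (F1 u v (1 - u - v) - F2 u v (1 - u - v)) * (F1 u v (1 - u - v) - F3 u v (1 - u - v)))"
    "cont2 (\<lambda>u v. (F2 u v (1 - u - v) - F3 u v (1 - u - v)) * (F2 u v (1 - u - v) - F1 u v (1 - u - v)))"
    "cont2 (\<lambda>u v. (F3 u v (1 - u - v) - F1 u v (1 - u - v)) * (F3 u v (1 - u - v) - F2 u v (1 - u - v)))"
    using cont unfolding cont2_def by (auto intro!: continuous_intros)
  have "triangle_eigenvalue p q r * (\<bar>d\<bar> * SI (\<lambda>u v. (F u v (1 - u - v))^2)) \<le>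
    \<bar>d\<bar> * ((1 / d^2) * ((norm (q - r))^2 * energy1 + (norm (r - p))^2 * energy2 + (norm (p - q))^2 * energy3))"
    using main unfolding 1 2 SI_cmult
    by (simp only: SI_add[OF cont2_add[OF cont2_cmult[OF jd(1)] cont2_cmult[OF jd(2)]] cont2_cmult[OF jd(3)]] SI_add[OF cont2_cmult[OF jd(1)] cont2_cmult[OF jd(2)]] SI_cmult)
  then have "\<bar>d\<bar> * (triangle_eigenvalue p q r * SI (\<lambda>u v. (F u v (1 - u - v))^2)) \<le>
    \<bar>d\<bar> * (((norm (q - r))^2 * energy1 + (norm (r - p))^2 * energy2 + (norm (p - q))^2 * energy3) / d^2)"
    by (simp add: mult.left_commute[of "triangle_eigenvalue p q r"])
  then have "triangle_eigenvalue p q r * SI (\<lambda>u v. (F u v (1 - u - v))^2) \<le>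
    ((norm (q - r))^2 * energy1 + (norm (r - p))^2 * energy2 + (norm (p - q))^2 * energy3) / d^2"
    by (rule mult_left_le_imp_le) (use d0 in simp)
  then show ?thesis unfolding d_def[symmetric] using d0 by (simp add: pos_le_divide_eq mult.commute mult.left_commute)
qed

end

text \<open>The factor \<open>(a + b)^3\<close> moves the mass away from the third vertex, towards the side on which \<open>c = 0\<close>.\<close>

definition side_trial where "side_trial a b c = a * b * c * (a + b) ^ 3" for a b c :: real

lemma trial_side: "trial side_trial (\<lambda>a b c. b * c * (a + b) ^ 3 + 3 * a * b * c * (a + b)^2)
  (\<lambda>a b c. a * c * (a + b) ^ 3 + 3 * a * b * c * (a + b)^2) (\<lambda>a b c. a * b * (a + b) ^ 3)"
proof
  show "smooth (\<lambda>x. side_trial (A x) (B x) (C x))" if "smooth A" "smooth B" "smooth C" for A B C :: "real^2 \<Rightarrow> real"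
    unfolding side_trial_def by (intro smooth_mult smooth_power smooth_add that)
qed (auto simp: side_trial_def cont2_def algebra_simps intro!: derivative_eq_intros continuous_intros)

lemma thin_triangle_bound:
  assumes D: "cross2 (p - r) (q - r) \<noteq> 0"
  shows "triangle_eigenvalue p q r * (cross2 (p - r) (q - r))^2 \<le>
    91 / 11 * ((norm (q - r))^2 + (norm (r - p))^2) + 2639 / 55 * (norm (p - q))^2"
proof -
  interpret trial side_trial "\<lambda>a b c. b * c * (a + b) ^ 3 + 3 * a * b * c * (a + b)^2"
    "\<lambda>a b c. a * c * (a + b) ^ 3 + 3 * a * b * c * (a + b)^2" "\<lambda>a b c. a * b * (a + b) ^ 3"
    by (rule trial_side)
  have e: "(side_trial a b c)^2 = trivariate [(1, 8, 2, 2), (6, 7, 3, 2), (15, 6, 4, 2), (20, 5, 5, 2), (15, 4, 6, 2), (6, 3, 7, 2), (1, 2, 8, 2)] a b c"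
    "(b * c * (a + b) ^ 3 + 3 * a * b * c * (a + b)^2 - (a * c * (a + b) ^ 3 + 3 * a * b * c * (a + b)^2)) *
      (b * c * (a + b) ^ 3 + 3 * a * b * c * (a + b)^2 - a * b * (a + b) ^ 3) = trivariate [(1, 8, 1, 1), (5, 7, 2, 1), ((-4), 7, 1, 2), (9, 6, 3, 1), ((-17), 6, 2, 2), (5, 5, 4, 1), ((-24), 5, 3, 2), ((-5), 4, 5, 1), ((-5), 4, 4, 2), ((-9), 3, 6, 1), (20, 3, 5, 2), ((-5), 2, 7, 1), (21, 2, 6, 2), ((-1), 1, 8, 1), (8, 1, 7, 2), (1, 0, 8, 2)] a b c"
    "(a * c * (a + b) ^ 3 + 3 * a * b * c * (a + b)^2 - a * b * (a + b) ^ 3) *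
      (a * c * (a + b) ^ 3 + 3 * a * b * c * (a + b)^2 - (b * c * (a + b) ^ 3 + 3 * a * b * c * (a + b)^2)) = trivariate [((-1), 8, 1, 1), (1, 8, 0, 2), ((-5), 7, 2, 1), (8, 7, 1, 2), ((-9), 6, 3, 1), (21, 6, 2, 2), ((-5), 5, 4, 1), (20, 5, 3, 2), (5, 4, 5, 1), ((-5), 4, 4, 2), (9, 3, 6, 1), ((-24), 3, 5, 2), (5, 2, 7, 1), ((-17), 2, 6, 2), (1, 1, 8, 1), ((-4), 1, 7, 2)] a b c"
    "(a * b * (a + b) ^ 3 - (b * c * (a + b) ^ 3 + 3 * a * b * c * (a + b)^2)) *
      (a * b * (a + b) ^ 3 - (a * c * (a + b) ^ 3 + 3 * a * b * c * (a + b)^2)) = trivariate [(1, 8, 2, 0), ((-1), 8, 1, 1), (6, 7, 3, 0), ((-13), 7, 2, 1), (4, 7, 1, 2), (15, 6, 4, 0), ((-51), 6, 3, 1), (33, 6, 2, 2), (20, 5, 5, 0), ((-95), 5, 4, 1), (96, 5, 3, 2), (15, 4, 6, 0), ((-95), 4, 5, 1), (134, 4, 4, 2), (6, 3, 7, 0), ((-51), 3, 6, 1), (96, 3, 5, 2), (1, 2, 8, 0), ((-13), 2, 7, 1), (33, 2, 6, 2), ((-1), 1, 8, 1), (4, 1, 7, 2)] a b c"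
    for a b c unfolding trivariate_def side_trial_def by (simp_all, algebra+)
  have "triangle_eigenvalue p q r * (cross2 (p - r) (q - r))^2 * (1 / 32760) \<le>
    (norm (q - r))^2 * (1 / 3960) + (norm (r - p))^2 * (1 / 3960) + (norm (p - q))^2 * (29 / 19800)"
    using eigenvalue_le[OF D] unfolding e SI_trivariate[THEN conjunct2] by (simp add: fact_numeral)
  moreover have "x * (1 / 32760) \<le> a * (1 / 3960) + b * (1 / 3960) + c * (29 / 19800) \<Longrightarrow> x \<le> 91 / 11 * (a + b) + 2639 / 55 * c"
    for x a b c :: real by (simp add: distrib_left)
  ultimately show ?thesis by blast
qed

lemma SI_parts_u:
  assumes "cont2 n" "cont2 nu" "cont2 c" "cont2 cu"
    and "\<And>u v. ((\<lambda>u. n u v) has_real_derivative nu u v) (at u)" "\<And>u v. ((\<lambda>u. c u v) has_real_derivative cu u v) (at u)"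
    and "\<And>v. n 0 v = 0" "\<And>v. n (1 - v) v = 0"
  shows "SI (\<lambda>u v. c u v * nu u v) = - SI (\<lambda>u v. cu u v * n u v)"
proof -
  have "SI (\<lambda>u v. c u v * nu u v + cu u v * n u v) = 0"
    by (rule SI_partial_u[where H="\<lambda>u v. c u v * n u v"])
      (use assms in \<open>auto intro!: cont2_add cont2_mult derivative_eq_intros\<close>)
  then show ?thesis using assms by (simp add: SI_add cont2_mult)
qed

lemma SI_parts_v:
  assumes "cont2 n" "cont2 nv" "cont2 c" "cont2 cv"
    and "\<And>u v. ((\<lambda>v. n u v) has_real_derivative nv u v) (at v)" "\<And>u v. ((\<lambda>v. c u v) has_real_derivative cv u v) (at v)"
    and "\<And>u. n u 0 = 0" "\<And>u. n u (1 - u) = 0"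
  shows "SI (\<lambda>u v. c u v * nv u v) = - SI (\<lambda>u v. cv u v * n u v)"
proof -
  have "SI (\<lambda>u v. c u v * nv u v + cv u v * n u v) = 0"
    by (rule SI_partial_v[where H="\<lambda>u v. c u v * n u v"])
      (use assms in \<open>auto intro!: cont2_add cont2_mult derivative_eq_intros\<close>)
  then show ?thesis using assms by (simp add: SI_add cont2_mult)
qed

text \<open>The sines that make up the first eigenfunction of the equilateral triangle, and their derivatives with
respect to the barycentric coordinate on which they depend.\<close>

definition sn1 :: "real \<Rightarrow> real \<Rightarrow> real" where "sn1 u v = sin (2 * pi * u)"
definition sn2 :: "real \<Rightarrow> real \<Rightarrow> real" where "sn2 u v = sin (2 * pi * v)"
definition sn3 :: "real \<Rightarrow> real \<Rightarrow> real" where "sn3 u v = sin (2 * pi * (1 - u - v))"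
definition cs1 :: "real \<Rightarrow> real \<Rightarrow> real" where "cs1 u v = 2 * pi * cos (2 * pi * u)"
definition cs2 :: "real \<Rightarrow> real \<Rightarrow> real" where "cs2 u v = 2 * pi * cos (2 * pi * v)"
definition cs3 :: "real \<Rightarrow> real \<Rightarrow> real" where "cs3 u v = 2 * pi * cos (2 * pi * (1 - u - v))"

lemma cont2_sn: "cont2 sn1" "cont2 sn2" "cont2 sn3" "cont2 cs1" "cont2 cs2" "cont2 cs3"
  unfolding cont2_def sn1_def sn2_def sn3_def cs1_def cs2_def cs3_def by (intro continuous_intros)+

lemma SI_sn11: "SI (\<lambda>u v. sn1 u v * sn1 u v) = 1 / 4"
proof -
  define K where "K u = (u - u^2/2)/2 - (1 - u) * sin (4 * pi * u) / (8 * pi) + cos (4 * pi * u) / (32 * pi^2)" for u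
  have "SI (\<lambda>u v. sn1 u v * sn1 u v) = K 1 - K 0"
  proof (rule SI_eval[OF cont2_mult[OF cont2_sn(1) cont2_sn(1)], where H="\<lambda>u v. (sin (2 * pi * u))^2 * v"])
    fix u
    have d: "(K has_real_derivative (1 - u) / 2 - (1 - u) * cos (4 * pi * u) / 2) (at u)"
      unfolding K_def[abs_def]
      by (auto intro!: derivative_eq_intros simp: field_simps power2_eq_square)
    have c: "cos (4 * pi * u) = 1 - 2 * (sin (2 * pi * u))^2"
      using cos_double_sin[of "2 * pi * u"] by (simp add: mult.assoc)
    have e: "(1 - u) / 2 - (1 - u) * cos (4 * pi * u) / 2 = (sin (2 * pi * u))^2 * (1 - u) - (sin (2 * pi * u))^2 * 0"
      unfolding c by (simp add: field_simps)
    show "(K has_real_derivative (sin (2 * pi * u))^2 * (1 - u) - (sin (2 * pi * u))^2 * 0) (at u)"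
      using d unfolding e .
  qed (auto simp: sn1_def power2_eq_square intro!: derivative_eq_intros continuous_intros)
  also have "K 1 - K 0 = 1 / 4"
    using sin_npi[of 4] cos_npi[of 4] by (simp add: K_def)
  finally show ?thesis .
qed

lemma SI_sn12: "SI (\<lambda>u v. sn1 u v * sn2 u v) = 0"
proof -
  define K where "K u = - cos (2 * pi * u) / (4 * pi^2) - (sin (2 * pi * u))^2 / (8 * pi^2)" for u
  have "SI (\<lambda>u v. sn1 u v * sn2 u v) = K 1 - K 0"
  proof (rule SI_eval[OF cont2_mult[OF cont2_sn(1) cont2_sn(2)], where H="\<lambda>u v. - sin (2 * pi * u) * cos (2 * pi * v) / (2 * pi)"])
    fix u
    have e: "cos (2 * pi * (1 - u)) = cos (2 * pi * u)"
      using cos_periodic[of "- 2 * pi * u"] by (simp add: algebra_simps)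
    show "(K has_real_derivative - sin (2 * pi * u) * cos (2 * pi * (1 - u)) / (2 * pi) - - sin (2 * pi * u) * cos (2 * pi * 0) / (2 * pi)) (at u)"
      unfolding e K_def[abs_def]
      by (auto intro!: derivative_eq_intros simp: field_simps power2_eq_square)
  qed (auto simp: sn1_def sn2_def intro!: derivative_eq_intros continuous_intros)
  also have "K 1 - K 0 = 0" by (simp add: K_def)
  finally show ?thesis .
qed

lemma SI_sn_rest: "SI (\<lambda>u v. sn2 u v * sn2 u v) = 1 / 4" "SI (\<lambda>u v. sn3 u v * sn3 u v) = 1 / 4"
  "SI (\<lambda>u v. sn1 u v * sn3 u v) = 0" "SI (\<lambda>u v. sn2 u v * sn3 u v) = 0"
  "SI (\<lambda>u v. sn2 u v * sn1 u v) = 0" "SI (\<lambda>u v. sn3 u v * sn1 u v) = 0" "SI (\<lambda>u v. sn3 u v * sn2 u v) = 0"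
proof -
  show 22: "SI (\<lambda>u v. sn2 u v * sn2 u v) = 1 / 4"
    using SI_swap[OF cont2_mult[OF cont2_sn(1) cont2_sn(1)]] SI_sn11 by (simp add: sn1_def sn2_def)
  show "SI (\<lambda>u v. sn3 u v * sn3 u v) = 1 / 4"
    using SI_flip[OF cont2_mult[OF cont2_sn(2) cont2_sn(2)]] 22 by (simp add: sn2_def sn3_def)
  show 13: "SI (\<lambda>u v. sn1 u v * sn3 u v) = 0"
    using SI_flip[OF cont2_mult[OF cont2_sn(1) cont2_sn(2)]] SI_sn12 by (simp add: sn1_def sn2_def sn3_def)
  show 23: "SI (\<lambda>u v. sn2 u v * sn3 u v) = 0"
    using SI_swap[OF cont2_mult[OF cont2_sn(1) cont2_sn(3)]] 13 by (simp add: sn1_def sn2_def sn3_def algebra_simps)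
  show "SI (\<lambda>u v. sn2 u v * sn1 u v) = 0" "SI (\<lambda>u v. sn3 u v * sn1 u v) = 0" "SI (\<lambda>u v. sn3 u v * sn2 u v) = 0"
    using SI_sn12 13 23 by (simp_all add: mult.commute)
qed

lemma SI_sn1_mono: "SI (\<lambda>u v. sn1 u v * mono3 3 1 1 u v) = 0" "SI (\<lambda>u v. sn1 u v * mono3 1 3 1 u v) = sine_moment" "SI (\<lambda>u v. sn1 u v * mono3 1 1 3 u v) = sine_moment"
  using SI_sin_mono311 SI_sin_mono131 SI_sin_mono113 by (simp_all add: sn1_def)

lemma SI_sn2_mono: "SI (\<lambda>u v. sn2 u v * mono3 a b c u v) = SI (\<lambda>u v. sn1 u v * mono3 b a c u v)"
  using SI_swap[OF cont2_mult[OF cont2_sn(1) cont2_mono3[of b a c]]]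
  by (simp add: sn1_def sn2_def mono3_def algebra_simps)

lemma SI_sn3_mono: "SI (\<lambda>u v. sn3 u v * mono3 a b c u v) = SI (\<lambda>u v. sn1 u v * mono3 c a b u v)"
  using SI_flip[OF cont2_mult[OF cont2_sn(2) cont2_mono3[of a c b]]] SI_sn2_mono[of a c b]
  by (simp add: sn2_def sn3_def mono3_def algebra_simps)

text \<open>For \<open>a + b + c = 1\<close> the sum of the three sines is \<open>4 sin (\<pi> a) sin (\<pi> b) sin (\<pi> c)\<close>, the first
eigenfunction of the equilateral triangle. The polynomial shifts mass towards one vertex or another,
according to its coefficients.\<close>

definition sine_trial :: "real \<Rightarrow> real \<Rightarrow> real \<Rightarrow> real \<Rightarrow> real \<Rightarrow> real \<Rightarrow> real" where
  "sine_trial s1 s2 s3 a b c = sin (2 * pi * a) + sin (2 * pi * b) + sin (2 * pi * c) + a * b * c * (s1 * a^2 + s2 * b^2 + s3 * c^2)"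
definition sine_trial1 :: "real \<Rightarrow> real \<Rightarrow> real \<Rightarrow> real \<Rightarrow> real \<Rightarrow> real \<Rightarrow> real" where
  "sine_trial1 s1 s2 s3 a b c = 2 * pi * cos (2 * pi * a) + b * c * (3 * s1 * a^2 + s2 * b^2 + s3 * c^2)"
definition sine_trial2 :: "real \<Rightarrow> real \<Rightarrow> real \<Rightarrow> real \<Rightarrow> real \<Rightarrow> real \<Rightarrow> real" where
  "sine_trial2 s1 s2 s3 a b c = 2 * pi * cos (2 * pi * b) + a * c * (s1 * a^2 + 3 * s2 * b^2 + s3 * c^2)"
definition sine_trial3 :: "real \<Rightarrow> real \<Rightarrow> real \<Rightarrow> real \<Rightarrow> real \<Rightarrow> real \<Rightarrow> real" where
  "sine_trial3 s1 s2 s3 a b c = 2 * pi * cos (2 * pi * c) + a * b * (s1 * a^2 + s2 * b^2 + 3 * s3 * c^2)"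

lemma sin_2pi_compl: "sin (2 * pi * (1 - a)) = - sin (2 * pi * a)"
  using sin_periodic[of "- 2 * pi * a"] by (simp add: algebra_simps)

lemma sine_trial_zero:
  assumes "a + b + c = 1" "a = 0 \<or> b = 0 \<or> c = 0"
  shows "sine_trial s1 s2 s3 a b c = 0"
proof -
  have "b = 1 - c" if "a = 0" using assms(1) that by simp
  moreover have "a = 1 - c" if "b = 0" using assms(1) that by simp
  moreover have "a = 1 - b" if "c = 0" using assms(1) that by simp
  ultimately show ?thesis using assms(2) by (auto simp: sine_trial_def sin_2pi_compl)
qed

lemma trial_sine: "trial (sine_trial s1 s2 s3) (sine_trial1 s1 s2 s3) (sine_trial2 s1 s2 s3) (sine_trial3 s1 s2 s3)"
proof
  show "smooth (\<lambda>x. sine_trial s1 s2 s3 (A x) (B x) (C x))" if "smooth A" "smooth B" "smooth C" for A B C :: "real^2 \<Rightarrow> real"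
    unfolding sine_trial_def by (intro smooth_mult smooth_power smooth_add smooth_sin smooth_const that)
  show "((\<lambda>x. sine_trial s1 s2 s3 (A x) (B x) (C x)) has_derivative (\<lambda>h. sine_trial1 s1 s2 s3 (A x) (B x) (C x) * A' h + sine_trial2 s1 s2 s3 (A x) (B x) (C x) * B' h + sine_trial3 s1 s2 s3 (A x) (B x) (C x) * C' h)) (at x)"
    if "(A has_derivative A') (at x)" "(B has_derivative B') (at x)" "(C has_derivative C') (at x)" for A B C :: "real^2 \<Rightarrow> real" and A' B' C' x
    unfolding sine_trial_def sine_trial1_def sine_trial2_def sine_trial3_def
    by (rule derivative_eq_intros that refl)+ (simp add: fun_eq_iff algebra_simps power2_eq_square)
qed (auto simp: sine_trial_zero sine_trial1_def sine_trial2_def sine_trial3_def cont2_def intro!: continuous_intros)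

text \<open>Let \<open>\<phi>\<close> be the sum of the sines, \<open>m\<close> the polynomial and \<open>B\<close> the bilinear form of the energy. Then
\<open>B (\<phi> + m, \<phi> + m) = B (\<phi>, \<phi> + 2 m) + B (m, m)\<close>. Integration by parts turns the first term into integrals
of \<open>\<phi> + 2 m\<close> against the three sines, because for this form the sine of the \<open>i\<close>-th coordinate
is an eigenfunction with eigenvalue \<open>4 \<pi>^2 Xi\<close>. The second term is the integral of a polynomial.\<close>

lemma near_equilateral_bound:
  assumes D: "cross2 (p - r) (q - r) \<noteq> 0" and sum: "s1 + s2 + s3 = 0"
  defines "X1 \<equiv> (norm (q - r))^2" and "X2 \<equiv> (norm (r - p))^2" and "X3 \<equiv> (norm (p - q))^2"
  shows "triangle_eigenvalue p q r * (cross2 (p - r) (q - r))^2 * (3 / 4 + (s1^2 + s2^2 + s3^2) / 277200) \<le>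
    pi^2 * (X1 + X2 + X3) - 8 * pi^2 * sine_moment * (X1 * s1 + X2 * s2 + X3 * s3)
    + X1 * ((s1^2 - s1 * s2 - s1 * s3) / 25200 + (s2^2 + s2 * s3 + s3^2) / 5040)
    + X2 * ((s2^2 - s2 * s1 - s2 * s3) / 25200 + (s1^2 + s1 * s3 + s3^2) / 5040)
    + X3 * ((s3^2 - s3 * s1 - s3 * s2) / 25200 + (s1^2 + s1 * s2 + s2^2) / 5040)"
proof -
  interpret trial "sine_trial s1 s2 s3" "sine_trial1 s1 s2 s3" "sine_trial2 s1 s2 s3" "sine_trial3 s1 s2 s3"
    by (rule trial_sine)
  define m where "m a b c = a * b * c * (s1 * a^2 + s2 * b^2 + s3 * c^2)" for a b c
  define m1 where "m1 a b c = b * c * (3 * s1 * a^2 + s2 * b^2 + s3 * c^2)" for a b c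
  define m2 where "m2 a b c = a * c * (s1 * a^2 + 3 * s2 * b^2 + s3 * c^2)" for a b c
  define m3 where "m3 a b c = a * b * (s1 * a^2 + s2 * b^2 + 3 * s3 * c^2)" for a b c
  have e: "(m a b c)^2 = trivariate [(1 * s1^2, 6, 2, 2), (2 * s1 * s2, 4, 4, 2), (2 * s1 * s3, 4, 2, 4), (1 * s2^2, 2, 6, 2), (2 * s2 * s3, 2, 4, 4), (1 * s3^2, 2, 2, 6)] a b c"
    "(m1 a b c - m2 a b c) * (m1 a b c - m3 a b c) = trivariate [(1 * s1^2, 6, 1, 1), ((-3) * s1^2, 5, 2, 1), ((-3) * s1^2, 5, 1, 2), (4 * s1 * s2, 4, 3, 1), (9 * s1^2, 4, 2, 2), (4 * s1 * s3, 4, 1, 3), ((-4) * s1 * s2, 3, 4, 1), ((-10) * s1 * s2, 3, 3, 2), ((-10) * s1 * s3, 3, 2, 3), ((-4) * s1 * s3, 3, 1, 4), (3 * s2^2, 2, 5, 1), (6 * s1 * s2, 2, 4, 2), (10 * s2 * s3, 2, 3, 3), (6 * s1 * s3, 2, 2, 4), (3 * s3^2, 2, 1, 5), ((-1) * s2^2, 1, 6, 1), ((-3) * s2^2, 1, 5, 2), ((-4) * s2 * s3, 1, 4, 3), ((-4) * s2 * s3, 1, 3, 4), ((-3) * s3^2, 1, 2, 5), ((-1) * s3^2, 1, 1, 6), (1 * s2^2, 0, 6, 2), (2 * s2 * s3, 0, 4, 4), (1 * s3^2, 0, 2, 6)] a b c"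
    "(m2 a b c - m3 a b c) * (m2 a b c - m1 a b c) = trivariate [((-1) * s1^2, 6, 1, 1), (1 * s1^2, 6, 0, 2), (3 * s1^2, 5, 2, 1), ((-3) * s1^2, 5, 1, 2), ((-4) * s1 * s2, 4, 3, 1), (6 * s1 * s2, 4, 2, 2), ((-4) * s1 * s3, 4, 1, 3), (2 * s1 * s3, 4, 0, 4), (4 * s1 * s2, 3, 4, 1), ((-10) * s1 * s2, 3, 3, 2), (10 * s1 * s3, 3, 2, 3), ((-4) * s1 * s3, 3, 1, 4), ((-3) * s2^2, 2, 5, 1), (9 * s2^2, 2, 4, 2), ((-10) * s2 * s3, 2, 3, 3), (6 * s2 * s3, 2, 2, 4), ((-3) * s3^2, 2, 1, 5), (1 * s3^2, 2, 0, 6), (1 * s2^2, 1, 6, 1), ((-3) * s2^2, 1, 5, 2), (4 * s2 * s3, 1, 4, 3), ((-4) * s2 * s3, 1, 3, 4), (3 * s3^2, 1, 2, 5), ((-1) * s3^2, 1, 1, 6)] a b c"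
    "(m3 a b c - m1 a b c) * (m3 a b c - m2 a b c) = trivariate [(1 * s1^2, 6, 2, 0), ((-1) * s1^2, 6, 1, 1), ((-3) * s1^2, 5, 2, 1), (3 * s1^2, 5, 1, 2), (2 * s1 * s2, 4, 4, 0), ((-4) * s1 * s2, 4, 3, 1), (6 * s1 * s3, 4, 2, 2), ((-4) * s1 * s3, 4, 1, 3), ((-4) * s1 * s2, 3, 4, 1), (10 * s1 * s2, 3, 3, 2), ((-10) * s1 * s3, 3, 2, 3), (4 * s1 * s3, 3, 1, 4), (1 * s2^2, 2, 6, 0), ((-3) * s2^2, 2, 5, 1), (6 * s2 * s3, 2, 4, 2), ((-10) * s2 * s3, 2, 3, 3), (9 * s3^2, 2, 2, 4), ((-3) * s3^2, 2, 1, 5), ((-1) * s2^2, 1, 6, 1), (3 * s2^2, 1, 5, 2), ((-4) * s2 * s3, 1, 4, 3), (4 * s2 * s3, 1, 3, 4), ((-3) * s3^2, 1, 2, 5), (1 * s3^2, 1, 1, 6)] a b c"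
    for a b c unfolding trivariate_def m_def m1_def m2_def m3_def by (simp_all, algebra+)
  define q0 q1 q2 q3 where "q0 u v = (m u v (1 - u - v))^2"
    and "q1 u v = (m1 u v (1 - u - v) - m2 u v (1 - u - v)) * (m1 u v (1 - u - v) - m3 u v (1 - u - v))"
    and "q2 u v = (m2 u v (1 - u - v) - m3 u v (1 - u - v)) * (m2 u v (1 - u - v) - m1 u v (1 - u - v))"
    and "q3 u v = (m3 u v (1 - u - v) - m1 u v (1 - u - v)) * (m3 u v (1 - u - v) - m2 u v (1 - u - v))" for u v
  have jq: "cont2 q0" "cont2 q1" "cont2 q2" "cont2 q3"
    unfolding q0_def[abs_def] q1_def[abs_def] q2_def[abs_def] q3_def[abs_def] e using SI_trivariate by blast+
  have s12: "s3 = - s1 - s2" using sum by simp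
  have Jq0: "SI q0 = (s1^2 + s2^2 + s3^2) / 277200"
    unfolding q0_def[abs_def] e SI_trivariate[THEN conjunct2] s12 by (simp add: fact_numeral power2_eq_square field_simps)
  have Jq1: "SI q1 = (s1^2 - s1 * s2 - s1 * s3) / 25200 + (s2^2 + s2 * s3 + s3^2) / 5040"
    unfolding q1_def[abs_def] e SI_trivariate[THEN conjunct2] by (simp add: fact_numeral power2_eq_square field_simps)
  have Jq2: "SI q2 = (s2^2 - s2 * s1 - s2 * s3) / 25200 + (s1^2 + s1 * s3 + s3^2) / 5040"
    unfolding q2_def[abs_def] e SI_trivariate[THEN conjunct2] by (simp add: fact_numeral power2_eq_square field_simps)
  have Jq3: "SI q3 = (s3^2 - s3 * s1 - s3 * s2) / 25200 + (s1^2 + s1 * s2 + s2^2) / 5040"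
    unfolding q3_def[abs_def] e SI_trivariate[THEN conjunct2] by (simp add: fact_numeral power2_eq_square field_simps)
  \<comment> \<open>This is \<open>\<phi> + 2 m\<close>, with derivatives \<open>nu\<close> and \<open>nv\<close> along \<open>u\<close> and \<open>v\<close>.\<close>
  define n where "n u v = sn1 u v + sn2 u v + sn3 u v + 2 * m u v (1 - u - v)" for u v
  define nu where "nu u v = cs1 u v - cs3 u v + 2 * (m1 u v (1 - u - v) - m3 u v (1 - u - v))" for u v
  define nv where "nv u v = cs2 u v - cs3 u v + 2 * (m2 u v (1 - u - v) - m3 u v (1 - u - v))" for u v
  have jn: "cont2 n" "cont2 nu" "cont2 nv"
    unfolding cont2_def n_def nu_def nv_def sn1_def sn2_def sn3_def cs1_def cs2_def cs3_def m_def m1_def m2_def m3_def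
    by (intro continuous_intros)+
  have n_eq: "n u v = sine_trial (2 * s1) (2 * s2) (2 * s3) u v (1 - u - v)" for u v
    by (simp add: n_def sn1_def sn2_def sn3_def m_def sine_trial_def algebra_simps)
  have n0: "n 0 v = 0" "n (1 - v) v = 0" "n u 0 = 0" "n u (1 - u) = 0" for u v
    unfolding n_eq by (rule sine_trial_zero; simp)+
  have du: "((\<lambda>u. n u v) has_real_derivative nu u v) (at u)" for u v
    unfolding n_def nu_def sn1_def sn2_def sn3_def cs1_def cs2_def cs3_def m_def m1_def m2_def m3_def
    by (auto intro!: derivative_eq_intros simp: algebra_simps power2_eq_square)
  have dv: "((\<lambda>v. n u v) has_real_derivative nv u v) (at v)" for u v
    unfolding n_def nv_def sn1_def sn2_def sn3_def cs1_def cs2_def cs3_def m_def m1_def m2_def m3_def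
    by (auto intro!: derivative_eq_intros simp: algebra_simps power2_eq_square)
  have jk: "cont2 (\<lambda>u v. k * sn1 u v)" "cont2 (\<lambda>u v. k * sn2 u v)" "cont2 (\<lambda>u v. k * sn3 u v)" for k
    by (intro cont2_cmult cont2_sn)+
  define I1 I2 I3 where "I1 = SI (\<lambda>u v. sn1 u v * n u v)" and "I2 = SI (\<lambda>u v. sn2 u v * n u v)" and "I3 = SI (\<lambda>u v. sn3 u v * n u v)"
  have parts: "SI (\<lambda>u v. cs1 u v * nu u v) = 4 * pi^2 * I1" "SI (\<lambda>u v. cs2 u v * nu u v) = 0" "SI (\<lambda>u v. cs3 u v * nu u v) = - 4 * pi^2 * I3"
    "SI (\<lambda>u v. cs1 u v * nv u v) = 0" "SI (\<lambda>u v. cs2 u v * nv u v) = 4 * pi^2 * I2" "SI (\<lambda>u v. cs3 u v * nv u v) = - 4 * pi^2 * I3"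
  proof -
    have 1: "SI (\<lambda>u v. cs1 u v * nu u v) = - SI (\<lambda>u v. - (4 * pi^2) * sn1 u v * n u v)"
      by (rule SI_parts_u[OF jn(1,2) cont2_sn(4) jk(1) du _ n0(1,2)])
        (auto simp: cs1_def sn1_def power2_eq_square intro!: derivative_eq_intros)
    have 2: "SI (\<lambda>u v. cs2 u v * nu u v) = - SI (\<lambda>u v. 0 * n u v)"
      by (rule SI_parts_u[OF jn(1,2) cont2_sn(5) cont2_const du _ n0(1,2)])
        (auto simp: cs2_def intro!: derivative_eq_intros)
    have 3: "SI (\<lambda>u v. cs3 u v * nu u v) = - SI (\<lambda>u v. (4 * pi^2) * sn3 u v * n u v)"
      by (rule SI_parts_u[OF jn(1,2) cont2_sn(6) jk(3) du _ n0(1,2)])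
        (auto simp: cs3_def sn3_def power2_eq_square intro!: derivative_eq_intros)
    have 4: "SI (\<lambda>u v. cs1 u v * nv u v) = - SI (\<lambda>u v. 0 * n u v)"
      by (rule SI_parts_v[OF jn(1,3) cont2_sn(4) cont2_const dv _ n0(3,4)])
        (auto simp: cs1_def intro!: derivative_eq_intros)
    have 5: "SI (\<lambda>u v. cs2 u v * nv u v) = - SI (\<lambda>u v. - (4 * pi^2) * sn2 u v * n u v)"
      by (rule SI_parts_v[OF jn(1,3) cont2_sn(5) jk(2) dv _ n0(3,4)])
        (auto simp: cs2_def sn2_def power2_eq_square intro!: derivative_eq_intros)
    have 6: "SI (\<lambda>u v. cs3 u v * nv u v) = - SI (\<lambda>u v. (4 * pi^2) * sn3 u v * n u v)"
      by (rule SI_parts_v[OF jn(1,3) cont2_sn(6) jk(3) dv _ n0(3,4)])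
        (auto simp: cs3_def sn3_def power2_eq_square intro!: derivative_eq_intros)
    show "SI (\<lambda>u v. cs1 u v * nu u v) = 4 * pi^2 * I1" "SI (\<lambda>u v. cs2 u v * nu u v) = 0" "SI (\<lambda>u v. cs3 u v * nu u v) = - 4 * pi^2 * I3"
      "SI (\<lambda>u v. cs1 u v * nv u v) = 0" "SI (\<lambda>u v. cs2 u v * nv u v) = 4 * pi^2 * I2" "SI (\<lambda>u v. cs3 u v * nv u v) = - 4 * pi^2 * I3"
      unfolding 1 2 3 4 5 6 mult.assoc SI_cmult I1_def I2_def I3_def by (simp_all add: SI_zero)
  qed
  have m_mono: "m u v (1 - u - v) = s1 * mono3 3 1 1 u v + s2 * mono3 1 3 1 u v + s3 * mono3 1 1 3 u v" for u v
    unfolding m_def mono3_def by (simp add: algebra_simps power2_eq_square power3_eq_cube)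
  have expand: "SI (\<lambda>u v. g u v * n u v) = SI (\<lambda>u v. g u v * sn1 u v) + SI (\<lambda>u v. g u v * sn2 u v) + SI (\<lambda>u v. g u v * sn3 u v)
     + 2 * (s1 * SI (\<lambda>u v. g u v * mono3 3 1 1 u v) + s2 * SI (\<lambda>u v. g u v * mono3 1 3 1 u v) + s3 * SI (\<lambda>u v. g u v * mono3 1 1 3 u v))"
    if g: "cont2 g" for g
  proof -
    have "(\<lambda>u v. g u v * n u v) = (\<lambda>u v. g u v * sn1 u v + g u v * sn2 u v + g u v * sn3 u v
      + 2 * (s1 * (g u v * mono3 3 1 1 u v) + s2 * (g u v * mono3 1 3 1 u v) + s3 * (g u v * mono3 1 1 3 u v)))"
      unfolding n_def m_mono by (intro ext) (simp add: algebra_simps)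
    then show ?thesis using g by (simp add: SI_add SI_cmult cont2_add cont2_cmult cont2_mult cont2_sn cont2_mono3)
  qed
  have s3: "s2 + s3 = - s1" "s1 + s3 = - s2" "s1 + s2 = - s3" using sum by simp_all
  have I1: "I1 = 1/4 - 2 * sine_moment * s1"
    unfolding I1_def expand[OF cont2_sn(1)] SI_sn11 SI_sn12 SI_sn_rest SI_sn1_mono
    using arg_cong[OF s3(1), of "\<lambda>t. 2 * sine_moment * t"] by (simp add: algebra_simps)
  have I2: "I2 = 1/4 - 2 * sine_moment * s2"
    unfolding I2_def expand[OF cont2_sn(2)] SI_sn12 SI_sn_rest SI_sn2_mono SI_sn1_mono
    using arg_cong[OF s3(2), of "\<lambda>t. 2 * sine_moment * t"] by (simp add: algebra_simps)
  have I3: "I3 = 1/4 - 2 * sine_moment * s3"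
    unfolding I3_def expand[OF cont2_sn(3)] SI_sn12 SI_sn_rest SI_sn3_mono SI_sn1_mono
    using arg_cong[OF s3(3), of "\<lambda>t. 2 * sine_moment * t"] by (simp add: algebra_simps)
  have N: "SI (\<lambda>u v. (sine_trial s1 s2 s3 u v (1 - u - v))^2) = 3/4 + (s1^2 + s2^2 + s3^2) / 277200"
  proof -
    have "(\<lambda>u v. (sine_trial s1 s2 s3 u v (1 - u - v))^2) = (\<lambda>u v. sn1 u v * n u v + sn2 u v * n u v + sn3 u v * n u v + q0 u v)"
    proof (intro ext)
      fix u v
      have "sine_trial s1 s2 s3 u v (1 - u - v) = sn1 u v + sn2 u v + sn3 u v + m u v (1 - u - v)"
        by (simp add: sine_trial_def m_def sn1_def sn2_def sn3_def)
      then show "(sine_trial s1 s2 s3 u v (1 - u - v))^2 = sn1 u v * n u v + sn2 u v * n u v + sn3 u v * n u v + q0 u v"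
        unfolding n_def q0_def by (simp add: power2_eq_square algebra_simps)
    qed
    then have "SI (\<lambda>u v. (sine_trial s1 s2 s3 u v (1 - u - v))^2) = I1 + I2 + I3 + SI q0"
      by (simp add: SI_add cont2_add cont2_mult cont2_sn jn jq I1_def I2_def I3_def)
    also have "\<dots> = 3/4 - 2 * sine_moment * (s1 + s2 + s3) + SI q0" unfolding I1 I2 I3 by (simp add: algebra_simps)
    finally show ?thesis unfolding sum Jq0 by simp
  qed
  have sb: "sine_trial1 s1 s2 s3 u v (1 - u - v) = cs1 u v + m1 u v (1 - u - v)"
    "sine_trial2 s1 s2 s3 u v (1 - u - v) = cs2 u v + m2 u v (1 - u - v)"
    "sine_trial3 s1 s2 s3 u v (1 - u - v) = cs3 u v + m3 u v (1 - u - v)" for u v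
    by (simp_all add: sine_trial1_def sine_trial2_def sine_trial3_def cs1_def cs2_def cs3_def m1_def m2_def m3_def)
  note jall = SI_add SI_cmult cont2_add cont2_cmult cont2_mult cont2_sn jn jq
  have 1: "energy1 = 4 * pi^2 * I1 + SI q1"
  proof -
    have "(\<lambda>u v. (sine_trial1 s1 s2 s3 u v (1 - u - v) - sine_trial2 s1 s2 s3 u v (1 - u - v)) * (sine_trial1 s1 s2 s3 u v (1 - u - v) - sine_trial3 s1 s2 s3 u v (1 - u - v))) =
      (\<lambda>u v. cs1 u v * nu u v + (-1/2) * (cs1 u v * nv u v) + (-1/2) * (cs2 u v * nu u v) + (-1/2) * (cs3 u v * nu u v) + (1/2) * (cs3 u v * nv u v) + q1 u v)"
      unfolding sb nu_def nv_def q1_def by (intro ext) (simp add: field_simps)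
    then show ?thesis by (simp only: jall parts, simp?)
  qed
  have 2: "energy2 = 4 * pi^2 * I2 + SI q2"
  proof -
    have "(\<lambda>u v. (sine_trial2 s1 s2 s3 u v (1 - u - v) - sine_trial3 s1 s2 s3 u v (1 - u - v)) * (sine_trial2 s1 s2 s3 u v (1 - u - v) - sine_trial1 s1 s2 s3 u v (1 - u - v))) =
      (\<lambda>u v. cs2 u v * nv u v + (-1/2) * (cs2 u v * nu u v) + (-1/2) * (cs1 u v * nv u v) + (-1/2) * (cs3 u v * nv u v) + (1/2) * (cs3 u v * nu u v) + q2 u v)"
      unfolding sb nu_def nv_def q2_def by (intro ext) (simp add: field_simps)
    then show ?thesis by (simp only: jall parts, simp?)
  qed
  have 3: "energy3 = 4 * pi^2 * I3 + SI q3"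
  proof -
    have "(\<lambda>u v. (sine_trial3 s1 s2 s3 u v (1 - u - v) - sine_trial1 s1 s2 s3 u v (1 - u - v)) * (sine_trial3 s1 s2 s3 u v (1 - u - v) - sine_trial2 s1 s2 s3 u v (1 - u - v))) =
      (\<lambda>u v. (-1/2) * (cs3 u v * nv u v) + (1/2) * (cs1 u v * nv u v) + (-1/2) * (cs3 u v * nu u v) + (1/2) * (cs2 u v * nu u v) + q3 u v)"
      unfolding sb nu_def nv_def q3_def by (intro ext) (simp add: field_simps)
    then show ?thesis by (simp only: jall parts, simp?)
  qed
  show ?thesis
    using eigenvalue_le[OF D] unfolding N 1 2 3 Jq1 Jq2 Jq3 I1 I2 I3 X1_def[symmetric] X2_def[symmetric] X3_def[symmetric]
    by (simp add: algebra_simps)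
qed

section \<open>The upper bound\<close>

text \<open>With \<open>S\<close> and \<open>R\<close> as in the definition, this is \<open>(4 / 9) (a + b + c)^2\<close> times the denominator, minus the
numerator divided by \<open>\<pi>^2\<close>, of the quotient in \<open>near_equilateral_bound\<close>, both multiplied by \<open>S^2\<close>, for
coefficients \<open>120 x / S\<close>, \<open>120 y / S\<close>, \<open>120 z / S\<close>. The constants that involve \<open>\<pi>\<close> are replaced by rational
bounds on the safe side.\<close>

definition side_poly :: "real \<Rightarrow> real \<Rightarrow> real \<Rightarrow> real" where
  "side_poly a b c = (let S = a^2 + b^2 + c^2; x = 3 * a^2 - S; y = 3 * b^2 - S; z = 3 * c^2 - S; R = x^2 + y^2 + z^2 in
     (a + b + c)^2 / 3 * (S^2 + 16 / 231 * R) - S ^ 3 + 3 / 50 * S * R - 3 / 25 * (x * y * z))"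

lemma side_poly_sym: "side_poly a b c = side_poly b a c"
  by (simp add: side_poly_def Let_def algebra_simps)

text \<open>The side lengths are a combination of \<open>(1, 1, 1)\<close>, \<open>(2, 1, 1)\<close> and \<open>(3, 2, 1)\<close>. There are no terms with
\<open>t^6\<close> and \<open>t^5\<close>, since the polynomial vanishes to second order at the equilateral triangle.\<close>

lemma side_poly_cone1:
  assumes "0 \<le> t" "0 \<le> d" "0 \<le> e"
  shows "0 \<le> side_poly (t + 2 * d + 3 * e) (t + d + 2 * e) (t + d + e)"
proof -
  have "5775 * side_poly (t + 2 * d + 3 * e) (t + d + 2 * e) (t + d + e) = 19098 * t ^ 4 * d ^ 2 + 57294 * t ^ 4 * d * e + 57294 * t ^ 4 * e ^ 2 + 108684 * t ^ 3 * d ^ 3 + 489078 * t ^ 3 * d ^ 2 * e + 794646 * t ^ 3 * d * e ^ 2 + 458352 * t ^ 3 * e ^ 3 + 217117 * t ^ 2 * d ^ 4 + 1302702 * t ^ 2 * d ^ 3 * e + 3001551 * t ^ 2 * d ^ 2 * e ^ 2 + 3142494 * t ^ 2 * d * e ^ 3 + 1249893 * t ^ 2 * e ^ 4 + 181332 * t * d ^ 5 + 1359990 * t * d ^ 4 * e + 4076828 * t * d ^ 3 * e ^ 2 + 6105816 * t * d ^ 2 * e ^ 3 + 4546338 * t * d * e ^ 4 + 1332756 * t * e ^ 5 + 51444 * d ^ 6 + 462996 * d ^ 5 * e + 1703229 * d ^ 4 * e ^ 2 + 3274434 * d ^ 3 * e ^ 3 + 3441901 * d ^ 2 * e ^ 4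 + 1841196 * d * e ^ 5 + 375396 * e ^ 6"
    unfolding side_poly_def Let_def by algebra
  moreover have "\<dots> \<ge> 0" using assms by (intro add_nonneg_nonneg mult_nonneg_nonneg zero_le_power) auto
  ultimately show ?thesis by linarith
qed

text \<open>The same with \<open>(1, 1, 1)\<close>, \<open>(3, 2, 1)\<close> and \<open>(5, 5, 2)\<close>.\<close>

lemma side_poly_cone2:
  assumes "0 \<le> t" "0 \<le> d" "0 \<le> e"
  shows "0 \<le> side_poly (t + 3 * d + 5 * e) (t + 2 * d + 5 * e) (t + d + 2 * e)"
proof -
  have "1925 * side_poly (t + 3 * d + 5 * e) (t + 2 * d + 5 * e) (t + d + 2 * e) = 19098 * t ^ 4 * d ^ 2 + 57294 * t ^ 4 * d * e + 57294 * t ^ 4 * e ^ 2 + 152784 * t ^ 3 * d ^ 3 + 733194 * t ^ 3 * d ^ 2 * e + 1282878 * t ^ 3 * d * e ^ 2 + 855252 * t ^ 3 * e ^ 3 + 416631 * t ^ 2 * d ^ 4 + 2773782 * t ^ 2 * d ^ 3 * e + 7161093 * t ^ 2 * d ^ 2 * e ^ 2 + 8774622 * t ^ 2 * d * e ^ 3 + 4387311 * t ^ 2 * e ^ 4 + 444252 * t * d ^ 5 + 3783966 * t * d ^ 4 * e + 13005792 * t * d ^ 3 * e ^ 2 + 23068548 * t * d ^ 2 * e ^ 3 + 21597030 * t * d * e ^ 4 + 8638812 * t * e ^ 5 + 125132 * d ^ 6 + 1299684 * d ^ 5 * e + 5501991 * d ^ 4 * e ^ 2 + 12440898 * d ^ 3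 * e ^ 3 + 16311159 * d ^ 2 * e ^ 4 + 12108852 * d * e ^ 5 + 4036284 * e ^ 6"
    unfolding side_poly_def Let_def by algebra
  moreover have "\<dots> \<ge> 0" using assms by (intro add_nonneg_nonneg mult_nonneg_nonneg zero_le_power) auto
  ultimately show ?thesis by linarith
qed

text \<open>For \<open>b \<le> a\<close> the assumptions describe a cone with four extreme rays, \<open>(1, 1, 1)\<close>, \<open>(2, 1, 1)\<close>,
\<open>(3, 2, 1)\<close> and \<open>(5, 5, 2)\<close>; the plane \<open>2 b = a + c\<close> cuts it into the two cones above.\<close>

lemma side_poly_nonneg:
  assumes "c \<le> a" "c \<le> b" "a \<le> b + c" "b \<le> a + c" "a + b \<le> 5 * c"
  shows "0 \<le> side_poly a b c"
proof -
  have *: "0 \<le> side_poly a b c" if "c \<le> b" "b \<le> a" "a \<le> b + c" "a + b \<le> 5 * c" for a b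
  proof (cases "2 * b \<le> a + c")
    case True
    show ?thesis using side_poly_cone1[of "b + c - a" "a - 2 * b + c" "b - c"] that True by simp
  next
    case False
    have e: "(5 * c - a - b) / 3 + 3 * (a - b) + 5 * ((2 * b - a - c) / 3) = a"
      "(5 * c - a - b) / 3 + 2 * (a - b) + 5 * ((2 * b - a - c) / 3) = b"
      "(5 * c - a - b) / 3 + (a - b) + 2 * ((2 * b - a - c) / 3) = c" by argo+
    show ?thesis using side_poly_cone2[of "(5 * c - a - b) / 3" "a - b" "(2 * b - a - c) / 3"] that False unfolding e by simp
  qed
  show ?thesis
  proof (cases "b \<le> a")
    case True
    then show ?thesis using *[of b a] assms by simp
  next
    case False
    then show ?thesis using *[of a b] assms side_poly_sym[of a b c] by simp
  qed
qed

lemma pi_square_bounds: "986 / 100 \<le> pi^2" "pi^2 \<le> 988 / 100"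
proof -
  have "(3.1415 :: real)^2 \<le> pi^2" using pi_approx by (intro power_mono) auto
  then show "986 / 100 \<le> pi^2" by (simp add: power2_eq_square)
  have "pi^2 \<le> (3.1416 :: real)^2" using pi_approx by (intro power_mono) auto
  then show "pi^2 \<le> 988 / 100" by (simp add: power2_eq_square)
qed

lemma sine_moment_bound: "1 / 1280 \<le> sine_moment"
proof -
  have "pi ^ 5 \<le> (3.1416 :: real) ^ 5" using pi_approx by (intro power_mono) auto
  also have "(3.1416 :: real) ^ 5 \<le> 307" by (simp add: eval_nat_numeral)
  also have "(307::real) \<le> 80 * (986 / 100 - 6)" by simp
  also have "\<dots> \<le> 80 * (pi^2 - 6)" using pi_square_bounds(1) by (intro mult_left_mono diff_right_mono) auto
  finally have "pi ^ 5 \<le> 80 * (pi^2 - 6)" .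
  then have "1 / 1280 \<le> (pi^2 - 6) / (16 * pi ^ 5)" by (simp add: field_simps)
  also have "\<dots> = sine_moment" by (simp add: sine_moment_def field_simps power_mult_distrib eval_nat_numeral)
  finally show ?thesis .
qed

lemma triangle_eigenvalue_le_shortest:
  assumes nc: "\<not> collinear {p, q, r}" and sh: "dist p q \<le> dist q r" "dist p q \<le> dist r p"
  shows "triangle_eigenvalue p q r \<le> pi^2 * (triangle_perimeter p q r)^2 / (9 * (triangle_area p q r)^2)"
proof -
  define d where "d = cross2 (p - r) (q - r)"
  have D: "cross2 (p - r) (q - r) \<noteq> 0" using nc collinear_iff_cross2 by blast
  define a b c where "a = norm (q - r)" and "b = norm (r - p)" and "c = norm (p - q)"
  have abc: "c \<le> a" "c \<le> b" using sh by (simp_all add: a_def b_def c_def dist_norm)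
  have pos: "a > 0" "b > 0" "c > 0" using cross2_nz_imp[OF D] D
    by (auto simp: a_def b_def c_def cross2_def)
  have tri: "a \<le> b + c" "b \<le> a + c"
    using norm_triangle_ineq[of "q - p" "p - r"] norm_triangle_ineq[of "r - q" "q - p"]
    by (simp_all add: a_def b_def c_def norm_minus_commute)
  define L where "L = triangle_eigenvalue p q r * d^2"
  have "L \<le> 4 * pi^2 / 9 * (a + b + c)^2"
  proof (cases "a + b \<le> 5 * c")
    case False
    have "L \<le> 91 / 11 * (a^2 + b^2) + 2639 / 55 * c^2"
      using thin_triangle_bound[OF D] by (simp add: L_def d_def a_def b_def c_def)
    also have "a^2 + b^2 \<le> ((a + b)^2 + c^2) / 2"
    proof -
      have "(a - b)^2 \<le> c^2" using tri pos by (intro abs_le_square_iff[THEN iffD1]) auto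
      then show ?thesis by (simp add: power2_eq_square algebra_simps)
    qed
    also have "91 / 11 * (((a + b)^2 + c^2) / 2) + 2639 / 55 * c^2 \<le> 4 * (986 / 100) / 9 * (a + b + c)^2"
    proof -
      \<comment> \<open>As a polynomial in \<open>t\<close> and \<open>c\<close>, the difference of the two sides has nonnegative coefficients.\<close>
      define t where "t = a + b - 5 * c"
      have t: "t \<ge> 0" "a + b = 5 * c + t" using False by (simp_all add: t_def)
      have "4 * (986 / 100) / 9 * (a + b + c)^2 - (91 / 11 * (((a + b)^2 + c^2) / 2) + 2639 / 55 * c^2) =
        1217 / 4950 * (t * t) + 27777 / 2475 * (t * c) + 5526 / 2475 * (c * c)"
        unfolding t(2) by (simp add: power2_eq_square field_simps)
      also have "\<dots> \<ge> 0" using t pos by (intro add_nonneg_nonneg mult_nonneg_nonneg) auto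
      finally show ?thesis by simp
    qed
    also have "\<dots> \<le> 4 * pi^2 / 9 * (a + b + c)^2"
      using pi_square_bounds by (intro mult_right_mono) auto
    finally show ?thesis by simp
  next
    case True
    define X1 X2 X3 where "X1 = a^2" and "X2 = b^2" and "X3 = c^2"
    define S where "S = X1 + X2 + X3"
    define x y z where "x = 3 * X1 - S" and "y = 3 * X2 - S" and "z = 3 * X3 - S"
    define R where "R = x^2 + y^2 + z^2"
    define W where "W = 19 * S * R / 151200 + x * y * z / 12600"
    have Xpos: "X1 > 0" "X2 > 0" "X3 > 0" using pos by (simp_all add: X1_def X2_def X3_def)
    have S: "S > 0" using Xpos by (simp add: S_def)
    have sum: "x + y + z = 0" by (simp add: x_def y_def z_def S_def)
    have R0: "R \<ge> 0" by (simp add: R_def)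
    \<comment> \<open>The optimum to second order at the equilateral triangle would be about 133.\<close>
    define k where "k = 120 / S"
    have A: "L * (3 / 4 + ((k * x)^2 + (k * y)^2 + (k * z)^2) / 277200) \<le>
      pi^2 * S - 8 * pi^2 * sine_moment * (X1 * (k * x) + X2 * (k * y) + X3 * (k * z))
      + (X1 * (((k * x)^2 - k * x * (k * y) - k * x * (k * z)) / 25200 + ((k * y)^2 + k * y * (k * z) + (k * z)^2) / 5040)
      + X2 * (((k * y)^2 - k * y * (k * x) - k * y * (k * z)) / 25200 + ((k * x)^2 + k * x * (k * z) + (k * z)^2) / 5040)
      + X3 * (((k * z)^2 - k * z * (k * x) - k * z * (k * y)) / 25200 + ((k * x)^2 + k * x * (k * y) + (k * y)^2) / 5040))"
      using near_equilateral_bound[OF D, of "k * x" "k * y" "k * z"] sum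
      unfolding S_def X1_def X2_def X3_def a_def b_def c_def L_def d_def
      by (simp add: distrib_left[symmetric] add.assoc)
    have e1: "(k * x)^2 + (k * y)^2 + (k * z)^2 = k^2 * R" by (simp add: R_def power_mult_distrib algebra_simps)
    have e2: "X1 * (k * x) + X2 * (k * y) + X3 * (k * z) = k * R / 3"
    proof -
      have "X1 * x + X2 * y + X3 * z = R / 3"
        unfolding R_def x_def y_def z_def S_def by (simp add: power2_eq_square algebra_simps)
      then have "k * (X1 * x + X2 * y + X3 * z) = k * (R / 3)" by simp
      then show ?thesis by (simp add: algebra_simps)
    qed
    have e3: "X1 * (((k * x)^2 - k * x * (k * y) - k * x * (k * z)) / 25200 + ((k * y)^2 + k * y * (k * z) + (k * z)^2) / 5040)
      + X2 * (((k * y)^2 - k * y * (k * x) - k * y * (k * z)) / 25200 + ((k * x)^2 + k * x * (k * z) + (k * z)^2) / 5040)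
      + X3 * (((k * z)^2 - k * z * (k * x) - k * z * (k * y)) / 25200 + ((k * x)^2 + k * x * (k * y) + (k * y)^2) / 5040) = k^2 * W"
      unfolding W_def R_def x_def y_def z_def S_def by algebra
    have "L * (3 / 4 + k^2 * R / 277200) \<le> pi^2 * S - 8 * pi^2 * sine_moment * (k * R / 3) + k^2 * W"
      using A unfolding e1 e2 e3 .
    then have "S^2 * (L * (3 / 4 + k^2 * R / 277200)) \<le> S^2 * (pi^2 * S - 8 * pi^2 * sine_moment * (k * R / 3) + k^2 * W)"
      by (intro mult_left_mono) auto
    moreover have "S^2 * (L * (3 / 4 + k^2 * R / 277200)) = L * (3 / 4 * S^2 + 4 / 77 * R)"
      using S by (simp add: k_def field_simps power2_eq_square)
    moreover have "S^2 * (pi^2 * S - 8 * pi^2 * sine_moment * (k * R / 3) + k^2 * W) = pi^2 * S ^ 3 - 320 * pi^2 * sine_moment * (S * R) + 14400 * W"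
      using S by (simp add: k_def field_simps power2_eq_square power3_eq_cube)
    ultimately have 1: "L * (3 / 4 * S^2 + 4 / 77 * R) \<le> pi^2 * S ^ 3 - 320 * pi^2 * sine_moment * (S * R) + 14400 * W" by simp
    have W0: "W \<ge> 0"
    proof -
      have "\<bar>x * y * z\<bar> \<le> R / 2 * (2 * S)"
        unfolding abs_mult[of "x * y"]
      proof (rule mult_mono)
        have "0 \<le> (\<bar>x\<bar> - \<bar>y\<bar>)^2" by simp
        then have "2 * (\<bar>x\<bar> * \<bar>y\<bar>) \<le> x^2 + y^2" by (simp add: power2_eq_square algebra_simps)
        also have "\<dots> \<le> R" by (simp add: R_def)
        finally show "\<bar>x * y\<bar> \<le> R / 2" by (simp add: abs_mult)
        show "\<bar>z\<bar> \<le> 2 * S" using Xpos by (simp add: z_def S_def)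
      qed (use R0 in auto)
      then have "- (S * R) \<le> x * y * z" by (simp add: algebra_simps)
      moreover have "0 \<le> S * R" using S R0 by simp
      ultimately show ?thesis unfolding W_def by (simp add: field_simps)
    qed
    have 2: "14400 * W \<le> 1512 * pi^2 * W" using W0 pi_square_bounds by (intro mult_right_mono) auto
    have 3: "pi^2 * (1 / 4) * (S * R) \<le> 320 * pi^2 * sine_moment * (S * R)"
      using sine_moment_bound S R0 by (intro mult_right_mono) auto
    have "0 \<le> side_poly a b c" by (rule side_poly_nonneg) (use abc tri True in auto)
    then have "0 \<le> (a + b + c)^2 / 3 * (S^2 + 16 / 231 * R) - S ^ 3 + 3 / 50 * S * R - 3 / 25 * (x * y * z)"
      unfolding side_poly_def Let_def R_def x_def y_def z_def S_def X1_def X2_def X3_def .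
    also have "\<dots> = 4 / 9 * (a + b + c)^2 * (3 / 4 * S^2 + 4 / 77 * R) - (S ^ 3 - 1 / 4 * (S * R) + 1512 * W)"
      unfolding W_def by (simp add: field_simps)
    finally have "pi^2 * (S ^ 3 - 1 / 4 * (S * R) + 1512 * W) \<le> pi^2 * (4 / 9 * (a + b + c)^2 * (3 / 4 * S^2 + 4 / 77 * R))"
      by (intro mult_left_mono) auto
    then have "L * (3 / 4 * S^2 + 4 / 77 * R) \<le> (4 * pi^2 / 9 * (a + b + c)^2) * (3 / 4 * S^2 + 4 / 77 * R)"
      using 1 2 3 by (simp add: algebra_simps)
    moreover have "0 < 3 / 4 * S^2 + 4 / 77 * R" using S R0 by (intro add_pos_nonneg) auto
    ultimately show ?thesis by (rule mult_right_le_imp_le)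
  qed
  moreover have "d^2 > 0" using D by (simp add: d_def)
  ultimately have "triangle_eigenvalue p q r \<le> 4 * pi^2 / 9 * (a + b + c)^2 / d^2"
    by (simp add: L_def pos_le_divide_eq)
  also have "a + b + c = triangle_perimeter p q r"
    by (simp add: triangle_perimeter_def a_def b_def c_def dist_norm)
  also have "4 * pi^2 / 9 * (triangle_perimeter p q r)^2 / d^2 = pi^2 * (triangle_perimeter p q r)^2 / (9 * (triangle_area p q r)^2)"
    by (simp add: triangle_area_eq d_def[symmetric] power_divide)
  finally show ?thesis .
qed

lemma triangle_eigenvalue_le:
  assumes nc: "\<not> collinear {p, q, r}"
  shows "triangle_eigenvalue p q r \<le> pi^2 * (triangle_perimeter p q r)^2 / (9 * (triangle_area p q r)^2)"
proof -
  have e: "{q, r, p} = {p, q, r}" "{r, p, q} = {p, q, r}" by auto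
  have per: "triangle_perimeter q r p = triangle_perimeter p q r" "triangle_perimeter r p q = triangle_perimeter p q r"
    by (simp_all add: triangle_perimeter_def)
  have area: "triangle_area q r p = triangle_area p q r" "triangle_area r p q = triangle_area p q r"
    unfolding triangle_area_def e by simp_all
  have ev: "triangle_eigenvalue q r p = triangle_eigenvalue p q r" "triangle_eigenvalue r p q = triangle_eigenvalue p q r"
    unfolding triangle_eigenvalue_def e by simp_all
  consider "dist p q \<le> dist q r \<and> dist p q \<le> dist r p" | "dist q r \<le> dist r p \<and> dist q r \<le> dist p q"
    | "dist r p \<le> dist p q \<and> dist r p \<le> dist q r" by linarith
  then show ?thesis
  proof cases
    case 1
    then show ?thesis using triangle_eigenvalue_le_shortest[OF nc] by simp
  next
    case 2
    then show ?thesis using triangle_eigenvalue_le_shortest[of q r p] nc by (simp add: e per area ev)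
  next
    case 3
    then show ?thesis using triangle_eigenvalue_le_shortest[of r p q] nc by (simp add: e per area ev)
  qed
qed

section \<open>Optimality of the constants\<close>

lemma rect_integral:
  fixes \<alpha> \<beta> :: "real \<Rightarrow> real"
  assumes w: "w > 0" "h > 0" and c: "continuous_on UNIV \<alpha>" "continuous_on UNIV \<beta>"
  defines "A \<equiv> box 0 (vec2 w h)"
  shows "integrable lborel (\<lambda>x. indicator A x * (\<alpha> (x$1 / w) * \<beta> (x$2 / h)))"
    and "(LINT x|lborel. indicator A x * (\<alpha> (x$1 / w) * \<beta> (x$2 / h))) =
      w * h * ((LINT u|lborel. indicator {0<..<1} u * \<alpha> u) * (LINT v|lborel. indicator {0<..<1} v * \<beta> v))"
proof -
  show i: "integrable lborel (\<lambda>x. indicator A x * (\<alpha> (x$1 / w) * \<beta> (x$2 / h)))"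
    unfolding A_def using w
    by (intro integrable_indicator_bounded continuous_intros continuous_on_compose2[OF c(1)] continuous_on_compose2[OF c(2)]) auto
  interpret chart 0 "vec2 w 0" "vec2 0 h" "w * h" using w by unfold_locales auto
  have e: "indicator A (0 + u *\<^sub>R vec2 w 0 + v *\<^sub>R vec2 0 h) = (indicator {0<..<1} u * indicator {0<..<1} v :: real)" for u v
    using w by (auto simp: A_def box_real2 indicator_def zero_less_mult_iff)
  have "(LINT x|lborel. indicator A x * (\<alpha> (x$1 / w) * \<beta> (x$2 / h))) =
    w * h * (LINT u|lborel. LINT v|lborel. (indicator {0<..<1} u * \<alpha> u) * (indicator {0<..<1} v * \<beta> v))"
    unfolding integral_chart_iterated(2)[OF i] e using w by (simp add: mult_ac)
  then show "(LINT x|lborel. indicator A x * (\<alpha> (x$1 / w) * \<beta> (x$2 / h))) =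
      w * h * ((LINT u|lborel. indicator {0<..<1} u * \<alpha> u) * (LINT v|lborel. indicator {0<..<1} v * \<beta> v))"
    by simp
qed

lemma integral_sin_square: "(LINT u|lborel. indicator {0<..<1} u * (sin (pi * u))^2) = 1 / 2"
  and integral_cos_square: "(LINT u|lborel. indicator {0<..<1} u * (cos (pi * u))^2) = 1 / 2"
proof -
  have c: "(cos (pi * u))^2 = 1 - (sin (pi * u))^2" for u by (simp add: cos_squared_eq)
  have d: "((\<lambda>u. sin (pi * u) * cos (pi * u) / (2 * pi)) has_real_derivative ((cos (pi * u))^2 - (sin (pi * u))^2) / 2) (at u)" for u
    by (auto intro!: derivative_eq_intros simp: field_simps power2_eq_square)
  have "(LINT u|lborel. indicator {0<..<1} u * (sin (pi * u))^2) =
    (1 / 2 - sin (pi * 1) * cos (pi * 1) / (2 * pi)) - (0 / 2 - sin (pi * 0) * cos (pi * 0) / (2 * pi))"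
  proof (rule integral_Ioo_FTC[where F="\<lambda>u. u / 2 - sin (pi * u) * cos (pi * u) / (2 * pi)"])
    fix u
    have "((\<lambda>u. u / 2 - sin (pi * u) * cos (pi * u) / (2 * pi)) has_real_derivative 1 / 2 - ((cos (pi * u))^2 - (sin (pi * u))^2) / 2) (at u)"
      by (intro DERIV_diff d) (auto intro!: derivative_eq_intros)
    moreover have "1 / 2 - ((cos (pi * u))^2 - (sin (pi * u))^2) / 2 = (sin (pi * u))^2"
      by (simp add: c field_simps)
    ultimately show "((\<lambda>u. u / 2 - sin (pi * u) * cos (pi * u) / (2 * pi)) has_real_derivative (sin (pi * u))^2) (at u)" by simp
  qed (auto intro!: continuous_intros)
  then show "(LINT u|lborel. indicator {0<..<1} u * (sin (pi * u))^2) = 1 / 2" by simp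
  have "(LINT u|lborel. indicator {0<..<1} u * (cos (pi * u))^2) =
    (1 / 2 + sin (pi * 1) * cos (pi * 1) / (2 * pi)) - (0 / 2 + sin (pi * 0) * cos (pi * 0) / (2 * pi))"
  proof (rule integral_Ioo_FTC[where F="\<lambda>u. u / 2 + sin (pi * u) * cos (pi * u) / (2 * pi)"])
    fix u
    have "((\<lambda>u. u / 2 + sin (pi * u) * cos (pi * u) / (2 * pi)) has_real_derivative 1 / 2 + ((cos (pi * u))^2 - (sin (pi * u))^2) / 2) (at u)"
      by (intro DERIV_add d) (auto intro!: derivative_eq_intros)
    moreover have "1 / 2 + ((cos (pi * u))^2 - (sin (pi * u))^2) / 2 = (cos (pi * u))^2"
      by (simp add: c field_simps)
    ultimately show "((\<lambda>u. u / 2 + sin (pi * u) * cos (pi * u) / (2 * pi)) has_real_derivative (cos (pi * u))^2) (at u)" by simp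
  qed (auto intro!: continuous_intros)
  then show "(LINT u|lborel. indicator {0<..<1} u * (cos (pi * u))^2) = 1 / 2" by simp
qed

text \<open>The rectangle with sides \<open>w\<close> and \<open>h\<close> at the right angle lies in the triangle, and its first eigenfunction is
a product of two sines.\<close>

lemma right_triangle_eigenvalue_le:
  assumes N: "N > 0" and w: "w > 0" "h > 0" and fit: "w / N + h \<le> 1"
  shows "triangle_eigenvalue (vec2 N 0) (vec2 0 1) 0 \<le> pi^2 * (1 / w^2 + 1 / h^2)"
proof -
  let ?p = "vec2 N 0" and ?q = "vec2 0 1"
  have D: "cross2 (?p - 0) (?q - 0) \<noteq> 0" using N by (simp add: cross2_def)
  define T where "T = interior (convex hull {?p, ?q, 0})"
  have T: "T = {x. bary ?p ?q 0 x > 0 \<and> bary ?q 0 ?p x > 0 \<and> bary 0 ?p ?q x > 0}"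
    unfolding T_def by (rule interior_triangle[OF D])
  have b: "bary ?p ?q 0 x = x$1 / N" "bary ?q 0 ?p x = x$2" for x
    using N by (simp_all add: bary_def cross2_def)
  then have b3: "bary 0 ?p ?q x = 1 - x$1 / N - x$2" for x
    using bary_sum[OF D, of x] by simp
  define A where "A = box 0 (vec2 w h)"
  have sub: "A \<subseteq> T"
  proof
    fix x assume "x \<in> A"
    then have x: "0 < x$1" "x$1 < w" "0 < x$2" "x$2 < h" by (auto simp: A_def box_real2)
    have "x$1 / N < w / N" using x N by (simp add: divide_strict_right_mono)
    then show "x \<in> T" using x N fit by (simp add: T b b3)
  qed
  define f where "f x = sin (pi / w * (axis 1 1 \<bullet> x)) * sin (pi / h * (axis 2 1 \<bullet> x))" for x :: "real^2"
  have f: "smooth f" unfolding f_def by (intro smooth_mult smooth_sin smooth_const smooth_inner)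
  have feq: "f x = sin (pi * (x$1 / w)) * sin (pi * (x$2 / h))" for x by (simp add: f_def inner_axis')
  have grad: "gradient f x = vec2 (pi / w * cos (pi * (x$1 / w)) * sin (pi * (x$2 / h))) (pi / h * sin (pi * (x$1 / w)) * cos (pi * (x$2 / h)))" for x
  proof (rule gradient_eqI)
    show "(f has_derivative (\<bullet>) (vec2 (pi / w * cos (pi * (x$1 / w)) * sin (pi * (x$2 / h))) (pi / h * sin (pi * (x$1 / w)) * cos (pi * (x$2 / h))))) (at x)"
      unfolding f_def
      by (rule derivative_eq_intros refl)+ (simp add: fun_eq_iff inner_real2 inner_axis' axis_def algebra_simps)
  qed
  have zero: "f x = 0" if "x \<in> frontier A" for x
  proof -
    have "closed {x :: real^2. 0 \<le> x$1 \<and> x$1 \<le> w \<and> 0 \<le> x$2 \<and> x$2 \<le> h}"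
      by (intro closed_Collect_conj closed_Collect_le continuous_intros)
    then have "closure A \<subseteq> {x :: real^2. 0 \<le> x$1 \<and> x$1 \<le> w \<and> 0 \<le> x$2 \<and> x$2 \<le> h}"
      by (intro closure_minimal) (auto simp: A_def box_real2)
    moreover have "x \<in> closure A" "x \<notin> A" using that by (auto simp: frontier_def A_def interior_open[OF open_box])
    ultimately have "x$1 = 0 \<or> x$1 = w \<or> x$2 = 0 \<or> x$2 = h"
      by (auto simp: A_def box_real2)
    then show ?thesis using w by (auto simp: feq)
  qed
  have le: "triangle_eigenvalue ?p ?q 0 * (LINT x|lborel. indicator A x * (f x)^2) \<le> (LINT x|lborel. indicator A x * (norm (gradient f x))^2)"
    unfolding triangle_eigenvalue_def T_def[symmetric]
    by (rule first_eigenvalue_le[OF f _ _ sub _ zero]) (auto simp: A_def T_def)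
  have s: "continuous_on UNIV (\<lambda>u. (sin (pi * u))^2)" "continuous_on UNIV (\<lambda>u. (cos (pi * u))^2)"
    by (intro continuous_intros)+
  have 1: "(LINT x|lborel. indicator A x * (f x)^2) = w * h / 4"
    using rect_integral(2)[OF w s(1) s(1)] by (simp add: feq A_def power_mult_distrib integral_sin_square)
  note i = rect_integral(1)[OF w s(2) s(1), folded A_def] rect_integral(1)[OF w s(1) s(2), folded A_def]
  note I = rect_integral(2)[OF w s(2) s(1), folded A_def, unfolded integral_sin_square integral_cos_square]
    rect_integral(2)[OF w s(1) s(2), folded A_def, unfolded integral_sin_square integral_cos_square]
  have 2: "(LINT x|lborel. indicator A x * (norm (gradient f x))^2) = pi^2 * (1 / w^2 + 1 / h^2) * (w * h / 4)"
  proof -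
    have "(LINT x|lborel. indicator A x * (norm (gradient f x))^2) =
      (LINT x|lborel. (pi / w)^2 * (indicator A x * ((cos (pi * (x$1 / w)))^2 * (sin (pi * (x$2 / h)))^2))
        + (pi / h)^2 * (indicator A x * ((sin (pi * (x$1 / w)))^2 * (cos (pi * (x$2 / h)))^2)))"
      by (intro Bochner_Integration.integral_cong refl) (simp add: grad norm_real2 power_mult_distrib power_divide algebra_simps)
    also have "\<dots> = (pi / w)^2 * (w * h * (1/2 * (1/2))) + (pi / h)^2 * (w * h * (1/2 * (1/2)))"
      by (simp only: Bochner_Integration.integral_add integrable_mult_right integral_mult_right_zero i I)
    finally show ?thesis by (simp add: power_divide algebra_simps)
  qed
  have "0 < w * h / 4" using w by simp
  then show ?thesis using le unfolding 1 2 by (rule mult_right_le_imp_le[rotated])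
qed

text \<open>For a right triangle with legs 1 and \<open>N\<close>, the quotient of the perimeter and the area is at least 4, while
the eigenvalue is close to \<open>\<pi>^2\<close> if \<open>N\<close> is large.\<close>

lemma lower_bound_sharp:
  assumes c: "0 < c" "c < 16"
  shows "\<exists>p q r :: real^2. \<not> collinear {p, q, r} \<and>
    triangle_eigenvalue p q r < pi^2 * (triangle_perimeter p q r)^2 / (c * (triangle_area p q r)^2)"
proof -
  define s where "s = sqrt c / 4"
  have s2: "s^2 = c / 16" using c by (simp add: s_def power_divide)
  have s: "0 < s" "s < 1"
  proof -
    show "0 < s" using c by (simp add: s_def)
    have "sqrt c < sqrt 16" using c by (intro real_sqrt_less_mono) auto
    then show "s < 1" by (simp add: s_def)
  qed
  \<comment> \<open>The rectangle has height \<open>h < 1\<close> with \<open>1 / h^2 < 16 / c\<close>; the width \<open>w\<close> makes up for the rest.\<close>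
  define h where "h = (1 + s) / 2"
  have h: "0 < h" "h < 1" "s < h" using s by (simp_all add: h_def)
  have "s^2 < h^2" using s h by (intro power_strict_mono) auto
  then have gap: "1 / h^2 < 16 / c" using s2 c h by (simp add: field_simps)
  define g where "g = 16 / c - 1 / h^2"
  have g: "g > 0" using gap by (simp add: g_def)
  define w where "w = 1 / sqrt g + 1"
  have w: "w > 0" using g by (simp add: w_def add_pos_pos)
  have "1 / w < sqrt g"
  proof -
    have "1 / sqrt g < w" by (simp add: w_def)
    then show ?thesis using g w by (simp add: field_simps)
  qed
  then have "(1 / w)^2 < (sqrt g)^2" using w by (intro power_strict_mono) auto
  then have wg: "1 / w^2 < g" using g by (simp add: power_divide)
  define N where "N = w / (1 - h)"
  have N: "N > 0" using w h by (simp add: N_def)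
  let ?p = "vec2 N 0" and ?q = "vec2 0 1" and ?r = "0 :: real^2"
  have cr: "cross2 (?p - ?r) (?q - ?r) = N" by (simp add: cross2_def)
  have nc: "\<not> collinear {?p, ?q, ?r}" using collinear_iff_cross2 cr N by simp
  have area: "triangle_area ?p ?q ?r = N / 2" unfolding triangle_area_eq cr using N by simp
  have per: "2 * N \<le> triangle_perimeter ?p ?q ?r"
  proof -
    have n: "norm ?p = N" using N norm_real2[of ?p] by (simp add: power2_eq_iff_nonneg)
    have "norm ?p \<le> norm ?q + norm (?p - ?q)" using norm_triangle_ineq[of ?q "?p - ?q"] by simp
    then show ?thesis using n by (simp add: triangle_perimeter_def dist_norm)
  qed
  have "triangle_eigenvalue ?p ?q ?r \<le> pi^2 * (1 / w^2 + 1 / h^2)"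
    by (rule right_triangle_eigenvalue_le[OF N w h(1)]) (use w h in \<open>simp add: N_def\<close>)
  also have "\<dots> < pi^2 * (16 / c)" using wg by (intro mult_strict_left_mono) (auto simp: g_def)
  also have "\<dots> = pi^2 * (2 * N)^2 / (c * (N / 2)^2)" using N c by (simp add: field_simps power2_eq_square)
  also have "\<dots> \<le> pi^2 * (triangle_perimeter ?p ?q ?r)^2 / (c * (triangle_area ?p ?q ?r)^2)"
    unfolding area using per N c by (intro divide_right_mono mult_left_mono power_mono) auto
  finally show ?thesis using nc by blast
qed

text \<open>\<open>V\<close> is the derivative along \<open>g\<close> of \<open>\<phi>^2 cot (\<pi> l)\<close>, where \<open>l\<close> is the affine function \<open>g \<bullet> x + c\<close>. The poles of
the cotangent stay away from the support of \<open>\<phi>\<close>.\<close>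

lemma cot_field_integral:
  fixes \<phi> :: "real^2 \<Rightarrow> real"
  assumes s: "smooth \<phi>" and K: "compact K" "\<And>x. x \<notin> K \<Longrightarrow> \<phi> x = 0" "\<And>x. x \<notin> K \<Longrightarrow> gradient \<phi> x = 0"
    and l: "\<And>x. x \<in> K \<Longrightarrow> 0 < g \<bullet> x + c \<and> g \<bullet> x + c < 1"
  defines "V \<equiv> \<lambda>x. 2 * \<phi> x * (gradient \<phi> x \<bullet> g) * cot (pi * (g \<bullet> x + c)) - pi * (1 + (cot (pi * (g \<bullet> x + c)))^2) * (g \<bullet> g) * (\<phi> x)^2"
  shows "integrable lborel V" "(LINT x|lborel. V x) = 0"
proof -
  define U where "U = {x. 0 < g \<bullet> x + c} \<inter> {x. g \<bullet> x + c < 1}"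
  have U: "open U" unfolding U_def by (intro open_Int open_Collect_less continuous_intros)
  have KU: "K \<subseteq> U" using l by (auto simp: U_def)
  have nz: "sin (pi * (g \<bullet> x + c)) \<noteq> 0" if "x \<in> U" for x
    using that sin_gt_zero[of "pi * (g \<bullet> x + c)"] by (auto simp: U_def)
  have op: "open (- K)" using K(1) by (simp add: compact_imp_closed open_Compl)
  have der: "((\<lambda>x. (\<phi> x)^2 * cot (pi * (g \<bullet> x + c))) has_derivative
    (\<lambda>h. 2 * \<phi> x * (gradient \<phi> x \<bullet> h) * cot (pi * (g \<bullet> x + c)) - pi * (1 + (cot (pi * (g \<bullet> x + c)))^2) * (g \<bullet> h) * (\<phi> x)^2)) (at x)" for x
  proof (cases "x \<in> K")
    case True
    have "((\<lambda>x. pi * (g \<bullet> x + c)) has_derivative (\<lambda>h. pi * (g \<bullet> h))) (at x)"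
      by (auto intro!: derivative_eq_intros)
    from has_derivative_compose[OF this cot_has_derivative[OF nz, unfolded has_field_derivative_def]] True KU
    have "((\<lambda>x. cot (pi * (g \<bullet> x + c))) has_derivative (\<lambda>h. - (1 + (cot (pi * (g \<bullet> x + c)))^2) * (pi * (g \<bullet> h)))) (at x)"
      by blast
    moreover have "((\<lambda>x. (\<phi> x)^2) has_derivative (\<lambda>h. 2 * \<phi> x * (gradient \<phi> x \<bullet> h))) (at x)"
      using has_derivative_power[OF smooth_gradient[OF s], of 2 x] by (simp add: mult_ac)
    ultimately show ?thesis
      by (rule has_derivative_eq_rhs[OF has_derivative_mult[rotated]]) (simp add: fun_eq_iff algebra_simps)
  next
    case False
    have "((\<lambda>_. 0) has_derivative (\<lambda>h. 0)) (at x)" by simp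
    then have "((\<lambda>x. (\<phi> x)^2 * cot (pi * (g \<bullet> x + c))) has_derivative (\<lambda>h. 0)) (at x)"
      by (rule has_derivative_transform_within_open[OF _ op]) (use False K(2) in auto)
    then show ?thesis using False K(2) by simp
  qed
  have "continuous_on U (\<lambda>x. cot (pi * (g \<bullet> x + c)))"
    unfolding cot_def using nz by (intro continuous_intros) auto
  then have cU: "continuous_on U V" unfolding V_def
    by (intro continuous_intros smooth_continuous[OF s] continuous_gradient[OF s])
  have "continuous_on (- K) V"
    by (rule continuous_on_eq[of _ "\<lambda>_. 0"]) (use K in \<open>auto simp: V_def\<close>)
  from continuous_on_open_Un[OF U op cU this] KU have cV: "continuous_on UNIV V"
    by (metis Compl_partition sup.orderE sup_commute Un_mono Un_UNIV_left subset_refl top.extremum_uniqueI)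
  show "integrable lborel V" "(LINT x|lborel. V x) = 0"
    by (rule integral_directional_derivative_compact_support[OF der, where e=g, OF _ cV K(1)]; use K(2) in \<open>simp add: V_def\<close>)+
qed

lemma cot_sum_pi:
  fixes a b c :: real
  assumes "a + b + c = pi" "sin a \<noteq> 0" "sin b \<noteq> 0" "sin c \<noteq> 0"
  shows "cot a * cot b + cot b * cot c + cot c * cot a = 1"
proof -
  have c: "c = pi - (a + b)" using assms(1) by simp
  have sc: "sin c = sin a * cos b + cos a * sin b" unfolding c by (simp add: sin_add)
  have cc: "cos c = sin a * sin b - cos a * cos b" unfolding c by (simp add: cos_add)
  have "cot a * cot b + cot b * cot c + cot c * cot a =
    (cos a * cos b * sin c + cos c * (sin a * cos b + cos a * sin b)) / (sin a * sin b * sin c)"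
    using assms(2-4) by (simp add: cot_def field_simps)
  also have "cos a * cos b * sin c + cos c * (sin a * cos b + cos a * sin b) = sin a * sin b * sin c"
    unfolding sc cc by (simp add: algebra_simps)
  finally show ?thesis using assms by simp
qed

text \<open>Let \<open>l1\<close>, \<open>l2\<close>, \<open>l3\<close> be the barycentric coordinates, with gradients \<open>g1\<close>, \<open>g2\<close>, \<open>g3\<close>. The eigenfunction
\<open>sin (\<pi> l1) sin (\<pi> l2) sin (\<pi> l3)\<close> has the logarithmic gradient \<open>\<pi> (cot (\<pi> l1) g1 + cot (\<pi> l2) g2 + cot (\<pi> l3) g3)\<close>.
The square of the norm of the gradient of \<open>\<phi>\<close> minus \<open>\<phi>\<close> times this field is expanded. The mixed terms are
derivatives that integrate to 0, up to multiples of \<open>\<phi>^2\<close>; as the cotangents satisfy \<open>cot_sum_pi\<close>, what is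
left is the eigenvalue times \<open>\<phi>^2\<close>.\<close>

lemma equilateral_eigenvalue_ge:
  "16 * pi^2 / 3 \<le> triangle_eigenvalue (vec2 1 0) (vec2 (1/2) (sqrt 3 / 2)) 0"
proof -
  let ?p = "vec2 1 0" and ?q = "vec2 (1/2) (sqrt 3 / 2)"
  have D: "cross2 (?p - 0) (?q - 0) \<noteq> 0" by (simp add: cross2_def)
  define T where "T = interior (convex hull {?p, ?q, 0})"
  have T: "T = {x. bary ?p ?q 0 x > 0 \<and> bary ?q 0 ?p x > 0 \<and> bary 0 ?p ?q x > 0}"
    unfolding T_def by (rule interior_triangle[OF D])
  define t where "t = 1 / sqrt 3"
  have t: "t * t = 1 / 3" by (simp add: t_def)
  have t': "sqrt 3 * t = 1" by (simp add: t_def)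
  define g1 g2 g3 where "g1 = vec2 1 (- t)" and "g2 = vec2 0 (2 * t)" and "g3 = vec2 (- 1) (- t)"
  have b: "bary ?p ?q 0 x = g1 \<bullet> x + 0" "bary ?q 0 ?p x = g2 \<bullet> x + 0" for x
    by (simp_all add: bary_def cross2_def g1_def g2_def inner_real2 t_def field_simps)
  have b3: "bary 0 ?p ?q x = g3 \<bullet> x + 1" for x
    using bary_sum[OF D, of x] unfolding b by (simp add: g1_def g2_def g3_def inner_real2)
  have gg: "g1 \<bullet> g1 = 4/3" "g2 \<bullet> g2 = 4/3" "g3 \<bullet> g3 = 4/3"
    using t by (simp_all add: g1_def g2_def g3_def inner_real2)
  have "16 * pi^2 / 3 \<le> first_dirichlet_eigenvalue T"
  proof (rule first_eigenvalue_ge)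
    show "open T" unfolding T_def by simp
    have "vec2 (1/2) (1 / (2 * sqrt 3)) \<in> T"
      unfolding T b b3 by (simp add: g1_def g2_def g3_def inner_real2 t_def)
    then show "T \<noteq> {}" by blast
    fix \<phi> assume tf: "test_function T \<phi>"
    note s = test_function_smooth[OF tf]
    obtain K where K: "compact K" "K \<subseteq> T" "\<And>x. x \<notin> K \<Longrightarrow> \<phi> x = 0" "\<And>x. x \<notin> K \<Longrightarrow> gradient \<phi> x = 0"
      using test_function_compact_support[OF tf] by blast
    define V where "V g c x = 2 * \<phi> x * (gradient \<phi> x \<bullet> g) * cot (pi * (g \<bullet> x + c)) - pi * (1 + (cot (pi * (g \<bullet> x + c)))^2) * (g \<bullet> g) * (\<phi> x)^2"
      for g :: "real^2" and c x
    have bs: "bary ?p ?q 0 x + bary ?q 0 ?p x + bary 0 ?p ?q x = 1" for x using bary_sum[OF D] .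
    have l: "0 < g1 \<bullet> x + 0 \<and> g1 \<bullet> x + 0 < 1" "0 < g2 \<bullet> x + 0 \<and> g2 \<bullet> x + 0 < 1" "0 < g3 \<bullet> x + 1 \<and> g3 \<bullet> x + 1 < 1"
      if "x \<in> K" for x
      using that K(2) bs[of x] unfolding T b b3 by auto
    have V: "integrable lborel (V g1 0)" "(LINT x|lborel. V g1 0 x) = 0" "integrable lborel (V g2 0)" "(LINT x|lborel. V g2 0 x) = 0"
      "integrable lborel (V g3 1)" "(LINT x|lborel. V g3 1 x) = 0"
      unfolding V_def by (rule cot_field_integral[OF s K(1,3,4)]; use l in blast)+
    have "0 = (LINT x|lborel. pi * (V g1 0 x + V g2 0 x + V g3 1 x))" using V by simp
    also have "\<dots> \<le> (LINT x|lborel. (norm (gradient \<phi> x))^2 - 16 * pi^2 / 3 * (\<phi> x)^2)"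
    proof (rule integral_mono)
      fix x
      show "pi * (V g1 0 x + V g2 0 x + V g3 1 x) \<le> (norm (gradient \<phi> x))^2 - 16 * pi^2 / 3 * (\<phi> x)^2"
      proof (cases "x \<in> K")
        case True
        define c1 c2 c3 where "c1 = cot (pi * (g1 \<bullet> x + 0))" and "c2 = cot (pi * (g2 \<bullet> x + 0))" and "c3 = cot (pi * (g3 \<bullet> x + 1))"
        have sn: "sin (pi * y) \<noteq> 0" if "0 < y \<and> y < 1" for y
          using that sin_gt_zero[of "pi * y"] by auto
        have cc: "c1 * c2 + c2 * c3 + c3 * c1 = 1"
          unfolding c1_def c2_def c3_def
        proof (rule cot_sum_pi)
          show "pi * (g1 \<bullet> x + 0) + pi * (g2 \<bullet> x + 0) + pi * (g3 \<bullet> x + 1) = pi"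
            using bs[of x] unfolding b b3 distrib_left[symmetric] by simp
        qed (rule sn, rule l[OF True])+
        define f G1 G2 where "f = \<phi> x" and "G1 = gradient \<phi> x $ 1" and "G2 = gradient \<phi> x $ 2"
        have "G1^2 + G2^2 - 16 * pi^2 / 3 * f^2
          - pi * ((2 * f * (G1 - t * G2) * c1 - pi * (1 + c1^2) * (4/3) * f^2)
            + (2 * f * (2 * t * G2) * c2 - pi * (1 + c2^2) * (4/3) * f^2)
            + (2 * f * (- G1 - t * G2) * c3 - pi * (1 + c3^2) * (4/3) * f^2))
          = (G1 - f * pi * (c1 - c3))^2 + (G2 - f * pi * t * (2 * c2 - c1 - c3))^2"
          using t cc by algebra
        then have "pi * ((2 * f * (G1 - t * G2) * c1 - pi * (1 + c1^2) * (4/3) * f^2)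
            + (2 * f * (2 * t * G2) * c2 - pi * (1 + c2^2) * (4/3) * f^2)
            + (2 * f * (- G1 - t * G2) * c3 - pi * (1 + c3^2) * (4/3) * f^2)) \<le> G1^2 + G2^2 - 16 * pi^2 / 3 * f^2"
          by (smt (verit) zero_le_power2)
        moreover have "V g1 0 x = 2 * f * (G1 - t * G2) * c1 - pi * (1 + c1^2) * (4/3) * f^2"
          "V g2 0 x = 2 * f * (2 * t * G2) * c2 - pi * (1 + c2^2) * (4/3) * f^2"
          "V g3 1 x = 2 * f * (- G1 - t * G2) * c3 - pi * (1 + c3^2) * (4/3) * f^2"
          unfolding V_def gg c1_def c2_def c3_def f_def G1_def G2_def
          by (simp_all add: inner_real2 g1_def g2_def g3_def mult_ac)
        ultimately show ?thesis unfolding norm_real2 G1_def G2_def f_def by simp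
      next
        case False
        then show ?thesis using K by (simp add: V_def)
      qed
    qed (use V test_function_integrable[OF tf] in auto)
    finally show "16 * pi^2 / 3 * (LINT x|lborel. (\<phi> x)^2) \<le> (LINT x|lborel. (norm (gradient \<phi> x))^2)"
      using test_function_integrable[OF tf] by simp
  qed simp
  then show ?thesis by (simp add: triangle_eigenvalue_def T_def)
qed

lemma upper_bound_sharp:
  assumes c: "9 < c"
  shows "\<exists>p q r :: real^2. \<not> collinear {p, q, r} \<and>
    triangle_eigenvalue p q r > pi^2 * (triangle_perimeter p q r)^2 / (c * (triangle_area p q r)^2)"
proof -
  let ?p = "vec2 1 0" and ?q = "vec2 (1/2) (sqrt 3 / 2)" and ?r = "0 :: real^2"
  have cr: "cross2 (?p - ?r) (?q - ?r) = sqrt 3 / 2" by (simp add: cross2_def)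
  have nc: "\<not> collinear {?p, ?q, ?r}" unfolding collinear_iff_cross2 cr by simp
  have area: "triangle_area ?p ?q ?r = sqrt 3 / 4" unfolding triangle_area_eq cr by simp
  have n: "norm x = 1" if "(x$1)^2 + (x$2)^2 = 1" for x :: "real^2"
    using that unfolding norm_real2[symmetric] by (simp add: power2_eq_1_iff) (metis abs_norm_cancel abs_1 abs_minus_cancel)
  have "norm (?p - ?q) = 1" "norm ?q = 1" "norm ?p = 1"
    by (rule n; simp add: power_divide)+
  then have per: "triangle_perimeter ?p ?q ?r = 3" by (simp add: triangle_perimeter_def dist_norm)
  have "pi^2 * 3^2 / (c * (sqrt 3 / 4)^2) = 48 * pi^2 / c" using c by (simp add: power_divide)
  also have "\<dots> < 48 * pi^2 / 9" using c by (intro divide_strict_left_mono) auto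
  also have "\<dots> = 16 * pi^2 / 3" by simp
  also have "\<dots> \<le> triangle_eigenvalue ?p ?q ?r" by (rule equilateral_eigenvalue_ge)
  finally have "pi^2 * (triangle_perimeter ?p ?q ?r)^2 / (c * (triangle_area ?p ?q ?r)^2) < triangle_eigenvalue ?p ?q ?r"
    unfolding per area .
  then show ?thesis using nc by blast
qed

section \<open>The sharp bounds\<close>

theorem theorem1p1:
  "(\<forall>p q r :: real ^ 2. \<not> collinear {p, q, r} \<longrightarrow>
      pi\<^sup>2 * (triangle_perimeter p q r)\<^sup>2 / (16 * (triangle_area p q r)\<^sup>2)
        \<le> triangle_eigenvalue p q r \<and>
      triangle_eigenvalue p q r
        \<le> pi\<^sup>2 * (triangle_perimeter p q r)\<^sup>2 / (9 * (triangle_area p q r)\<^sup>2)) \<and>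
   (\<forall>c :: real. c > 9 \<longrightarrow> (\<exists>p q r :: real ^ 2. \<not> collinear {p, q, r} \<and>
      triangle_eigenvalue p q r
        > pi\<^sup>2 * (triangle_perimeter p q r)\<^sup>2 / (c * (triangle_area p q r)\<^sup>2))) \<and>
   (\<forall>c :: real. 0 < c \<and> c < 16 \<longrightarrow> (\<exists>p q r :: real ^ 2. \<not> collinear {p, q, r} \<and>
      triangle_eigenvalue p q r
        < pi\<^sup>2 * (triangle_perimeter p q r)\<^sup>2 / (c * (triangle_area p q r)\<^sup>2)))"
  using triangle_eigenvalue_ge triangle_eigenvalue_le upper_bound_sharp lower_bound_sharp by blast

end
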